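(* Let $G=(S,T;E)$ be a bipartite graph with $S=\{s_1,\dots,s_n\}$, let $d\in\mathbb N$, let $b:S\cup T\to\mathbb Z_+\cup\{\infty\}$, and let $w:E\to\mathbb R_+$. Consider the linear program (LP1') \[ \max \sum_{e\in E} w_e x_e \quad\text{s.t.}\quad x\in\mathbb R_+^E,\qquad \sum_{e\in\Delta(v)}x_e\le b(v)\ \ \forall v\in S\cup T,\qquad \sum_{s\in R_d(s_i),\ st\in E} x_{st}\le 1\ \ \forall t\in T,\ \forall i\in\{1,\dots,n\}, \] where $R_d(s_i)=\{s_i,s_{i+1},\dots,s_{i+d-1}\}$ with indices taken modulo $n$. If $(2d-1)$ divides $|S|=n$, then the integrality gap of (LP1') for the weighted cyclic $d$-distance $b$-matching problem (i.e. the supremum of the ratio of the optimum of (LP1') to the maximum weight of a cyclic $d$-distance $b$-matching) is at most $2-\frac{1}{d}$, and this bound is tight. Furthermore, there exists a polynomial-time algorithm that, for such instances (with $(2d-1)\mid n$), outputs a cyclic $d$-distance $b$-matching whose weight is at least $\frac{1}{2-1/d}$ times the maximum weight of a cyclic $d$-distance $b$-matching.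
   Context: $G=(S,T;E)$ is a bipartite graph without loops or parallel edges; $\Delta(v)$ denotes the set of edges incident to $v$. Given $d\in\mathbb N$ and $b:S\cup T\to\mathbb Z_+\cup\{\infty\}$, an edge set $M\subseteq E$ is a cyclic $d$-distance $b$-matching if (1) every node $v\in S\cup T$ has degree at most $b(v)$ in $M$, and (2) whenever $s_it,s_jt\in M$ with $i\ne j$, both $|i-j|\ge d$ and $|i-j|\le n-d$ hold. The weighted cyclic $d$-distance $b$-matching problem asks for a maximum-weight cyclic $d$-distance $b$-matching with respect to $w$. *)

theory Defs
  imports Complex_Main "HOL-Library.Extended_Nat" "HOL-Library.Extended_Real"
    "HOL-Computational_Algebra.Polynomial"
begin

section \<open>Instances\<close>

text \<open>
  The two colour classes are S = {s_0, ..., s_(n-1)} and T = {t_0, ..., t_(m-1)}. Indices start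
  at 0, so that "indices modulo n" is just \<open>mod n\<close>; the distance conditions only involve
  differences of indices. The edge between s_i and t_j is the pair (i, j), so loops and
  parallel edges cannot occur.
\<close>

datatype node = SNode nat | TNode nat

record problem =
  num_S :: nat
  num_T :: nat
  edges :: "(nat \<times> nat) set"
  min_dist :: nat
  bound :: "node \<Rightarrow> enat"
  weight :: "nat \<times> nat \<Rightarrow> real"

definition valid_problem :: "problem \<Rightarrow> bool" where
  "valid_problem I \<longleftrightarrow>
     edges I \<subseteq> {..<num_S I} \<times> {..<num_T I} \<and> (\<forall>e\<in>edges I. 0 \<le> weight I e)"

definition nodes :: "problem \<Rightarrow> node set" where
  "nodes I = SNode ` {..<num_S I} \<union> TNode ` {..<num_T I}"

fun incident_edges :: "problem \<Rightarrow> node \<Rightarrow> (nat \<times> nat) set" where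
  "incident_edges I (SNode i) = {e \<in> edges I. fst e = i}"
| "incident_edges I (TNode j) = {e \<in> edges I. snd e = j}"

section \<open>Cyclic d-distance b-matchings\<close>

definition cyclic_matching :: "problem \<Rightarrow> (nat \<times> nat) set \<Rightarrow> bool" where
  "cyclic_matching I M \<longleftrightarrow>
     M \<subseteq> edges I \<and>
     (\<forall>v\<in>nodes I. enat (card (M \<inter> incident_edges I v)) \<le> bound I v) \<and>
     (\<forall>i j t. (i, t) \<in> M \<and> (j, t) \<in> M \<and> i \<noteq> j \<longrightarrow>
        int (min_dist I) \<le> \<bar>int i - int j\<bar> \<and>
        \<bar>int i - int j\<bar> \<le> int (num_S I) - int (min_dist I))"

definition matching_weight :: "problem \<Rightarrow> (nat \<times> nat) set \<Rightarrow> real" where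
  "matching_weight I M = (\<Sum>e\<in>M. weight I e)"

definition max_matching_weight :: "problem \<Rightarrow> real" where
  "max_matching_weight I = Max (matching_weight I ` {M. cyclic_matching I M})"

section \<open>The linear program and its integrality gap\<close>

definition window :: "problem \<Rightarrow> nat \<Rightarrow> nat set" where
  "window I i = {(i + k) mod num_S I | k. k < min_dist I}"

definition lp_feasible :: "problem \<Rightarrow> (nat \<times> nat \<Rightarrow> real) \<Rightarrow> bool" where
  "lp_feasible I x \<longleftrightarrow>
     (\<forall>e\<in>edges I. 0 \<le> x e) \<and>
     (\<forall>v\<in>nodes I. ereal (\<Sum>e\<in>incident_edges I v. x e) \<le> ereal_of_enat (bound I v)) \<and>
     (\<forall>t<num_T I. \<forall>i<num_S I. (\<Sum>e | e \<in> edges I \<and> snd e = t \<and> fst e \<in> window I i. x e) \<le> 1)"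

definition lp_optimum :: "problem \<Rightarrow> ereal" where
  "lp_optimum I = (SUP x\<in>{x. lp_feasible I x}. ereal (\<Sum>e\<in>edges I. weight I e * x e))"

text \<open>
  The instances with parameter d for which 2 d - 1 divides the size of S. As d is a natural
  number, d > 0 is needed for 2 d - 1 and 2 - 1 / d to have their usual meaning.
\<close>

definition divisible_problems :: "nat \<Rightarrow> problem set" where
  "divisible_problems d = {I. valid_problem I \<and> min_dist I = d \<and> 0 < d \<and> (2 * d - 1) dvd num_S I}"

definition gap_ratio :: "problem \<Rightarrow> ereal" where
  "gap_ratio I = lp_optimum I / ereal (max_matching_weight I)"

text \<open>
  In \<^typ>\<open>ereal\<close>, 0 / 0 = 0 and a / 0 = \<infinity> for a > 0. Hence an instance whose maximum matching
  weight is 0 does not affect the supremum if its LP optimum is 0 too, and would make the gap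
  infinite otherwise.
\<close>

definition integrality_gap :: "nat \<Rightarrow> ereal" where
  "integrality_gap d = (SUP I\<in>divisible_problems d. gap_ratio I)"

section \<open>A random-access machine language with running times\<close>

text \<open>
  The weights are real numbers, so algorithms are programs in the arithmetic model: a while
  language whose memory consists of two-dimensional arrays of natural numbers and of reals (a
  scalar is the cell with indices 0, 0). Array indices are computed, so there is indirect
  addressing. The only operations are addition, subtraction (truncated on natural numbers) and
  comparison. There are no conversions between the two kinds of numbers, no real constants other
  than rationals (an arbitrary real constant could act as an oracle), and no multiplication or
  division (with unit costs, repeated squaring would produce numbers of exponential length).
  So on rational inputs the bit length of the numbers that occur in a run of k steps is
  bounded by a polynomial in k and the bit length of the input, and polynomially many steps are
  polynomial time on a Turing machine as well.
\<close>

type_synonym vname = string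

record state =
  nmem :: "vname \<Rightarrow> nat \<Rightarrow> nat \<Rightarrow> nat"
  rmem :: "vname \<Rightarrow> nat \<Rightarrow> nat \<Rightarrow> real"

datatype nexp = NConst nat | NCell vname nexp nexp | NPlus nexp nexp | NMinus nexp nexp

datatype rexp = RConst rat | RCell vname nexp nexp | RPlus rexp rexp | RMinus rexp rexp

datatype bexp = NLess nexp nexp | RLess rexp rexp | BNot bexp | BAnd bexp bexp

datatype com =
    Skip
  | NAssign vname nexp nexp nexp
  | RAssign vname nexp nexp rexp
  | Seq com com
  | Cond bexp com com
  | While bexp com

fun nval :: "nexp \<Rightarrow> state \<Rightarrow> nat" where
  "nval (NConst k) s = k"
| "nval (NCell a i j) s = nmem s a (nval i s) (nval j s)"
| "nval (NPlus e f) s = nval e s + nval f s"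
| "nval (NMinus e f) s = nval e s - nval f s"

fun rval :: "rexp \<Rightarrow> state \<Rightarrow> real" where
  "rval (RConst q) s = of_rat q"
| "rval (RCell a i j) s = rmem s a (nval i s) (nval j s)"
| "rval (RPlus e f) s = rval e s + rval f s"
| "rval (RMinus e f) s = rval e s - rval f s"

fun bval :: "bexp \<Rightarrow> state \<Rightarrow> bool" where
  "bval (NLess e f) s \<longleftrightarrow> nval e s < nval f s"
| "bval (RLess e f) s \<longleftrightarrow> rval e s < rval f s"
| "bval (BNot p) s \<longleftrightarrow> \<not> bval p s"
| "bval (BAnd p q) s \<longleftrightarrow> bval p s \<and> bval q s"

definition update_cell :: "(vname \<Rightarrow> nat \<Rightarrow> nat \<Rightarrow> 'v) \<Rightarrow> vname \<Rightarrow> nat \<Rightarrow> nat \<Rightarrow> 'v \<Rightarrow> (vname \<Rightarrow> nat \<Rightarrow> nat \<Rightarrow> 'v)" where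
  "update_cell m a i j v = m(a := (m a)(i := (m a i)(j := v)))"

text \<open>
  \<open>exec c s k s'\<close>: started in state s, the program c terminates after k steps in state s'.
  Evaluating an expression is charged as part of the step that uses it; the expressions of a
  fixed program have constant size, so this affects running times by a constant factor only.
\<close>

inductive exec :: "com \<Rightarrow> state \<Rightarrow> nat \<Rightarrow> state \<Rightarrow> bool" where
  Skip: "exec Skip s 1 s"
| NAssign: "exec (NAssign a i j e) s 1
    (s\<lparr>nmem := update_cell (nmem s) a (nval i s) (nval j s) (nval e s)\<rparr>)"
| RAssign: "exec (RAssign a i j e) s 1
    (s\<lparr>rmem := update_cell (rmem s) a (nval i s) (nval j s) (rval e s)\<rparr>)"
| Seq: "exec c1 s k1 s1 \<Longrightarrow> exec c2 s1 k2 s2 \<Longrightarrow> exec (Seq c1 c2) s (k1 + k2) s2"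
| CondTrue: "bval p s \<Longrightarrow> exec c1 s k s1 \<Longrightarrow> exec (Cond p c1 c2) s (1 + k) s1"
| CondFalse: "\<not> bval p s \<Longrightarrow> exec c2 s k s1 \<Longrightarrow> exec (Cond p c1 c2) s (1 + k) s1"
| WhileFalse: "\<not> bval p s \<Longrightarrow> exec (While p c) s 1 s"
| WhileTrue: "bval p s \<Longrightarrow> exec c s k1 s1 \<Longrightarrow> exec (While p c) s1 k2 s2 \<Longrightarrow>
    exec (While p c) s (1 + k1 + k2) s2"

inductive_cases exec_cases:
  "exec Skip s k t" "exec (NAssign a i j e) s k t" "exec (RAssign a i j r) s k t"
  "exec (Seq c d) s k t" "exec (Cond p c d) s k t" "exec (While p c) s k t"

lemma exec_deterministic: "exec c s k s' \<Longrightarrow> exec c s k2 s2 \<Longrightarrow> k2 = k \<and> s2 = s'"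
proof (induction arbitrary: k2 s2 rule: exec.induct)
  case (Seq c1 s k1 s1 c2 k2' s2')
  from Seq.prems show ?case by (rule exec_cases) (metis Seq.IH)
next
  case (CondTrue p s c1 k s1 c2)
  from CondTrue.prems show ?case by (rule exec_cases) (use CondTrue in \<open>metis plus_1_eq_Suc\<close>)+
next
  case (CondFalse p s c2 k s1 c1)
  from CondFalse.prems show ?case by (rule exec_cases) (use CondFalse in \<open>metis plus_1_eq_Suc\<close>)+
next
  case (WhileTrue p s c k1 s1 k2' s2')
  from WhileTrue.prems show ?case
    by (rule exec_cases) (use WhileTrue in \<open>metis plus_1_eq_Suc add_Suc\<close>)+
qed (erule exec_cases, simp_all)+

section \<open>Input and output\<close>

fun finite_part :: "enat \<Rightarrow> nat" where
  "finite_part (enat k) = k"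
| "finite_part \<infinity> = 0"

text \<open>
  The degree bounds of S are in column 0 and those of T in column 1 of the arrays \<open>b\<close> (the
  value, if finite) and \<open>binf\<close> (1 if the value is infinite). Everything else is 0; in
  particular, weights of non-edges are not visible.
\<close>

definition input_state :: "problem \<Rightarrow> state" where
  "input_state I =
    \<lparr>nmem = (\<lambda>a i j.
       if a = ''n'' \<and> i = 0 \<and> j = 0 then num_S I
       else if a = ''m'' \<and> i = 0 \<and> j = 0 then num_T I
       else if a = ''d'' \<and> i = 0 \<and> j = 0 then min_dist I
       else if a = ''E'' \<and> (i, j) \<in> edges I then 1
       else if a = ''b'' \<and> i < num_S I \<and> j = 0 then finite_part (bound I (SNode i))
       else if a = ''b'' \<and> i < num_T I \<and> j = 1 then finite_part (bound I (TNode i))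
       else if a = ''binf'' \<and> i < num_S I \<and> j = 0 \<and> bound I (SNode i) = \<infinity> then 1
       else if a = ''binf'' \<and> i < num_T I \<and> j = 1 \<and> bound I (TNode i) = \<infinity> then 1
       else 0),
     rmem = (\<lambda>a i j. if a = ''w'' \<and> (i, j) \<in> edges I then weight I (i, j) else 0)\<rparr>"

definition output_edges :: "problem \<Rightarrow> state \<Rightarrow> (nat \<times> nat) set" where
  "output_edges I s = {(i, j). i < num_S I \<and> j < num_T I \<and> nmem s ''M'' i j \<noteq> 0}"

definition problem_size :: "problem \<Rightarrow> nat" where
  "problem_size I = num_S I + num_T I + card (edges I)"

end

theory Submission
  imports Defs
begin

text \<open>
  Let n = |S|. Cut the cyclic order of S, starting at some node h, into blocks of length 2 d - 1 and
  keep only the edges at the first d nodes of each block. Kept nodes of different blocks are at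
  distance at least d, and the kept nodes of one block lie in one window, so what remains is to choose
  edges subject to the degree bounds and to at most one edge between a block and a node of T. This is
  a minimum cost circulation problem; an optimal circulation with its node potentials is integral
  and certifies, by complementary slackness, that it is at least as good as every solution of the
  linear program on the kept edges. Each node is kept for d of the 2 d - 1 possible starting points,
  so the best of the matchings found has at least d / (2 d - 1) times the weight of any LP solution,
  in particular of any matching.

  The circulation is computed by inserting the edges one at a time. If the new edge has negative
  reduced cost -D, Dijkstra's algorithm computes the distances from its head, capped at D. Adding them
  to the potentials makes the reduced costs nonnegative again; if the tail is at distance less
  than D, one unit is sent around the cycle formed by the edge and a shortest path, and otherwise the
  edge stays unused.
\<close>

section \<open>Total correctness with running times\<close>

text \<open>The block length balances two needs: d - 1 dropped nodes are just enough to separate the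
  kept nodes of consecutive blocks, and d kept nodes are what one window inequality controls.
  Divisibility makes the last block complete, so the separation also holds across the cut. An LP
  solution restricted to the kept edges is therefore a fractional circulation, and the loss is the
  factor (2 d - 1) / d = 2 - 1 / d. A star with 2 d - 1 leaves attains it: any two leaves conflict,
  while the value 1 / d on each edge satisfies every window. Neither degree bounds nor weights are
  limited by the problem size, so the running time must not depend on them. With edges inserted as
  arcs of capacity 1, one augmentation per edge suffices; at the start all arcs cost 0 and the zero
  circulation is optimal. Since the machine cannot multiply or divide, node numbers and block
  boundaries are obtained by counting.\<close>

definition set_nat :: "state \<Rightarrow> vname \<Rightarrow> nat \<Rightarrow> nat \<Rightarrow> nat \<Rightarrow> state" where
  "set_nat s a i j v = s\<lparr>nmem := update_cell (nmem s) a i j v\<rparr>"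

definition set_real :: "state \<Rightarrow> vname \<Rightarrow> nat \<Rightarrow> nat \<Rightarrow> real \<Rightarrow> state" where
  "set_real s a i j v = s\<lparr>rmem := update_cell (rmem s) a i j v\<rparr>"

lemma mem_set [simp]:
  "nmem (set_nat s a i j v) a' i' j' = (if a' = a \<and> i' = i \<and> j' = j then v else nmem s a' i' j')"
  "rmem (set_nat s a i j v) = rmem s"
  "rmem (set_real s a i j r) a' i' j' = (if a' = a \<and> i' = i \<and> j' = j then r else rmem s a' i' j')"
  "nmem (set_real s a i j r) = nmem s"
  by (auto simp: set_nat_def set_real_def update_cell_def)

lemma array_set_other:
  "a' \<noteq> a \<Longrightarrow> nmem (set_nat s a i j v) a' = nmem s a'"
  "a' \<noteq> a \<Longrightarrow> rmem (set_real s a i j r) a' = rmem s a'"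
  by (auto simp: set_nat_def set_real_def update_cell_def)

fun nmods :: "com \<Rightarrow> vname set" where
  "nmods Skip = {}"
| "nmods (NAssign a i j e) = {a}"
| "nmods (RAssign a i j e) = {}"
| "nmods (Seq c d) = nmods c \<union> nmods d"
| "nmods (Cond p c d) = nmods c \<union> nmods d"
| "nmods (While p c) = nmods c"

fun rmods :: "com \<Rightarrow> vname set" where
  "rmods Skip = {}"
| "rmods (NAssign a i j e) = {}"
| "rmods (RAssign a i j e) = {a}"
| "rmods (Seq c d) = rmods c \<union> rmods d"
| "rmods (Cond p c d) = rmods c \<union> rmods d"
| "rmods (While p c) = rmods c"

text \<open>The frame condition is syntactic and concerns whole arrays. It composes along a run, so
  invariants need to mention only arrays that the loop writes.\<close>

definition unchanged :: "com \<Rightarrow> state \<Rightarrow> state \<Rightarrow> bool" where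
  "unchanged c s s' \<longleftrightarrow>
     (\<forall>a. a \<notin> nmods c \<longrightarrow> nmem s' a = nmem s a) \<and> (\<forall>a. a \<notin> rmods c \<longrightarrow> rmem s' a = rmem s a)"

lemma exec_unchanged: "exec c s k s' \<Longrightarrow> unchanged c s s'"
  by (induction rule: exec.induct) (auto simp: unchanged_def update_cell_def)

text \<open>Bounds the running time of a command all of whose loops make at most L iterations.\<close>

fun cost :: "nat \<Rightarrow> com \<Rightarrow> nat" where
  "cost L Skip = 1"
| "cost L (NAssign a i j e) = 1"
| "cost L (RAssign a i j e) = 1"
| "cost L (Seq c d) = cost L c + cost L d"
| "cost L (Cond p c d) = 1 + cost L c + cost L d"
| "cost L (While p c) = 1 + L * (1 + cost L c)"

text \<open>The program is fixed, so \<open>cost\<close> is built from the iteration bound by a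
  fixed number of sums and products. This turns an iteration bound that is polynomial in the input
  size into a polynomial running time.\<close>

lemma cost_polynomial: "\<exists>p::nat poly. \<forall>z. cost (poly q z) c = poly p z"
proof (induction c)
  case (Seq c d)
  then obtain p p' where "\<forall>z. cost (poly q z) c = poly p z" "\<forall>z. cost (poly q z) d = poly p' z"
    by auto
  then show ?case by (intro exI[of _ "p + p'"]) simp
next
  case (Cond b c d)
  then obtain p p' where "\<forall>z. cost (poly q z) c = poly p z" "\<forall>z. cost (poly q z) d = poly p' z"
    by auto
  then show ?case by (intro exI[of _ "1 + p + p'"]) simp
next
  case (While b c)
  then obtain p where "\<forall>z. cost (poly q z) c = poly p z" by auto
  then show ?case by (intro exI[of _ "1 + q * (1 + p)"]) simp
qed (auto intro: exI[of _ 1])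

text \<open>A total correctness statement in the style of weakest preconditions. The time bound
  depends only on \<open>L\<close> and the syntax of the command, so no invariant has to count
  steps.\<close>

definition run :: "nat \<Rightarrow> com \<Rightarrow> state \<Rightarrow> (state \<Rightarrow> bool) \<Rightarrow> bool" where
  "run L c s Q \<longleftrightarrow> (\<exists>k s'. exec c s k s' \<and> k \<le> cost L c \<and> Q s')"

lemma run_weaken: "run L c s Q \<Longrightarrow> (\<And>s'. unchanged c s s' \<Longrightarrow> Q s' \<Longrightarrow> Q' s') \<Longrightarrow> run L c s Q'"
  unfolding run_def using exec_unchanged by blast

lemma run_Skip: "Q s \<Longrightarrow> run L Skip s Q"
  unfolding run_def using exec.Skip by fastforce

lemma run_NAssign:
  "Q (set_nat s a (nval i s) (nval j s) (nval e s)) \<Longrightarrow> run L (NAssign a i j e) s Q"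
  unfolding run_def set_nat_def using exec.NAssign by fastforce

lemma run_RAssign:
  "Q (set_real s a (nval i s) (nval j s) (rval e s)) \<Longrightarrow> run L (RAssign a i j e) s Q"
  unfolding run_def set_real_def using exec.RAssign by fastforce

lemma run_Seq: "run L c s (\<lambda>s'. run L d s' Q) \<Longrightarrow> run L (Seq c d) s Q"
  unfolding run_def using exec.Seq by (metis add_le_mono cost.simps(4))

lemma run_Cond:
  assumes "bval p s \<Longrightarrow> run L c s Q" "\<not> bval p s \<Longrightarrow> run L d s Q"
  shows "run L (Cond p c d) s Q"
proof (cases "bval p s")
  case True
  with assms(1) obtain k s' where "exec c s k s'" "k \<le> cost L c" "Q s'" by (auto simp: run_def)
  with exec.CondTrue[OF True this(1), of d] show ?thesis
    unfolding run_def by (intro exI[of _ "1 + k"] exI[of _ s']) auto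
next
  case False
  with assms(2) obtain k s' where "exec d s k s'" "k \<le> cost L d" "Q s'" by (auto simp: run_def)
  with exec.CondFalse[OF False this(1), of c] show ?thesis
    unfolding run_def by (intro exI[of _ "1 + k"] exI[of _ s']) auto
qed

text \<open>The variant \<open>f\<close> starts at no more than \<open>L\<close> and drops in each
  round, which bounds the number of rounds. Body and exit may assume the frame condition relative to
  the state before the loop.\<close>

lemma run_While:
  fixes f :: "state \<Rightarrow> nat"
  assumes "Inv s" "f s \<le> L"
    and step: "\<And>s'. unchanged c s s' \<Longrightarrow> Inv s' \<Longrightarrow> bval p s' \<Longrightarrow>
      run L c s' (\<lambda>s''. Inv s'' \<and> f s'' < f s')"
    and fin: "\<And>s'. unchanged c s s' \<Longrightarrow> Inv s' \<Longrightarrow> \<not> bval p s' \<Longrightarrow> Q s'"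
  shows "run L (While p c) s Q"
proof -
  have "\<exists>k s2. exec (While p c) s1 k s2 \<and> k \<le> 1 + f s1 * (1 + cost L c) \<and> Q s2"
    if "Inv s1" "unchanged c s s1" for s1
    using that
  proof (induction "f s1" arbitrary: s1 rule: less_induct)
    case less
    show ?case
    proof (cases "bval p s1")
      case False
      then show ?thesis using fin[OF less.prems(2,1)] exec.WhileFalse[OF False, of c]
        by (intro exI[of _ 1] exI[of _ s1]) auto
    next
      case True
      from step[OF less.prems(2,1) True] obtain k s2 where
        1: "exec c s1 k s2" "k \<le> cost L c" "Inv s2" "f s2 < f s1"
        by (auto simp: run_def)
      have "unchanged c s s2"
        using exec_unchanged[OF 1(1)] less.prems by (simp add: unchanged_def)
      from less.hyps[OF 1(4,3) this] obtain k' s3 where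
        2: "exec (While p c) s2 k' s3" "k' \<le> 1 + f s2 * (1 + cost L c)" "Q s3" by blast
      \<comment> \<open>The drop of the variant by at least 1 pays for the round just
        executed.\<close>
      have "1 + k + k' \<le> 1 + (1 + f s2) * (1 + cost L c)" using 1 2 by simp
      also have "\<dots> \<le> 1 + f s1 * (1 + cost L c)"
        using 1(4) by (intro add_mono mult_right_mono) auto
      finally show ?thesis using exec.WhileTrue[OF True 1(1) 2(1)] 2(3) by blast
    qed
  qed
  from this[OF assms(1)] obtain k s2 where
    "exec (While p c) s k s2" "k \<le> 1 + f s * (1 + cost L c)" "Q s2"
    by (auto simp: unchanged_def)
  moreover have "1 + f s * (1 + cost L c) \<le> 1 + L * (1 + cost L c)"
    using assms(2) by (intro add_mono mult_right_mono) auto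
  ultimately show ?thesis unfolding run_def by (metis cost.simps(6) order_trans)
qed

section \<open>Counting loops\<close>

abbreviation nvar :: "vname \<Rightarrow> nexp" where
  "nvar a \<equiv> NCell a (NConst 0) (NConst 0)"

abbreviation rvar :: "vname \<Rightarrow> rexp" where
  "rvar a \<equiv> RCell a (NConst 0) (NConst 0)"

abbreviation nset :: "vname \<Rightarrow> nexp \<Rightarrow> com" where
  "nset a e \<equiv> NAssign a (NConst 0) (NConst 0) e"

abbreviation rset :: "vname \<Rightarrow> rexp \<Rightarrow> com" where
  "rset a e \<equiv> RAssign a (NConst 0) (NConst 0) e"

definition For :: "vname \<Rightarrow> nexp \<Rightarrow> com \<Rightarrow> com" where
  "For x e c = Seq (nset x (NConst 0))
     (While (NLess (nvar x) e) (Seq c (nset x (NPlus (nvar x) (NConst 1)))))"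

lemma mods_For [simp]: "nmods (For x e c) = insert x (nmods c)" "rmods (For x e c) = rmods c"
  by (auto simp: For_def)

text \<open>The invariant is indexed by the number of completed rounds, and the step establishes it
  in the state after the increment. The limit is evaluated anew in every round and must keep the
  value \<open>b\<close>.\<close>

lemma run_For:
  assumes "b \<le> L" "x \<notin> nmods c"
    and bound: "\<And>s'. unchanged (For x e c) s s' \<Longrightarrow> nval e s' = b"
    and init: "Inv 0 (set_nat s x 0 0 0)"
    and step: "\<And>k s'. unchanged (For x e c) s s' \<Longrightarrow> k < b \<Longrightarrow> Inv k s' \<Longrightarrow> nmem s' x 0 0 = k \<Longrightarrow>
      run L c s' (\<lambda>s''. Inv (Suc k) (set_nat s'' x 0 0 (Suc k)))"
    and fin: "\<And>s'. unchanged (For x e c) s s' \<Longrightarrow> Inv b s' \<Longrightarrow> Q s'"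
  shows "run L (For x e c) s Q"
  unfolding For_def
proof (intro run_Seq run_NAssign, simp only: nval.simps)
  let ?s = "set_nat s x 0 0 0" and ?I = "\<lambda>s'. nmem s' x 0 0 \<le> b \<and> Inv (nmem s' x 0 0) s'"
  let ?d = "Seq c (nset x (NPlus (nvar x) (NConst 1)))"
  have un: "unchanged (For x e c) s s'" if "unchanged ?d ?s s'" for s'
    using that by (auto simp: unchanged_def array_set_other)
  show "run L (While (NLess (nvar x) e) ?d) ?s Q"
  proof (rule run_While[of ?I ?s "\<lambda>s'. b - nmem s' x 0 0"])
    fix s' assume s': "unchanged ?d ?s s'" "?I s'" "bval (NLess (nvar x) e) s'"
    let ?k = "nmem s' x 0 0"
    have k: "?k < b" using s'(3) bound[OF un[OF s'(1)]] by simp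
    have "run L c s' (\<lambda>s''. Inv (Suc ?k) (set_nat s'' x 0 0 (Suc ?k)))"
      using step[OF un[OF s'(1)] k] s'(2) by simp
    then have "run L c s' (\<lambda>s''. Inv (Suc ?k) (set_nat s'' x 0 0 (Suc ?k)) \<and> nmem s'' x 0 0 = ?k)"
      by (rule run_weaken) (use assms(2) in \<open>auto simp: unchanged_def\<close>)
    then show "run L ?d s' (\<lambda>s''. ?I s'' \<and> b - nmem s'' x 0 0 < b - nmem s' x 0 0)"
      by (intro run_Seq, elim run_weaken) (intro run_NAssign, use k in auto)
  next
    fix s' assume s': "unchanged ?d ?s s'" "?I s'" "\<not> bval (NLess (nvar x) e) s'"
    show "Q s'"
      using fin[OF un[OF s'(1)]] s'(2,3) bound[OF un[OF s'(1)]] by (auto simp: not_less)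
  next
    show "?I ?s" using init by simp
    show "b - nmem ?s x 0 0 \<le> L" using assms(1) by simp
  qed
qed

section \<open>Circulations and shortest paths\<close>

definition reduced :: "(nat \<Rightarrow> nat \<Rightarrow> real) \<Rightarrow> (nat \<Rightarrow> real) \<Rightarrow> nat \<Rightarrow> nat \<Rightarrow> real" where
  "reduced c p x y = c x y + p x - p y"

text \<open>
  A flow f with capacities C is represented by its residual capacities R x y = C x y - f x y,
  where f is antisymmetric. Conservation says that R and C have the same row sums.
\<close>

definition circulation :: "nat \<Rightarrow> (nat \<Rightarrow> nat \<Rightarrow> nat) \<Rightarrow> (nat \<Rightarrow> nat \<Rightarrow> nat) \<Rightarrow> bool" where
  "circulation N C R \<longleftrightarrow>
     (\<forall>x<N. \<forall>y<N. R x y + R y x = C x y + C y x) \<and> (\<forall>x<N. (\<Sum>y<N. R x y) = (\<Sum>y<N. C x y))"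

text \<open>For residual capacities and reduced costs this is the optimality certificate of a
  circulation, and at the same time the nonnegativity that Dijkstra's algorithm requires.\<close>

definition nonneg_arcs :: "nat \<Rightarrow> (nat \<Rightarrow> nat \<Rightarrow> nat) \<Rightarrow> (nat \<Rightarrow> nat \<Rightarrow> real) \<Rightarrow> bool" where
  "nonneg_arcs N R r \<longleftrightarrow> (\<forall>x<N. \<forall>y<N. 0 < R x y \<longrightarrow> 0 \<le> r x y)"

text \<open>
  The state of Dijkstra's algorithm from source v after k selections; distances are capped at D,
  and \<open>vis x\<close> is the time at which x was selected, or 0.
\<close>

definition dijkstra :: "nat \<Rightarrow> (nat \<Rightarrow> nat \<Rightarrow> nat) \<Rightarrow> (nat \<Rightarrow> nat \<Rightarrow> real) \<Rightarrow> real \<Rightarrow> nat \<Rightarrow> nat \<Rightarrow>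
    (nat \<Rightarrow> real) \<Rightarrow> (nat \<Rightarrow> nat) \<Rightarrow> (nat \<Rightarrow> nat) \<Rightarrow> bool" where
  "dijkstra N R r D v k dst vis pred \<longleftrightarrow>
     dst v = 0 \<and> (\<forall>x<N. 0 \<le> dst x \<and> dst x \<le> D) \<and>
     (\<forall>x<N. \<forall>y<N. vis x \<noteq> 0 \<longrightarrow> vis y = 0 \<longrightarrow> dst x \<le> dst y) \<and>
     (\<forall>x<N. \<forall>y<N. vis x \<noteq> 0 \<longrightarrow> 0 < R x y \<longrightarrow> dst y \<le> dst x + r x y) \<and>
     (\<forall>y<N. dst y < D \<longrightarrow> y \<noteq> v \<longrightarrow>
        pred y < N \<and> vis (pred y) \<noteq> 0 \<and> 0 < R (pred y) y \<and>
        dst y = dst (pred y) + r (pred y) y \<and> (vis y = 0 \<or> vis (pred y) < vis y)) \<and>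
     card {x. x < N \<and> vis x \<noteq> 0} = k \<and> (\<forall>x<N. vis x \<le> k)"

text \<open>Capping needs no extra work: D replaces infinity as the initial distance, relaxation
  only lowers distances, and the predecessor clause speaks only of nodes below D.\<close>

lemma dijkstra_init:
  assumes "v < N" "0 < D" "\<And>x. x < N \<Longrightarrow> dst x = (if x = v then 0 else D)" "\<And>x. x < N \<Longrightarrow> vis x = 0"
  shows "dijkstra N R r D v 0 dst vis pred"
proof -
  have "{x. x < N \<and> vis x \<noteq> 0} = {}" using assms by auto
  with assms show ?thesis by (auto simp: dijkstra_def)
qed

text \<open>Greedy choice: with nonnegative lengths, a closest unvisited node x can improve only
  nodes that are still unvisited, and none of these falls below \<open>dst x\<close>.\<close>

lemma dijkstra_step:
  assumes inv: "dijkstra N R r D v k dst vis pred"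
    and nonneg: "nonneg_arcs N R r" and v: "v < N"
    and x: "x < N" "vis x = 0" "\<And>y. y < N \<Longrightarrow> vis y = 0 \<Longrightarrow> dst x \<le> dst y"
    and better: "\<And>y. better y \<longleftrightarrow> 0 < R x y \<and> dst x + r x y < dst y"
    and dst': "\<And>y. y < N \<Longrightarrow> dst' y = (if better y then dst x + r x y else dst y)"
    and pred': "\<And>y. y < N \<Longrightarrow> pred' y = (if better y then x else pred y)"
    and vis': "\<And>y. y < N \<Longrightarrow> vis' y = (if y = x then Suc k else vis y)"
  shows "dijkstra N R r D v (Suc k) dst' vis' pred'"
proof -
  from inv have I: "dst v = 0" "\<And>y. y < N \<Longrightarrow> 0 \<le> dst y" "\<And>y. y < N \<Longrightarrow> dst y \<le> D"
    "\<And>x y. x < N \<Longrightarrow> y < N \<Longrightarrow> vis x \<noteq> 0 \<Longrightarrow> vis y = 0 \<Longrightarrow> dst x \<le> dst y"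
    "\<And>x y. x < N \<Longrightarrow> y < N \<Longrightarrow> vis x \<noteq> 0 \<Longrightarrow> 0 < R x y \<Longrightarrow> dst y \<le> dst x + r x y"
    "\<And>y. y < N \<Longrightarrow> dst y < D \<Longrightarrow> y \<noteq> v \<Longrightarrow>
        pred y < N \<and> vis (pred y) \<noteq> 0 \<and> 0 < R (pred y) y \<and>
        dst y = dst (pred y) + r (pred y) y \<and> (vis y = 0 \<or> vis (pred y) < vis y)"
    "card {x. x < N \<and> vis x \<noteq> 0} = k" "\<And>y. y < N \<Longrightarrow> vis y \<le> k"
    unfolding dijkstra_def by blast+
  have r: "0 \<le> r x y" if "y < N" "0 < R x y" for y
    using nonneg x that by (auto simp: nonneg_arcs_def)
  \<comment> \<open>Visited nodes are no farther than x, so an arc of nonnegative length from x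
    improves neither them nor x itself.\<close>
  have old: "dst' y = dst y" "pred' y = pred y" if "y < N" "vis y \<noteq> 0 \<or> y = x" for y
  proof -
    have "dst y \<le> dst x" using that x I(4) by blast
    then have "\<not> better y" using r[OF that(1)] better by auto
    then show "dst' y = dst y" "pred' y = pred y" using that dst' pred' by auto
  qed
  have new: "dst x \<le> dst' y" if "y < N" "vis y = 0" for y
    using that x r[of y] better dst'[of y] by auto
  have le: "dst' y \<le> dst y" if "y < N" for y
    using that better dst'[of y] by auto
  have set: "{y. y < N \<and> vis' y \<noteq> 0} = insert x {y. y < N \<and> vis y \<noteq> 0}"
    using x vis' by auto
  have "dst' v = 0" using dst'[OF v] better[of v] r[OF v] I(1) I(2)[OF x(1)] by auto
  moreover have "0 \<le> dst' y \<and> dst' y \<le> D" if "y < N" for y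
    using le[OF that] I(3)[OF that] I(2)[OF that] I(2)[OF x(1)] dst'[OF that] better[of y] r[OF that]
    by auto
  moreover have "dst' y \<le> dst' z" if "y < N" "z < N" "vis' y \<noteq> 0" "vis' z = 0" for y z
  proof -
    have z: "vis z = 0" using that vis' by (auto split: if_splits)
    have y: "vis y \<noteq> 0 \<or> y = x" using that vis' by (auto split: if_splits)
    then have "dst' y \<le> dst x" using old that(1) I(4) x by force
    then show ?thesis using new[OF that(2) z] by simp
  qed
  moreover have "dst' z \<le> dst' y + r y z" if "y < N" "z < N" "vis' y \<noteq> 0" "0 < R y z" for y z
  proof (cases "y = x")
    case True
    then show ?thesis using that old(1)[of x] x dst'[of z] better[of z] by auto
  next
    case False
    then have "vis y \<noteq> 0" using that vis' by (auto split: if_splits)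
    then show ?thesis using I(5)[of y z] old(1)[of y] le[of z] that by force
  qed
  moreover have "pred' y < N \<and> vis' (pred' y) \<noteq> 0 \<and> 0 < R (pred' y) y \<and>
        dst' y = dst' (pred' y) + r (pred' y) y \<and> (vis' y = 0 \<or> vis' (pred' y) < vis' y)"
    if y: "y < N" "dst' y < D" "y \<noteq> v" for y
  proof (cases "better y")
    case True
    then have "\<not> (vis y \<noteq> 0 \<or> y = x)" by (metis better dst' less_irrefl old(1) y(1))
    then have "vis y = 0" "y \<noteq> x" by auto
    then show ?thesis using True y x old(1)[of x] dst'[of y] pred'[of y] vis' better[of y] by auto
  next
    case False
    then have *: "dst' y = dst y" "pred' y = pred y" using y dst' pred' by auto
    with I(6)[of y] y have p: "pred y < N" "vis (pred y) \<noteq> 0" "0 < R (pred y) y"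
        "dst y = dst (pred y) + r (pred y) y" "vis y = 0 \<or> vis (pred y) < vis y" by auto
    moreover have "pred y \<noteq> x" using p x by auto
    \<comment> \<open>This matters for y = x, whose selection time becomes
      \<open>Suc k\<close>.\<close>
    moreover have "vis (pred y) < Suc k" using I(8)[OF p(1)] by simp
    ultimately show ?thesis using * y old(1)[of "pred y"] vis' by auto
  qed
  moreover have "card {y. y < N \<and> vis' y \<noteq> 0} = Suc k"
    unfolding set using x I(7) by (subst card_insert_disjoint) auto
  moreover have "vis' y \<le> Suc k" if "y < N" for y
    using I(8)[OF that] vis'[OF that] by auto
  ultimately show ?thesis unfolding dijkstra_def by blast
qed

lemma dijkstra_unvisited:
  assumes "dijkstra N R r D v k dst vis pred" "k < N"
  shows "\<exists>x<N. vis x = 0"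
proof (rule ccontr)
  assume "\<not> ?thesis"
  then have "{x. x < N \<and> vis x \<noteq> 0} = {..<N}" by auto
  with assms show False by (auto simp: dijkstra_def)
qed

lemma dijkstra_finished:
  assumes "dijkstra N R r D v N dst vis pred" "x < N"
  shows "vis x \<noteq> 0"
proof -
  have "{x. x < N \<and> vis x \<noteq> 0} = {..<N}"
    using assms by (intro card_subset_eq) (auto simp: dijkstra_def)
  with assms show ?thesis by auto
qed

lemma reduced_shift:
  "reduced c (\<lambda>x. p x + dst x) x y = reduced c p x y + dst x - dst y"
  by (simp add: reduced_def)

section \<open>Inserting an arc\<close>

definition reduced_exp :: "nexp \<Rightarrow> nexp \<Rightarrow> rexp" where
  "reduced_exp x y = RMinus (RPlus (RCell ''c'' x y) (RCell ''pot'' x (NConst 0))) (RCell ''pot'' y (NConst 0))"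

lemma rval_reduced_exp [simp]:
  "rval (reduced_exp x y) s = reduced (rmem s ''c'') (\<lambda>x. rmem s ''pot'' x 0) (nval x s) (nval y s)"
  by (simp add: reduced_exp_def reduced_def)

text \<open>\<open>''x''\<close> holds the invalid node N until an unvisited node is met. The
  negated conjunction encodes a disjunction: x is still N, or y is closer than x.\<close>

definition select_com :: com where
  "select_com = Seq (nset ''x'' (nvar ''N''))
     (For ''y'' (nvar ''N'')
       (Cond (BAnd (BNot (NLess (NConst 0) (NCell ''vis'' (nvar ''y'') (NConst 0))))
                (BNot (BAnd (NLess (nvar ''x'') (nvar ''N''))
                  (BNot (RLess (RCell ''dist'' (nvar ''y'') (NConst 0)) (RCell ''dist'' (nvar ''x'') (NConst 0)))))))
         (nset ''x'' (nvar ''y'')) Skip))"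

lemma mods_select [simp]: "nmods select_com = {''x'', ''y''}" "rmods select_com = {}"
  by (auto simp: select_com_def)

lemma run_select:
  assumes "nmem s ''N'' 0 0 = N" "N \<le> L" "\<exists>x<N. nmem s ''vis'' x 0 = 0"
  shows "run L select_com s (\<lambda>s'. \<exists>x<N. nmem s' ''x'' 0 0 = x \<and> nmem s ''vis'' x 0 = 0 \<and>
    (\<forall>y<N. nmem s ''vis'' y 0 = 0 \<longrightarrow> rmem s ''dist'' x 0 \<le> rmem s ''dist'' y 0))"
  unfolding select_com_def
proof (intro run_Seq run_NAssign)
  let ?s = "set_nat s ''x'' (nval (NConst 0) s) (nval (NConst 0) s) (nval (nvar ''N'') s)"
  let ?I = "\<lambda>k s'. let x = nmem s' ''x'' 0 0 in
     (x = N \<and> (\<forall>y<k. nmem s ''vis'' y 0 \<noteq> 0)) \<or>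
     (x < N \<and> nmem s ''vis'' x 0 = 0 \<and>
       (\<forall>y<k. nmem s ''vis'' y 0 = 0 \<longrightarrow> rmem s ''dist'' x 0 \<le> rmem s ''dist'' y 0))"
  show "run L (For ''y'' (nvar ''N'')
       (Cond (BAnd (BNot (NLess (NConst 0) (NCell ''vis'' (nvar ''y'') (NConst 0))))
                (BNot (BAnd (NLess (nvar ''x'') (nvar ''N''))
                  (BNot (RLess (RCell ''dist'' (nvar ''y'') (NConst 0)) (RCell ''dist'' (nvar ''x'') (NConst 0)))))))
         (nset ''x'' (nvar ''y'')) Skip)) ?s (\<lambda>s'. \<exists>x<N. nmem s' ''x'' 0 0 = x \<and> nmem s ''vis'' x 0 = 0 \<and>
    (\<forall>y<N. nmem s ''vis'' y 0 = 0 \<longrightarrow> rmem s ''dist'' x 0 \<le> rmem s ''dist'' y 0))"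
    (is "run L (For _ _ ?c) _ _")
  proof (rule run_For[where b = N and Inv = ?I])
    fix k s' assume "unchanged (For ''y'' (nvar ''N'') ?c) ?s s'"
    then have same: "nmem s' ''vis'' = nmem s ''vis''" "nmem s' ''N'' = nmem s ''N''" "rmem s' = rmem s"
      by (auto simp: unchanged_def array_set_other)
    then show "nval (nvar ''N'') s' = N" using assms by simp
    assume k: "k < N" and inv: "?I k s'" and y: "nmem s' ''y'' 0 0 = k"
    show "run L ?c s' (\<lambda>s''. ?I (Suc k) (set_nat s'' ''y'' 0 0 (Suc k)))"
      by (intro run_Cond run_NAssign run_Skip)
        (use k inv y same assms in \<open>fastforce simp: Let_def less_Suc_eq\<close>)+
  next
    fix s' assume "?I N s'"
    then show "\<exists>x<N. nmem s' ''x'' 0 0 = x \<and> nmem s ''vis'' x 0 = 0 \<and>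
       (\<forall>y<N. nmem s ''vis'' y 0 = 0 \<longrightarrow> rmem s ''dist'' x 0 \<le> rmem s ''dist'' y 0)"
      using assms by (auto simp: Let_def)
  qed (use assms in auto)
qed

definition relax_com :: com where
  "relax_com = For ''y'' (nvar ''N'')
     (Cond (BAnd (NLess (NConst 0) (NCell ''cap'' (nvar ''x'') (nvar ''y'')))
             (RLess (RPlus (RCell ''dist'' (nvar ''x'') (NConst 0)) (reduced_exp (nvar ''x'') (nvar ''y'')))
                (RCell ''dist'' (nvar ''y'') (NConst 0))))
       (Seq (RAssign ''dist'' (nvar ''y'') (NConst 0)
               (RPlus (RCell ''dist'' (nvar ''x'') (NConst 0)) (reduced_exp (nvar ''x'') (nvar ''y''))))
            (NAssign ''pred'' (nvar ''y'') (NConst 0) (nvar ''x'')))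
       Skip)"

lemma mods_relax [simp]: "nmods relax_com = {''y'', ''pred''}" "rmods relax_com = {''dist''}"
  by (auto simp: relax_com_def)

lemma run_relax:
  fixes s :: state
  defines "x \<equiv> nmem s ''x'' 0 0"
  defines "r \<equiv> reduced (rmem s ''c'') (\<lambda>x. rmem s ''pot'' x 0)"
  defines "better \<equiv> \<lambda>y. 0 < nmem s ''cap'' x y \<and> rmem s ''dist'' x 0 + r x y < rmem s ''dist'' y 0"
  assumes "nmem s ''N'' 0 0 = N" "N \<le> L" "x < N" "nonneg_arcs N (nmem s ''cap'') r"
  shows "run L relax_com s (\<lambda>s'. \<forall>y<N.
      rmem s' ''dist'' y 0 = (if better y then rmem s ''dist'' x 0 + r x y else rmem s ''dist'' y 0) \<and>
      nmem s' ''pred'' y 0 = (if better y then x else nmem s ''pred'' y 0))"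
  unfolding relax_com_def
proof (rule run_For[where b = N and Inv = "\<lambda>k s'. \<forall>y<N.
      rmem s' ''dist'' y 0 =
        (if y < k \<and> better y then rmem s ''dist'' x 0 + r x y else rmem s ''dist'' y 0) \<and>
      nmem s' ''pred'' y 0 = (if y < k \<and> better y then x else nmem s ''pred'' y 0)"],
    goal_cases)
  case (5 k s')
  from 5(1) have same: "nmem s' ''cap'' = nmem s ''cap''" "nmem s' ''x'' 0 0 = x" "rmem s' ''c'' = rmem s ''c''"
      "rmem s' ''pot'' = rmem s ''pot''"
    by (auto simp: unchanged_def x_def)
  \<comment> \<open>The loop overwrites \<open>''dist''\<close> while it keeps reading the entry of
    x. That entry stays fixed, because a residual loop at x would have nonnegative length.\<close>
  have "\<not> better x" 
    using assms(7)[unfolded nonneg_arcs_def, rule_format, of x x] assms(6) by (auto simp: better_def)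
  then have x: "rmem s' ''dist'' x 0 = rmem s ''dist'' x 0" using 5(3) assms(6) by simp
  have k: "rmem s' ''dist'' k 0 = rmem s ''dist'' k 0" using 5(2,3) by simp
  show ?case
    by (intro run_Cond run_Seq run_RAssign run_NAssign run_Skip)
      (use 5(2,3,4) in \<open>auto simp: same x k r_def[symmetric] better_def less_Suc_eq\<close>)
qed (use assms in \<open>auto simp: unchanged_def\<close>)

definition dijkstra_com :: com where
  "dijkstra_com =
     Seq (For ''x'' (nvar ''N'')
           (Seq (RAssign ''dist'' (nvar ''x'') (NConst 0) (rvar ''D''))
                (NAssign ''vis'' (nvar ''x'') (NConst 0) (NConst 0))))
    (Seq (RAssign ''dist'' (nvar ''v'') (NConst 0) (RConst 0))
         (For ''k'' (nvar ''N'')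
           (Seq select_com
           (Seq (NAssign ''vis'' (nvar ''x'') (NConst 0) (NPlus (nvar ''k'') (NConst 1)))
                relax_com))))"

lemma mods_dijkstra [simp]:
  "nmods dijkstra_com = {''x'', ''y'', ''k'', ''vis'', ''pred''}" "rmods dijkstra_com = {''dist''}"
  by (auto simp: dijkstra_com_def)

definition dijkstra_state :: "nat \<Rightarrow> nat \<Rightarrow> state \<Rightarrow> bool" where
  "dijkstra_state N k s \<longleftrightarrow>
     dijkstra N (nmem s ''cap'') (reduced (rmem s ''c'') (\<lambda>x. rmem s ''pot'' x 0)) (rmem s ''D'' 0 0)
       (nmem s ''v'' 0 0) k
       (\<lambda>x. rmem s ''dist'' x 0) (\<lambda>x. nmem s ''vis'' x 0) (\<lambda>x. nmem s ''pred'' x 0)"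

lemma run_dijkstra:
  assumes N: "nmem s ''N'' 0 0 = N" "N \<le> L" and v: "nmem s ''v'' 0 0 < N"
    and D: "0 < rmem s ''D'' 0 0"
    and nonneg: "nonneg_arcs N (nmem s ''cap'') (reduced (rmem s ''c'') (\<lambda>x. rmem s ''pot'' x 0))"
  shows "run L dijkstra_com s (dijkstra_state N N)"
  unfolding dijkstra_com_def
proof (intro run_Seq run_RAssign,
    rule run_For[where b = N and Inv = "\<lambda>k s'. \<forall>x<k. rmem s' ''dist'' x 0 = rmem s ''D'' 0 0 \<and> nmem s' ''vis'' x 0 = 0"],
    goal_cases)
  case (5 k s')
  then have "rmem s' ''D'' = rmem s ''D''" by (auto simp: unchanged_def)
  then show ?case using 5 by (intro run_Seq run_RAssign run_NAssign) (auto simp: less_Suc_eq)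
next
  case (6 s1)
  then have same: "nmem s1 ''cap'' = nmem s ''cap''" "nmem s1 ''v'' = nmem s ''v''"
      "nmem s1 ''N'' = nmem s ''N''" "rmem s1 ''D'' = rmem s ''D''" "rmem s1 ''c'' = rmem s ''c''"
      "rmem s1 ''pot'' = rmem s ''pot''"
    by (auto simp: unchanged_def)
  let ?v = "nmem s ''v'' 0 0"
  define s2 where "s2 = set_real s1 ''dist'' ?v 0 0"
  have same2: "nmem s2 ''cap'' = nmem s ''cap''" "nmem s2 ''v'' = nmem s ''v''"
      "nmem s2 ''N'' = nmem s ''N''" "rmem s2 ''D'' = rmem s ''D''" "rmem s2 ''c'' = rmem s ''c''"
      "rmem s2 ''pot'' = rmem s ''pot''"
    by (simp_all add: s2_def same array_set_other)
  have init: "dijkstra_state N 0 s2"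
    unfolding dijkstra_state_def same2 by (rule dijkstra_init) (use 6 v D in \<open>auto simp: s2_def\<close>)
  let ?c = "Seq select_com (Seq (NAssign ''vis'' (nvar ''x'') (NConst 0) (NPlus (nvar ''k'') (NConst 1))) relax_com)"
  have "run L (For ''k'' (nvar ''N'') ?c) s2 (dijkstra_state N N)"
  proof (rule run_For[where b = N and Inv = "dijkstra_state N"], goal_cases)
    case (5 k s')
    let ?R = "nmem s' ''cap''" and ?r = "reduced (rmem s' ''c'') (\<lambda>x. rmem s' ''pot'' x 0)"
    from 5(1) have same3: "nmem s' ''cap'' = nmem s ''cap''" "nmem s' ''v'' = nmem s ''v''"
      "nmem s' ''N'' = nmem s ''N''" "rmem s' ''D'' = rmem s ''D''" "rmem s' ''c'' = rmem s ''c''"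
      "rmem s' ''pot'' = rmem s ''pot''"
      by (auto simp: unchanged_def same2)
    note inv = 5(3)[unfolded dijkstra_state_def]
    show ?case
    proof (intro run_Seq, rule run_weaken[OF run_select[where N = N]], goal_cases)
      case 3
      show ?case using dijkstra_unvisited[OF inv 5(2)] by simp
    next
      case (4 s4)
      then obtain x where x: "x < N" "nmem s4 ''x'' 0 0 = x" "nmem s' ''vis'' x 0 = 0"
        "\<And>y. y < N \<Longrightarrow> nmem s' ''vis'' y 0 = 0 \<Longrightarrow> rmem s' ''dist'' x 0 \<le> rmem s' ''dist'' y 0"
        by auto
      from 4(1) have same4: "\<And>a. a \<notin> {''x'', ''y''} \<Longrightarrow> nmem s4 a = nmem s' a" "rmem s4 = rmem s'"
        by (auto simp: unchanged_def)
      define s5 where "s5 = set_nat s4 ''vis'' x 0 (Suc k)"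
      have same5: "\<And>a. a \<notin> {''x'', ''y'', ''vis''} \<Longrightarrow> nmem s5 a = nmem s' a" "rmem s5 = rmem s'"
        "nmem s5 ''x'' 0 0 = x" "\<And>y. nmem s5 ''vis'' y 0 = (if y = x then Suc k else nmem s' ''vis'' y 0)"
        using same4 x by (auto simp: s5_def array_set_other)
      have nonneg': "nonneg_arcs N ?R ?r" using nonneg same3 by simp
      have "run L relax_com s5 (\<lambda>s''. dijkstra_state N (Suc k) (set_nat s'' ''k'' 0 0 (Suc k)))"
      proof (rule run_weaken[OF run_relax[where N = N]], goal_cases)
        case (5 s6)
        have "\<And>a. a \<notin> {''x'', ''y'', ''vis'', ''pred''} \<Longrightarrow> nmem s6 a = nmem s' a"
             "\<And>a. a \<notin> {''dist''} \<Longrightarrow> rmem s6 a = rmem s' a"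
          and vis: "nmem s6 ''vis'' = nmem s5 ''vis''"
          using 5(1) same5 by (auto simp: unchanged_def)
        then have eqs: "nmem s6 ''cap'' = ?R" "nmem s6 ''v'' = nmem s' ''v''" "rmem s6 ''D'' = rmem s' ''D''"
          "rmem s6 ''c'' = rmem s' ''c''" "rmem s6 ''pot'' = rmem s' ''pot''" by auto
        define better where "better y \<longleftrightarrow> 0 < ?R x y \<and> rmem s' ''dist'' x 0 + ?r x y < rmem s' ''dist'' y 0" for y
        have upd: "\<And>y. y < N \<Longrightarrow> rmem s6 ''dist'' y 0 =
            (if better y then rmem s' ''dist'' x 0 + ?r x y else rmem s' ''dist'' y 0)"
          "\<And>y. y < N \<Longrightarrow> nmem s6 ''pred'' y 0 = (if better y then x else nmem s' ''pred'' y 0)"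
          using 5(2) by (simp_all add: same5 better_def)
        have "dijkstra N ?R ?r (rmem s' ''D'' 0 0) (nmem s' ''v'' 0 0) (Suc k)
          (\<lambda>x. rmem s6 ''dist'' x 0) (\<lambda>x. nmem s6 ''vis'' x 0) (\<lambda>x. nmem s6 ''pred'' x 0)"
        proof (rule dijkstra_step[OF inv nonneg' _ x(1,3,4)])
          show "nmem s' ''v'' 0 0 < N" using v same3 by simp
          show "better y \<longleftrightarrow> 0 < ?R x y \<and> rmem s' ''dist'' x 0 + ?r x y < rmem s' ''dist'' y 0" for y
            by (simp add: better_def)
        qed (simp_all add: upd vis same5)
        then show ?case by (simp add: dijkstra_state_def eqs array_set_other)
      qed (use N x same5 same3 nonneg' in auto)
      with 5(4) x(2) same4 show ?case
        by - (intro run_Seq run_NAssign, simp add: s5_def)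
    qed (use N same3 in auto)
  qed (use N init in \<open>auto simp: dijkstra_state_def same2 array_set_other unchanged_def\<close>)
  then show ?case by - (intro run_Seq run_RAssign, simp add: s2_def same)
qed (use N in \<open>auto simp: unchanged_def\<close>)

section \<open>Pushing one unit of flow along tight arcs\<close>

definition put :: "(nat \<Rightarrow> nat \<Rightarrow> 'v) \<Rightarrow> nat \<Rightarrow> nat \<Rightarrow> 'v \<Rightarrow> nat \<Rightarrow> nat \<Rightarrow> 'v" where
  "put f i j v = (\<lambda>a b. if a = i \<and> b = j then v else f a b)"

lemma put_apply: "put f i j v a b = (if a = i \<and> b = j then v else f a b)"
  by (simp add: put_def)

lemma array_set:
  "nmem (set_nat s a i j v) a = put (nmem s a) i j v"
  "rmem (set_real s a i j r) a = put (rmem s a) i j r"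
  by (auto simp: put_def fun_eq_iff)

text \<open>Adding the old entry on one side and the new one on the other avoids truncated
  subtraction.\<close>

lemma sum_put:
  fixes f :: "nat \<Rightarrow> nat \<Rightarrow> nat"
  assumes "j < N"
  shows "(\<Sum>b<N. put f i j v a b) + (if a = i then f i j else 0) = (\<Sum>b<N. f a b) + (if a = i then v else 0)"
proof -
  have "(\<Sum>b<N. put f i j v a b) = put f i j v a j + (\<Sum>b\<in>{..<N} - {j}. put f i j v a b)"
    using assms by (intro sum.remove) auto
  also have "(\<Sum>b\<in>{..<N} - {j}. put f i j v a b) = (\<Sum>b\<in>{..<N} - {j}. f a b)"
    by (intro sum.cong) (auto simp: put_def)
  finally have "(\<Sum>b<N. put f i j v a b) = put f i j v a j + (\<Sum>b\<in>{..<N} - {j}. f a b)" .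
  moreover have "(\<Sum>b<N. f a b) = f a j + (\<Sum>b\<in>{..<N} - {j}. f a b)"
    using assms by (intro sum.remove) auto
  ultimately show ?thesis by (simp add: put_def)
qed

definition antisym_costs :: "nat \<Rightarrow> (nat \<Rightarrow> nat \<Rightarrow> real) \<Rightarrow> bool" where
  "antisym_costs N c \<longleftrightarrow> (\<forall>x<N. \<forall>y<N. c x y = - c y x)"

text \<open>The shortest path tree as it looks once the distances have been added to the potentials:
  its arcs are tight. The decrease of \<open>vis\<close> excludes cycles and makes it the variant of
  the augmentation loop.\<close>

definition pred_tree :: "nat \<Rightarrow> (nat \<Rightarrow> nat \<Rightarrow> real) \<Rightarrow> nat \<Rightarrow> nat set \<Rightarrow> (nat \<Rightarrow> nat) \<Rightarrow> (nat \<Rightarrow> nat) \<Rightarrow> bool" where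
  "pred_tree N r v A pred vis \<longleftrightarrow> A \<subseteq> {..<N} \<and>
     (\<forall>y\<in>A. y \<noteq> v \<longrightarrow> pred y \<in> A \<and> vis (pred y) < vis y \<and> r (pred y) y = 0)"

text \<open>
  Pushing one unit along the tree path from v to u is done backwards: when the front is at x, the
  unit is missing at v and superfluous at x.
\<close>

definition pushing :: "nat \<Rightarrow> (nat \<Rightarrow> nat \<Rightarrow> nat) \<Rightarrow> (nat \<Rightarrow> nat \<Rightarrow> real) \<Rightarrow> nat \<Rightarrow> nat set \<Rightarrow>
    (nat \<Rightarrow> nat) \<Rightarrow> (nat \<Rightarrow> nat) \<Rightarrow> nat \<Rightarrow> (nat \<Rightarrow> nat \<Rightarrow> nat) \<Rightarrow> bool" where
  "pushing N C r v A pred vis x R \<longleftrightarrow> x \<in> A \<and>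
     (\<forall>a<N. \<forall>b<N. R a b + R b a = C a b + C b a) \<and>
     (\<forall>a<N. (\<Sum>b<N. R a b) + (if a = x then 1 else 0) = (\<Sum>b<N. C a b) + (if a = v then 1 else 0)) \<and>
     nonneg_arcs N R r \<and>
     (\<forall>y\<in>A. vis y \<le> vis x \<longrightarrow> y \<noteq> v \<longrightarrow> 0 < R (pred y) y)"

text \<open>The tree arc is tight and costs are antisymmetric, so the reversed arc, which becomes
  residual, has reduced cost 0 too. The tree arcs still to be traversed end at nodes selected
  earlier than x and are not touched.\<close>

lemma pushing_step:
  assumes inv: "pushing N C r v A pred vis x R" and tree: "pred_tree N r v A pred vis"
    and anti: "antisym_costs N r" and "x \<noteq> v"
  defines "y \<equiv> pred x"
  shows "pushing N C r v A pred vis y (put (put R y x (R y x - 1)) x y (put R y x (R y x - 1) x y + 1))"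
    (is "pushing _ _ _ _ _ _ _ _ ?R2")
proof -
  from inv have I: "x \<in> A" "\<And>a b. a < N \<Longrightarrow> b < N \<Longrightarrow> R a b + R b a = C a b + C b a"
    "\<And>a. a < N \<Longrightarrow> (\<Sum>b<N. R a b) + (if a = x then 1 else 0) = (\<Sum>b<N. C a b) + (if a = v then 1 else 0)"
    "nonneg_arcs N R r" "\<And>y. y \<in> A \<Longrightarrow> vis y \<le> vis x \<Longrightarrow> y \<noteq> v \<Longrightarrow> 0 < R (pred y) y"
    unfolding pushing_def by blast+
  have y: "y \<in> A" "vis y < vis x" "r y x = 0"
    using tree I(1) \<open>x \<noteq> v\<close> by (auto simp: pred_tree_def y_def)
  have lt: "x < N" "y < N" using tree I(1) y(1) by (auto simp: pred_tree_def)
  have "x \<noteq> y" using y by auto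
  have pos: "0 < R y x" using I(5)[OF I(1)] \<open>x \<noteq> v\<close> by (simp add: y_def)
  let ?R1 = "put R y x (R y x - 1)"
  have "?R2 a b + ?R2 b a = C a b + C b a" if "a < N" "b < N" for a b
    using I(2)[OF that] pos \<open>x \<noteq> y\<close> by (auto simp: put_def)
  moreover have "(\<Sum>b<N. ?R2 a b) + (if a = y then 1 else 0) = (\<Sum>b<N. C a b) + (if a = v then 1 else 0)"
    if "a < N" for a
    using I(3)[OF that] sum_put[OF lt(1), of R y "R y x - 1" a]
      sum_put[OF lt(2), of ?R1 x "?R1 x y + 1" a] pos \<open>x \<noteq> y\<close>
    by (auto split: if_splits)
  moreover have "nonneg_arcs N ?R2 r"
  proof -
    have "r x y = 0" using anti lt y(3) unfolding antisym_costs_def by (metis neg_equal_0_iff_equal)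
    moreover have "0 \<le> r a b" if "a < N" "b < N" "0 < R a b" for a b
      using I(4) that by (simp add: nonneg_arcs_def)
    moreover have "a = x \<and> b = y \<or> 0 < R a b" if "0 < ?R2 a b" for a b
      using that by (cases "a = y"; cases "b = x"; cases "a = x"; cases "b = y") (simp_all add: put_def)
    ultimately show ?thesis unfolding nonneg_arcs_def by (metis order_refl)
  qed
  moreover have "0 < ?R2 (pred z) z" if z: "z \<in> A" "vis z \<le> vis y" "z \<noteq> v" for z
  proof -
    have "vis (pred z) < vis z" using tree z by (auto simp: pred_tree_def)
    then have "z \<noteq> x" "pred z \<noteq> x" using z y by auto
    then show ?thesis using I(5)[of z] z y by (auto simp: put_def)
  qed
  ultimately show ?thesis using y(1) unfolding pushing_def by blast
qed

definition augment_com :: com where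
  "augment_com = Seq (nset ''x'' (nvar ''u''))
     (While (BNot (BAnd (BNot (NLess (nvar ''x'') (nvar ''v''))) (BNot (NLess (nvar ''v'') (nvar ''x'')))))
       (Seq (nset ''y'' (NCell ''pred'' (nvar ''x'') (NConst 0)))
       (Seq (NAssign ''cap'' (nvar ''y'') (nvar ''x'') (NMinus (NCell ''cap'' (nvar ''y'') (nvar ''x'')) (NConst 1)))
       (Seq (NAssign ''cap'' (nvar ''x'') (nvar ''y'') (NPlus (NCell ''cap'' (nvar ''x'') (nvar ''y'')) (NConst 1)))
         (nset ''x'' (nvar ''y''))))))"

lemma mods_augment [simp]: "nmods augment_com = {''x'', ''y'', ''cap''}" "rmods augment_com = {}"
  by (auto simp: augment_com_def)

text \<open>When the front reaches v, the two imbalances in \<open>pushing\<close> sit at the same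
  node and cancel, which leaves a circulation.\<close>

lemma run_augment:
  fixes s :: state
  defines "v \<equiv> nmem s ''v'' 0 0" and "u \<equiv> nmem s ''u'' 0 0"
    and "pred \<equiv> \<lambda>x. nmem s ''pred'' x 0" and "vis \<equiv> \<lambda>x. nmem s ''vis'' x 0"
  assumes tree: "pred_tree N r v A pred vis" and anti: "antisym_costs N r"
    and init: "pushing N C r v A pred vis u (nmem s ''cap'')" and L: "\<And>x. x \<in> A \<Longrightarrow> vis x \<le> L"
  shows "run L augment_com s (\<lambda>s'. circulation N C (nmem s' ''cap'') \<and> nonneg_arcs N (nmem s' ''cap'') r)"
  unfolding augment_com_def
proof (intro run_Seq run_NAssign, rule run_While[where f = "\<lambda>s'. vis (nmem s' ''x'' 0 0)" and
      Inv = "\<lambda>s'. pushing N C r v A pred vis (nmem s' ''x'' 0 0) (nmem s' ''cap'')"], goal_cases)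
  case 1
  show ?case using init by (simp add: array_set_other u_def)
next
  case 2
  show ?case using init L by (simp add: pushing_def u_def)
next
  case (3 s')
  then have same: "nmem s' ''v'' 0 0 = v" "nmem s' ''pred'' = nmem s ''pred''"
    by (auto simp: unchanged_def array_set_other v_def)
  let ?x = "nmem s' ''x'' 0 0" and ?R = "nmem s' ''cap''"
  have x: "?x \<noteq> v" using 3(3) same by auto
  let ?y = "pred ?x"
  have lt: "vis ?y < vis ?x" using tree 3(2) x by (auto simp: pushing_def pred_tree_def)
  have y: "nmem s' ''pred'' ?x 0 = ?y" by (simp add: same pred_def)
  have eq: "\<And>i j k. nmem (set_nat s' ''y'' i j k) ''cap'' = ?R" by (simp add: array_set_other)
  show ?case
    by (intro run_Seq run_NAssign)
      (use lt pushing_step[OF 3(2) tree anti x] in \<open>simp add: array_set array_set_other put_apply y eq\<close>)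
next
  case (4 s')
  then have "nmem s' ''v'' 0 0 = v"
    by (auto simp: unchanged_def array_set_other v_def)
  with 4(3) have "nmem s' ''x'' 0 0 = v" by auto
  with 4(2) show ?case by (auto simp: pushing_def circulation_def)
qed

definition potential_com :: com where
  "potential_com = For ''x'' (nvar ''N'')
     (RAssign ''pot'' (nvar ''x'') (NConst 0)
       (RPlus (RCell ''pot'' (nvar ''x'') (NConst 0)) (RCell ''dist'' (nvar ''x'') (NConst 0))))"

lemma mods_potential [simp]: "nmods potential_com = {''x''}" "rmods potential_com = {''pot''}"
  by (auto simp: potential_com_def)

lemma run_potential:
  assumes "nmem s ''N'' 0 0 = N" "N \<le> L"
  shows "run L potential_com s (\<lambda>s'. \<forall>x<N. rmem s' ''pot'' x 0 = rmem s ''pot'' x 0 + rmem s ''dist'' x 0)"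
  unfolding potential_com_def
proof (rule run_For[where b = N and Inv = "\<lambda>k s'. \<forall>x<N. rmem s' ''pot'' x 0 =
      (if x < k then rmem s ''pot'' x 0 + rmem s ''dist'' x 0 else rmem s ''pot'' x 0)"], goal_cases)
  case (5 k s')
  then have "rmem s' ''dist'' = rmem s ''dist''" by (auto simp: unchanged_def)
  with 5(2,3,4) show ?case by - (rule run_RAssign, auto simp: less_Suc_eq)
qed (use assms in \<open>auto simp: unchanged_def\<close>)

text \<open>For the new arc from u to v, capacity 1 at (u, v) means that it stays empty, and 1 at
  (v, u) that it carries its unit. The cost is written in both directions to keep costs
  antisymmetric.\<close>

definition insert_com :: com where
  "insert_com =
     Seq (RAssign ''c'' (nvar ''u'') (nvar ''v'') (RMinus (RConst 0) (rvar ''wt'')))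
    (Seq (RAssign ''c'' (nvar ''v'') (nvar ''u'') (rvar ''wt''))
    (Seq (rset ''D'' (RMinus (RConst 0) (reduced_exp (nvar ''u'') (nvar ''v''))))
    (Cond (RLess (RConst 0) (rvar ''D''))
       (Seq dijkstra_com
       (Seq potential_com
         (Cond (RLess (RCell ''dist'' (nvar ''u'') (NConst 0)) (rvar ''D''))
           (Seq (NAssign ''cap'' (nvar ''v'') (nvar ''u'') (NConst 1)) augment_com)
           (NAssign ''cap'' (nvar ''u'') (nvar ''v'') (NConst 1)))))
       (NAssign ''cap'' (nvar ''u'') (nvar ''v'') (NConst 1)))))"

lemma mods_insert [simp]:
  "nmods insert_com = {''x'', ''y'', ''k'', ''vis'', ''pred'', ''cap''}"
  "rmods insert_com = {''c'', ''D'', ''dist'', ''pot''}"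
  by (auto simp: insert_com_def)

lemma circulation_put_unused:
  assumes "circulation N C R" "u < N" "v < N" "u \<noteq> v"
    "R u v = 0" "R v u = 0" "C u v = 0" "C v u = 0"
  shows "circulation N (put C u v 1) (put R u v 1)"
proof -
  have "(\<Sum>b<N. put R u v 1 a b) = (\<Sum>b<N. put C u v 1 a b)" if "a < N" for a
    using assms that sum_put[OF assms(3), of C u 1 a] sum_put[OF assms(3), of R u 1 a]
    by (auto simp: circulation_def split: if_splits)
  moreover have "put R u v 1 a b + put R u v 1 b a = put C u v 1 a b + put C u v 1 b a"
    if "a < N" "b < N" for a b
    using assms that by (auto simp: put_def circulation_def)
  ultimately show ?thesis by (simp add: circulation_def)
qed

lemma nonneg_arcs_put:
  assumes "nonneg_arcs N R r" "u < N" "v < N" "0 \<le> r u v"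
  shows "nonneg_arcs N (put R u v k) r"
  using assms by (auto simp: nonneg_arcs_def put_def)

text \<open>With the distances added to the potentials, the new arc has reduced cost
  \<open>dst u - D\<close>, which the cap keeps at most 0. At 0 the arc may stay empty; below 0 it
  must be full, so that only its reversal is residual.\<close>

lemma run_insert:
  fixes s :: state
  defines "R \<equiv> nmem s ''cap''" and "c \<equiv> rmem s ''c''" and "p \<equiv> \<lambda>x. rmem s ''pot'' x 0"
    and "wt \<equiv> rmem s ''wt'' 0 0" and "u \<equiv> nmem s ''u'' 0 0" and "v \<equiv> nmem s ''v'' 0 0"
  defines "c' \<equiv> put (put c u v (- wt)) v u wt"
  assumes N: "nmem s ''N'' 0 0 = N" "N \<le> L" and uv: "u < N" "v < N" "u \<noteq> v"
    and circ: "circulation N C R" and zero: "C u v = 0" "C v u = 0"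
    and anti: "antisym_costs N c" and nonneg: "nonneg_arcs N R (reduced c p)"
  shows "run L insert_com s (\<lambda>s'. circulation N (put C u v 1) (nmem s' ''cap'') \<and>
    rmem s' ''c'' = c' \<and> nonneg_arcs N (nmem s' ''cap'') (reduced c' (\<lambda>x. rmem s' ''pot'' x 0)))"
proof -
  have R0: "R u v = 0" "R v u = 0"
    using circ uv zero unfolding circulation_def by (metis add_is_0)+
  have anti': "antisym_costs N c'"
    unfolding antisym_costs_def
  proof (intro allI impI)
    fix x y assume "x < N" "y < N"
    then have "c x y = - c y x" using anti unfolding antisym_costs_def by blast
    then show "c' x y = - c' y x" using uv by (auto simp: c'_def put_def)
  qed
  \<comment> \<open>The costs change only between u and v, where there is no residual capacity
    yet.\<close>
  have nonneg': "nonneg_arcs N R (reduced c' p)"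
    using nonneg R0 by (auto simp: nonneg_arcs_def reduced_def c'_def put_def)
  define D where "D = - reduced c' p u v"
  define s1 where "s1 = set_real (set_real (set_real s ''c'' u v (- wt)) ''c'' v u wt) ''D'' 0 0 D"
  have s1: "rmem s1 ''c'' = c'" "rmem s1 ''pot'' = rmem s ''pot''" "rmem s1 ''D'' 0 0 = D"
    "nmem s1 = nmem s"
    by (simp_all add: s1_def array_set_other array_set put_apply c'_def c_def)
  have 1: "run L (NAssign ''cap'' (nvar ''u'') (nvar ''v'') (NConst 1)) s1
       (\<lambda>s'. circulation N (put C u v 1) (nmem s' ''cap'') \<and>
    rmem s' ''c'' = c' \<and> nonneg_arcs N (nmem s' ''cap'') (reduced c' (\<lambda>x. rmem s' ''pot'' x 0)))"
    if "\<not> 0 < D"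
    by (rule run_NAssign) (use that circulation_put_unused[OF circ uv R0 zero]
      nonneg_arcs_put[OF nonneg' uv(1,2), of 1] in \<open>simp add: s1 array_set D_def flip: u_def v_def R_def p_def\<close>)
  have 2: "run L (Seq dijkstra_com
       (Seq potential_com
         (Cond (RLess (RCell ''dist'' (nvar ''u'') (NConst 0)) (rvar ''D''))
           (Seq (NAssign ''cap'' (nvar ''v'') (nvar ''u'') (NConst 1)) augment_com)
           (NAssign ''cap'' (nvar ''u'') (nvar ''v'') (NConst 1))))) s1
       (\<lambda>s'. circulation N (put C u v 1) (nmem s' ''cap'') \<and>
    rmem s' ''c'' = c' \<and> nonneg_arcs N (nmem s' ''cap'') (reduced c' (\<lambda>x. rmem s' ''pot'' x 0)))"
    if D: "0 < D"
  proof (intro run_Seq, rule run_weaken[OF run_dijkstra[where N = N]], goal_cases)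
    case (6 s2)
    then have s2: "\<And>a. a \<notin> {''x'', ''y'', ''k'', ''vis'', ''pred''} \<Longrightarrow> nmem s2 a = nmem s a"
      "\<And>a. a \<noteq> ''dist'' \<Longrightarrow> rmem s2 a = rmem s1 a"
      by (auto simp: unchanged_def s1)
    define dst where "dst x = rmem s2 ''dist'' x 0" for x
    define vis where "vis x = nmem s2 ''vis'' x 0" for x
    define pred where "pred x = nmem s2 ''pred'' x 0" for x
    let ?p' = "\<lambda>x. p x + dst x"
    let ?r = "reduced c' p" and ?r' = "reduced c' ?p'"
    have dij: "dijkstra N R ?r D v N dst vis pred"
      using 6(2) by (simp add: dijkstra_state_def s2 s1 dst_def[abs_def] vis_def[abs_def] pred_def[abs_def]
          flip: u_def v_def R_def p_def)
    then have dj: "dst v = 0" "\<And>y. y < N \<Longrightarrow> 0 \<le> dst y" "\<And>y. y < N \<Longrightarrow> dst y \<le> D"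
      "\<And>x y. x < N \<Longrightarrow> y < N \<Longrightarrow> vis x \<noteq> 0 \<Longrightarrow> 0 < R x y \<Longrightarrow> dst y \<le> dst x + ?r x y"
      "\<And>y. y < N \<Longrightarrow> dst y < D \<Longrightarrow> y \<noteq> v \<Longrightarrow>
        pred y < N \<and> vis (pred y) \<noteq> 0 \<and> 0 < R (pred y) y \<and>
        dst y = dst (pred y) + ?r (pred y) y \<and> (vis y = 0 \<or> vis (pred y) < vis y)"
      "\<And>y. y < N \<Longrightarrow> vis y \<le> N"
      unfolding dijkstra_def by blast+
    note visited = dijkstra_finished[OF dij]
    have nonneg2: "nonneg_arcs N R ?r'"
      using dj(4) visited by (force simp: nonneg_arcs_def reduced_shift)
    have anti2: "antisym_costs N ?r'"
      unfolding antisym_costs_def reduced_def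
    proof (intro allI impI)
      fix x y assume "x < N" "y < N"
      then have "c' x y = - c' y x" using anti' unfolding antisym_costs_def by blast
      then show "c' x y + ?p' x - ?p' y = - (c' y x + ?p' y - ?p' x)" by simp
    qed
    have ruv: "?r' u v = dst u - D" by (simp add: reduced_shift D_def dj(1))
    show ?case
    proof (rule run_Seq, rule run_weaken[OF run_potential[where N = N]], goal_cases)
      case (3 s3)
      then have s3: "\<And>a. a \<notin> {''x'', ''y'', ''k'', ''vis'', ''pred''} \<Longrightarrow> nmem s3 a = nmem s a"
        "nmem s3 ''pred'' = nmem s2 ''pred''" "nmem s3 ''vis'' = nmem s2 ''vis''"
        "\<And>a. a \<noteq> ''pot'' \<Longrightarrow> rmem s3 a = rmem s2 a"
        by (auto simp: unchanged_def s2)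
      have pot: "rmem s3 ''pot'' x 0 = ?p' x" if "x < N" for x
        using 3(2) that by (simp add: s2 s1 dst_def p_def)
      have r': "nonneg_arcs N Q (reduced c' (\<lambda>x. rmem s3 ''pot'' x 0)) = nonneg_arcs N Q ?r'" for Q
        by (auto simp: nonneg_arcs_def reduced_def pot)
      show ?case
      proof (rule run_Cond)
        assume "\<not> bval (RLess (RCell ''dist'' (nvar ''u'') (NConst 0)) (rvar ''D'')) s3"
        then have "0 \<le> ?r' u v"
          using ruv by (simp add: s3 s2 s1 dst_def flip: u_def)
        then show "run L (NAssign ''cap'' (nvar ''u'') (nvar ''v'') (NConst 1)) s3
       (\<lambda>s'. circulation N (put C u v 1) (nmem s' ''cap'') \<and>
          rmem s' ''c'' = c' \<and> nonneg_arcs N (nmem s' ''cap'') (reduced c' (\<lambda>x. rmem s' ''pot'' x 0)))"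
          using circulation_put_unused[OF circ uv R0 zero] nonneg_arcs_put[OF nonneg2 uv(1,2), of 1]
          by - (rule run_NAssign, simp add: array_set s3 s2 s1 r' flip: u_def v_def R_def)
      next
        assume "bval (RLess (RCell ''dist'' (nvar ''u'') (NConst 0)) (rvar ''D'')) s3"
        then have less: "dst u < D"
          by (simp add: s3 s2 s1 dst_def flip: u_def)
        \<comment> \<open>Below the cap, predecessors are guaranteed to lead back to v along
          shortest paths.\<close>
        define A where "A = {y. y < N \<and> dst y < D}"
        have tree: "pred_tree N ?r' v A pred vis"
          unfolding pred_tree_def
        proof (intro conjI ballI impI)
          fix y assume "y \<in> A" "y \<noteq> v"
          then have y: "y < N" "dst y < D" "y \<noteq> v" by (auto simp: A_def)
          note P = dj(5)[OF y]
          show "pred y \<in> A" using P nonneg' y by (force simp: A_def nonneg_arcs_def)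
          show "vis (pred y) < vis y" using P visited[OF y(1)] by auto
          show "?r' (pred y) y = 0" using P by (simp add: reduced_shift)
        qed (auto simp: A_def)
        let ?R = "put R v u 1" and ?C = "put C u v 1"
        \<comment> \<open>With one unit on the new arc, u has net outflow 1 and v has net inflow 1.
          This is the imbalance of \<open>pushing\<close> with its front at u.\<close>
        have row: "(\<Sum>b<N. ?R a b) + (if a = u then 1 else 0) = (\<Sum>b<N. ?C a b) + (if a = v then 1 else 0)"
          if "a < N" for a
          using sum_put[OF uv(1), of R v 1 a] sum_put[OF uv(2), of C u 1 a] that circ zero R0 uv(3)
          by (auto simp: circulation_def split: if_splits)
        have "?r' v u = - ?r' u v" using anti2[unfolded antisym_costs_def, rule_format, of v u] uv by simp
        then have "nonneg_arcs N ?R ?r'"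
          using less ruv by (intro nonneg_arcs_put nonneg2 uv) auto
        moreover have "?R a b + ?R b a = ?C a b + ?C b a" if "a < N" "b < N" for a b
          using that circ zero R0 uv(3) by (auto simp: circulation_def put_def)
        moreover have "0 < ?R (pred y) y" if "y \<in> A" "y \<noteq> v" for y
          using dj(5)[of y] that by (auto simp: A_def put_def)
        ultimately have push: "pushing N ?C ?r' v A pred vis u ?R"
          using row uv less unfolding pushing_def A_def by blast
        define s4 where "s4 = set_nat s3 ''cap'' v u 1"
        have s4: "rmem s4 = rmem s3" "nmem s4 ''cap'' = ?R" "nmem s4 ''v'' 0 0 = v" "nmem s4 ''u'' 0 0 = u"
            "(\<lambda>x. nmem s4 ''pred'' x 0) = pred" "(\<lambda>x. nmem s4 ''vis'' x 0) = vis"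
          by (auto simp: s4_def array_set s3 R_def u_def v_def pred_def vis_def)
        have "run L augment_com s4 (\<lambda>s'. circulation N ?C (nmem s' ''cap'') \<and> nonneg_arcs N (nmem s' ''cap'') ?r')"
          by (rule run_augment[where A = A]) (use s4 tree anti2 push dj(6) N A_def in \<open>auto intro: order_trans\<close>)
        then have "run L augment_com s4 (\<lambda>s'. circulation N ?C (nmem s' ''cap'') \<and>
          rmem s' ''c'' = c' \<and> nonneg_arcs N (nmem s' ''cap'') (reduced c' (\<lambda>x. rmem s' ''pot'' x 0)))"
          by (rule run_weaken) (auto simp: unchanged_def s4 s3 s2 s1 r')
        then show "run L (Seq (NAssign ''cap'' (nvar ''v'') (nvar ''u'') (NConst 1)) augment_com) s3
          (\<lambda>s'. circulation N (put C u v 1) (nmem s' ''cap'') \<and>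
            rmem s' ''c'' = c' \<and> nonneg_arcs N (nmem s' ''cap'') (reduced c' (\<lambda>x. rmem s' ''pot'' x 0)))"
          by - (intro run_Seq run_NAssign, simp add: s4_def s3 flip: u_def v_def)
      qed
    qed (use N s2 in auto)
  qed (use N s1 uv D nonneg' in \<open>simp_all flip: u_def v_def R_def p_def\<close>)
  have D_eq: "rval (RMinus (RConst 0) (reduced_exp (nvar ''u'') (nvar ''v'')))
      (set_real (set_real s ''c'' u v (- wt)) ''c'' v u wt) = D"
    by (simp add: array_set array_set_other put_apply D_def c'_def c_def p_def flip: u_def v_def)
  show ?thesis
    unfolding insert_com_def
    by (rule run_Seq, rule run_RAssign, rule run_Seq, rule run_RAssign, rule run_Seq, rule run_RAssign,
        rule run_Cond) (use 1 2 D_eq in \<open>simp_all add: s1 flip: u_def v_def wt_def s1_def\<close>)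
qed

section \<open>The flow network\<close>

text \<open>
  The arcs lead from the root 0 to the nodes of S, from there to copies of T (copy j for the j-th
  block of S), from the copies to T, and from T back to the root.
\<close>

definition snode :: "nat \<Rightarrow> nat" where "snode i = 1 + i"

definition tnode :: "nat \<Rightarrow> nat \<Rightarrow> nat" where "tnode n t = 1 + n + t"

definition wnode :: "nat \<Rightarrow> nat \<Rightarrow> nat \<Rightarrow> nat \<Rightarrow> nat" where "wnode n m j t = 1 + n + m + j * m + t"

text \<open>There is room for n blocks, a bound on their number that takes no division by 2 d - 1.
  Copies for indices that are no block receive no edge.\<close>

definition node_count :: "nat \<Rightarrow> nat \<Rightarrow> nat" where "node_count n m = 1 + n + m + n * m"

lemma sum_lessThan_add: "(\<Sum>y<a+b. h y) = (\<Sum>y<a. h y) + (\<Sum>y<b::nat. h (a + y) :: 'a::comm_monoid_add)"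
  by (induction b) (auto simp: add.assoc)

lemma sum_lessThan_mult: "(\<Sum>y<a*b. h y) = (\<Sum>j<a. \<Sum>y<b::nat. h (j * b + y) :: 'a::comm_monoid_add)"
proof (induction a)
  case (Suc a)
  then show ?case using sum_lessThan_add[of h "a * b" b] by (simp add: add.commute)
qed auto

lemma sum_nodes:
  "(\<Sum>y<node_count n m. h y) = h 0 + (\<Sum>i<n. h (snode i)) + (\<Sum>t<m. h (tnode n t)) +
     (\<Sum>j<n. \<Sum>t<m. h (wnode n m j t) :: 'a::comm_monoid_add)"
  unfolding node_count_def sum_lessThan_add sum_lessThan_mult snode_def tnode_def wnode_def
  by (simp add: add.assoc)

lemma node_less:
  "0 < node_count n m" "i < n \<Longrightarrow> snode i < node_count n m" "t < m \<Longrightarrow> tnode n t < node_count n m"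
  "j < n \<Longrightarrow> t < m \<Longrightarrow> wnode n m j t < node_count n m"
proof -
  assume "j < n" "t < m"
  then have "j * m + t < Suc j * m" by simp
  also have "Suc j * m \<le> n * m" using \<open>j < n\<close> by (intro mult_right_mono) auto
  finally have "j * m + t < n * m" .
  then show "wnode n m j t < node_count n m" by (simp add: wnode_def node_count_def)
qed (auto simp: snode_def tnode_def node_count_def)

lemma wnode_eq_iff:
  assumes "t < m" "t' < m"
  shows "wnode n m j t = wnode n m j' t' \<longleftrightarrow> j = j' \<and> t = t'"
proof
  assume "wnode n m j t = wnode n m j' t'"
  then have *: "j * m + t = j' * m + t'" by (simp add: wnode_def)
  then have "(j * m + t) mod m = (j' * m + t') mod m" "(j * m + t) div m = (j' * m + t') div m" by simp_all
  then show "j = j' \<and> t = t'" using assms by simp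
qed simp

lemma node_distinct:
  "snode i \<noteq> 0" "tnode n t \<noteq> 0" "wnode n m j t \<noteq> 0"
  "0 \<noteq> snode i" "0 \<noteq> tnode n t" "0 \<noteq> wnode n m j t"
  "snode i = snode i' \<longleftrightarrow> i = i'" "tnode n t = tnode n t' \<longleftrightarrow> t = t'"
  "i < n \<Longrightarrow> snode i \<noteq> tnode n t" "i < n \<Longrightarrow> tnode n t \<noteq> snode i"
  "i < n \<Longrightarrow> snode i \<noteq> wnode n m j t'" "i < n \<Longrightarrow> wnode n m j t' \<noteq> snode i"
  "t < m \<Longrightarrow> tnode n t \<noteq> wnode n m j t'" "t < m \<Longrightarrow> wnode n m j t' \<noteq> tnode n t"
  by (auto simp: snode_def tnode_def wnode_def)

text \<open>All sixteen combinations of the four kinds of nodes are listed, since conservation sums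
  over all nodes. The parameters \<open>a\<close>, \<open>b\<close>, \<open>g\<close> and
  \<open>J\<close> let the same predicate describe the network while it is being filled.\<close>

definition capacities :: "nat \<Rightarrow> nat \<Rightarrow> (nat \<Rightarrow> nat) \<Rightarrow> (nat \<Rightarrow> nat) \<Rightarrow> (nat \<Rightarrow> nat) \<Rightarrow>
    (nat \<Rightarrow> nat \<Rightarrow> nat) \<Rightarrow> (nat \<times> nat) set \<Rightarrow> (nat \<Rightarrow> nat \<Rightarrow> nat) \<Rightarrow> bool" where
  "capacities n m blk a b g J C \<longleftrightarrow>
     (C 0 0 = 0) \<and> (\<forall>i<n. C 0 (snode i) = a i) \<and> (\<forall>t<m. C 0 (tnode n t) = 0) \<and>
     (\<forall>j<n. \<forall>t<m. C 0 (wnode n m j t) = 0) \<and>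
     (\<forall>i<n. C (snode i) 0 = 0) \<and> (\<forall>i<n. \<forall>i'<n. C (snode i) (snode i') = 0) \<and>
     (\<forall>i<n. \<forall>t<m. C (snode i) (tnode n t) = 0) \<and>
     (\<forall>i<n. \<forall>j<n. \<forall>t<m. C (snode i) (wnode n m j t) = (if (i, t) \<in> J \<and> j = blk i then 1 else 0)) \<and>
     (\<forall>t<m. C (tnode n t) 0 = b t) \<and> (\<forall>t<m. \<forall>i<n. C (tnode n t) (snode i) = 0) \<and>
     (\<forall>t<m. \<forall>t'<m. C (tnode n t) (tnode n t') = 0) \<and>
     (\<forall>t<m. \<forall>j<n. \<forall>t'<m. C (tnode n t) (wnode n m j t') = 0) \<and>
     (\<forall>j<n. \<forall>t<m. C (wnode n m j t) 0 = 0) \<and> (\<forall>j<n. \<forall>t<m. \<forall>i<n. C (wnode n m j t) (snode i) = 0) \<and>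
     (\<forall>j<n. \<forall>t<m. \<forall>t'<m. C (wnode n m j t) (tnode n t') = (if t = t' then g j t else 0)) \<and>
     (\<forall>j<n. \<forall>t<m. \<forall>j'<n. \<forall>t'<m. C (wnode n m j t) (wnode n m j' t') = 0)"

lemma capacities_zero:
  assumes "\<And>x y. x < node_count n m \<Longrightarrow> y < node_count n m \<Longrightarrow> C x y = 0"
  shows "capacities n m blk (\<lambda>_. 0) (\<lambda>_. 0) (\<lambda>_ _. 0) {} C"
  using assms by (simp add: capacities_def node_less)

lemma capacities_put:
  assumes "capacities n m blk a b g J C"
  shows "i < n \<Longrightarrow> capacities n m blk (a(i := v)) b g J (put C 0 (snode i) v)"
    and "t < m \<Longrightarrow> capacities n m blk a (b(t := v)) g J (put C (tnode n t) 0 v)"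
    and "j < n \<Longrightarrow> t < m \<Longrightarrow> capacities n m blk a b (put g j t v) J (put C (wnode n m j t) (tnode n t) v)"
    and "i < n \<Longrightarrow> t < m \<Longrightarrow> blk i < n \<Longrightarrow>
      capacities n m blk a b g (insert (i, t) J) (put C (snode i) (wnode n m (blk i) t) 1)"
  using assms by (auto simp: capacities_def put_def node_distinct wnode_eq_iff)

text \<open>Weights enter with a minus sign, because the circulation minimises cost. Costs are
  prescribed on the arcs of the network; antisymmetry prices their reversals.\<close>

definition arc_costs :: "nat \<Rightarrow> nat \<Rightarrow> (nat \<Rightarrow> nat) \<Rightarrow> (nat \<times> nat \<Rightarrow> real) \<Rightarrow> (nat \<times> nat) set \<Rightarrow>
    (nat \<Rightarrow> nat \<Rightarrow> real) \<Rightarrow> bool" where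
  "arc_costs n m blk w J c \<longleftrightarrow> antisym_costs (node_count n m) c \<and>
     (\<forall>i<n. c 0 (snode i) = 0) \<and> (\<forall>t<m. c (tnode n t) 0 = 0) \<and>
     (\<forall>j<n. \<forall>t<m. c (wnode n m j t) (tnode n t) = 0) \<and>
     (\<forall>(i, t)\<in>J. c (snode i) (wnode n m (blk i) t) = - w (i, t))"

lemma arc_costs_put:
  assumes "arc_costs n m blk w J c" "i < n" "t < m" "blk i < n" "J \<subseteq> {..<n} \<times> {..<m}"
  shows "arc_costs n m blk w (insert (i, t) J)
    (put (put c (snode i) (wnode n m (blk i) t) (- w (i, t))) (wnode n m (blk i) t) (snode i) (w (i, t)))"
    (is "arc_costs _ _ _ _ _ ?c")
proof -
  have "?c x y = - ?c y x" if "x < node_count n m" "y < node_count n m" for x y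
  proof -
    have "c x y = - c y x" using assms(1) that unfolding arc_costs_def antisym_costs_def by blast
    then show ?thesis using assms(2) by (auto simp: put_def node_distinct)
  qed
  then have "antisym_costs (node_count n m) ?c" unfolding antisym_costs_def by blast
  then show ?thesis
    using assms by (auto simp: arc_costs_def put_def node_distinct wnode_eq_iff)
qed

section \<open>Integrality and optimality of the circulation\<close>

locale optimal_circulation =
  fixes n m :: nat and blk :: "nat \<Rightarrow> nat" and a b :: "nat \<Rightarrow> nat" and w :: "nat \<times> nat \<Rightarrow> real"
    and J :: "(nat \<times> nat) set" and C R :: "nat \<Rightarrow> nat \<Rightarrow> nat" and c :: "nat \<Rightarrow> nat \<Rightarrow> real" and p :: "nat \<Rightarrow> real"
  assumes circ: "circulation (node_count n m) C R"
    and caps: "capacities n m blk a b (\<lambda>_ _. 1) J C"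
    and costs: "arc_costs n m blk w J c"
    and nonneg: "nonneg_arcs (node_count n m) R (reduced c p)"
    and J: "J \<subseteq> {..<n} \<times> {..<m}" and blk: "\<And>i. i < n \<Longrightarrow> blk i < n"
begin

abbreviation "V \<equiv> node_count n m"

abbreviation "r \<equiv> reduced c p"

definition flow :: "nat \<Rightarrow> nat \<Rightarrow> real" where
  "flow x y = real (C x y) - real (R x y)"

text \<open>On an arc of capacity 1, the residual capacity of the reversal is the flow. The program
  reads off its matching from the same cells.\<close>

definition chosen :: "(nat \<times> nat) set" where
  "chosen = {(i, t) \<in> J. 0 < R (wnode n m (blk i) t) (snode i)}"

abbreviation chi :: "nat \<Rightarrow> nat \<Rightarrow> real" where
  "chi i t \<equiv> of_bool ((i, t) \<in> chosen)"

lemma residual_sum: "x < V \<Longrightarrow> y < V \<Longrightarrow> R x y + R y x = C x y + C y x"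
  using circ by (simp add: circulation_def)

lemma flow_antisym: "x < V \<Longrightarrow> y < V \<Longrightarrow> flow x y = - flow y x"
  using residual_sum[of x y] by (simp add: flow_def flip: of_nat_add)

lemma flow_row: "x < V \<Longrightarrow> (\<Sum>y<V. flow x y) = 0"
  using circ by (simp add: flow_def sum_subtractf circulation_def flip: of_nat_sum)

lemma flow_zero: "x < V \<Longrightarrow> y < V \<Longrightarrow> C x y = 0 \<Longrightarrow> C y x = 0 \<Longrightarrow> flow x y = 0"
  using residual_sum[of x y] by (simp add: flow_def)

lemma flow_bounds:
  assumes "x < V" "y < V" "C y x = 0"
  shows "0 \<le> flow x y" "flow x y \<le> C x y"
  using residual_sum[OF assms(1,2)] assms(3) by (simp_all add: flow_def)

lemma flow_edge:
  assumes "i < n" "j < n" "t < m"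
  shows "flow (snode i) (wnode n m j t) = (if j = blk i then chi i t else 0)"
proof -
  have C: "C (snode i) (wnode n m j t) = (if (i, t) \<in> J \<and> j = blk i then 1 else 0)"
      "C (wnode n m j t) (snode i) = 0"
    using caps assms by (simp_all add: capacities_def)
  have "R (snode i) (wnode n m j t) + R (wnode n m j t) (snode i) = (if (i, t) \<in> J \<and> j = blk i then 1 else 0)"
    using residual_sum[of "snode i" "wnode n m j t"] assms C by (simp add: node_less)
  then show ?thesis using C by (auto simp: flow_def chosen_def split: if_splits)
qed

text \<open>Conservation at a node of S. Together with its analogues at the copies and at T, it
  expresses all flow values through \<open>chi\<close>, so that capacities become constraints on
  \<open>chosen\<close>.\<close>

lemma flow_root:
  assumes "i < n" shows "flow 0 (snode i) = (\<Sum>t<m. chi i t)"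
proof -
  have "flow (snode i) y = 0" if "y \<in> snode ` {..<n} \<union> tnode n ` {..<m}" for y
    using that assms caps by (intro flow_zero) (auto simp: node_less capacities_def)
  then have "flow (snode i) 0 + (\<Sum>j<n. \<Sum>t<m. flow (snode i) (wnode n m j t)) = 0"
    using flow_row[of "snode i"] assms by (simp add: node_less sum_nodes)
  also have "(\<Sum>j<n. \<Sum>t<m. flow (snode i) (wnode n m j t)) = (\<Sum>j<n. if j = blk i then \<Sum>t<m. chi i t else 0)"
    using assms by (intro sum.cong) (auto simp: flow_edge)
  also have "\<dots> = (\<Sum>t<m. chi i t)" using blk[OF assms] by simp
  finally show ?thesis using flow_antisym[of 0 "snode i"] assms by (simp add: node_less)
qed

lemma flow_copy:
  assumes "j < n" "t < m"
  shows "flow (wnode n m j t) (tnode n t) = (\<Sum>i<n. if j = blk i then chi i t else 0)"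
proof -
  let ?w = "wnode n m j t"
  have "flow ?w 0 = 0" "\<And>j' t'. j' < n \<Longrightarrow> t' < m \<Longrightarrow> flow ?w (wnode n m j' t') = 0"
    "\<And>t'. t' < m \<Longrightarrow> t' \<noteq> t \<Longrightarrow> flow ?w (tnode n t') = 0"
    using assms caps by (intro flow_zero; auto simp: node_less capacities_def)+
  then have "(\<Sum>i<n. flow ?w (snode i)) + (\<Sum>t'<m. flow ?w (tnode n t')) = 0"
    using flow_row[of ?w] assms by (simp add: node_less sum_nodes)
  also have "(\<Sum>t'<m. flow ?w (tnode n t')) = (\<Sum>t'<m. if t' = t then flow ?w (tnode n t) else 0)"
    using \<open>\<And>t'. t' < m \<Longrightarrow> t' \<noteq> t \<Longrightarrow> flow ?w (tnode n t') = 0\<close> by (intro sum.cong) auto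
  also have "\<dots> = flow ?w (tnode n t)" using assms by simp
  also have "(\<Sum>i<n. flow ?w (snode i)) = - (\<Sum>i<n. flow (snode i) ?w)"
    unfolding sum_negf[symmetric] using assms by (intro sum.cong flow_antisym) (auto simp: node_less)
  also have "(\<Sum>i<n. flow (snode i) ?w) = (\<Sum>i<n. if j = blk i then chi i t else 0)"
    using assms by (intro sum.cong) (auto simp: flow_edge)
  finally show ?thesis by simp
qed

lemma sum_blk:
  "(\<Sum>j<n. \<Sum>i<n. if j = blk i then f j i else 0 :: real) = (\<Sum>i<n. f (blk i) i)"
  by (subst sum.swap) (auto intro!: sum.cong simp: blk)

lemma flow_sink:
  assumes "t < m" shows "flow (tnode n t) 0 = (\<Sum>i<n. chi i t)"
proof -
  let ?t = "tnode n t"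
  have "\<And>i. i < n \<Longrightarrow> flow ?t (snode i) = 0" "\<And>t'. t' < m \<Longrightarrow> flow ?t (tnode n t') = 0"
    and z: "\<And>j t'. j < n \<Longrightarrow> t' < m \<Longrightarrow> t' \<noteq> t \<Longrightarrow> flow ?t (wnode n m j t') = 0"
    using assms caps by (intro flow_zero; auto simp: node_less capacities_def)+
  then have "flow ?t 0 + (\<Sum>j<n. \<Sum>t'<m. flow ?t (wnode n m j t')) = 0"
    using flow_row[of ?t] assms by (simp add: node_less sum_nodes)
  also have "(\<Sum>j<n. \<Sum>t'<m. flow ?t (wnode n m j t')) =
      (\<Sum>j<n. \<Sum>t'<m. if t' = t then flow ?t (wnode n m j t) else 0)"
    using z by (intro sum.cong) auto
  also have "\<dots> = (\<Sum>j<n. - flow (wnode n m j t) ?t)"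
    using assms by (intro sum.cong) (auto simp: node_less intro!: flow_antisym)
  also have "\<dots> = - (\<Sum>j<n. \<Sum>i<n. if j = blk i then chi i t else 0)"
    using assms by (simp add: sum_negf flow_copy)
  also have "\<dots> = - (\<Sum>i<n. chi i t)" by (subst sum_blk) simp
  finally show ?thesis by simp
qed

lemma sum_chi_fst: "i < n \<Longrightarrow> (\<Sum>t<m. chi i t) = real (card {e \<in> chosen. fst e = i})"
proof -
  assume "i < n"
  have "{e \<in> chosen. fst e = i} = Pair i ` {t. t < m \<and> (i, t) \<in> chosen}"
    using J by (auto simp: chosen_def)
  then have "card {e \<in> chosen. fst e = i} = card {t. t < m \<and> (i, t) \<in> chosen}"
    by (simp add: card_image inj_on_def)
  then show ?thesis by (simp add: of_bool_def sum.If_cases Collect_conj_eq lessThan_def)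
qed

lemma sum_chi_snd: "t < m \<Longrightarrow> (\<Sum>i<n. chi i t) = real (card {e \<in> chosen. snd e = t})"
proof -
  assume "t < m"
  have "{e \<in> chosen. snd e = t} = (\<lambda>i. (i, t)) ` {i. i < n \<and> (i, t) \<in> chosen}"
    using J by (auto simp: chosen_def)
  then have "card {e \<in> chosen. snd e = t} = card {i. i < n \<and> (i, t) \<in> chosen}"
    by (simp add: card_image inj_on_def)
  then show ?thesis by (simp add: of_bool_def sum.If_cases Collect_conj_eq lessThan_def)
qed

lemma chosen_degrees:
  shows "i < n \<Longrightarrow> card {e \<in> chosen. fst e = i} \<le> a i" "t < m \<Longrightarrow> card {e \<in> chosen. snd e = t} \<le> b t"
proof -
  assume i: "i < n"
  then have "flow 0 (snode i) \<le> a i" using caps flow_bounds(2)[of 0 "snode i"]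
    by (simp add: node_less capacities_def)
  then show "card {e \<in> chosen. fst e = i} \<le> a i" using flow_root[OF i] sum_chi_fst[OF i] by linarith
next
  assume t: "t < m"
  then have "flow (tnode n t) 0 \<le> b t" using caps flow_bounds(2)[of "tnode n t" 0]
    by (simp add: node_less capacities_def)
  then show "card {e \<in> chosen. snd e = t} \<le> b t" using flow_sink[OF t] sum_chi_snd[OF t] by linarith
qed

text \<open>The arc from a copy to its node of T has capacity 1, and two chosen edges of one block
  would put two units on it.\<close>

lemma chosen_block:
  assumes "(i, t) \<in> chosen" "(i', t) \<in> chosen" "blk i = blk i'"
  shows "i = i'"
proof (rule ccontr)
  assume "i \<noteq> i'"
  have it: "i < n" "i' < n" "t < m" using assms J by (auto simp: chosen_def)
  have "(\<Sum>k\<in>{i, i'}. if blk i = blk k then chi k t else 0) \<le> (\<Sum>k<n. if blk i = blk k then chi k t else 0)"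
    using it by (intro sum_mono2) auto
  also have "\<dots> = flow (wnode n m (blk i) t) (tnode n t)" using it blk by (simp add: flow_copy)
  also have "\<dots> \<le> 1"
    using caps it blk flow_bounds(2)[of "wnode n m (blk i) t" "tnode n t"]
    by (simp add: node_less capacities_def)
  finally show False using assms \<open>i \<noteq> i'\<close> by simp
qed

text \<open>If the reduced cost is positive, the reversal cannot be residual and the flow is 0; if
  it is negative, the arc is saturated. In both cases the flow minimises \<open>r x y * h\<close>
  over all admissible h.\<close>

lemma complementary_slackness:
  assumes "x < V" "y < V" "C y x = 0" "0 \<le> h" "h \<le> real (C x y)"
  shows "r x y * flow x y \<le> r x y * h"
proof -
  have "c y x = - c x y" using costs assms unfolding arc_costs_def antisym_costs_def by blast
  then have anti: "r y x = - r x y" by (simp add: reduced_def)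
  consider "r x y = 0" | "0 < r x y" | "r x y < 0" by linarith
  then show ?thesis
  proof cases
    case 2
    then have "R y x = 0" using nonneg anti assms unfolding nonneg_arcs_def
      by (metis neg_0_le_iff_le not_gr_zero not_less)
    then have "flow x y = 0" using residual_sum[OF assms(1,2)] assms by (simp add: flow_def)
    then show ?thesis using 2 assms by simp
  next
    case 3
    then have "R x y = 0" using nonneg assms unfolding nonneg_arcs_def by (metis not_gr_zero not_less)
    then show ?thesis using 3 assms by (simp add: flow_def)
  qed simp
qed

text \<open>
  The reduced costs along the cycle through the edge (i, t) add up to minus the weight of that
  edge. Hence the weight of a fractional solution is a combination of the reduced costs.
\<close>

lemma weight_by_reduced_costs:
  assumes X: "\<And>i t. (i, t) \<notin> J \<Longrightarrow> X i t = 0"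
  shows "- (\<Sum>(i, t)\<in>J. w (i, t) * X i t) =
    (\<Sum>i<n. \<Sum>t<m. r (snode i) (wnode n m (blk i) t) * X i t) +
    (\<Sum>i<n. r 0 (snode i) * (\<Sum>t<m. X i t)) + (\<Sum>t<m. r (tnode n t) 0 * (\<Sum>i<n. X i t)) +
    (\<Sum>t<m. \<Sum>j<n. r (wnode n m j t) (tnode n t) * (\<Sum>i<n. if j = blk i then X i t else 0))"
proof -
  let ?q = "\<lambda>i t. r (snode i) (wnode n m (blk i) t) + r 0 (snode i) + r (tnode n t) 0 +
       r (wnode n m (blk i) t) (tnode n t)"
  have q: "?q i t = - w (i, t)" if "(i, t) \<in> J" for i t
  proof -
    have "i < n" "t < m" using that J by auto
    then show ?thesis using that costs blk by (force simp: arc_costs_def reduced_def)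
  qed
  have "- (\<Sum>(i, t)\<in>J. w (i, t) * X i t) = (\<Sum>(i, t)\<in>J. ?q i t * X i t)"
    unfolding sum_negf[symmetric] using q by (intro sum.cong) auto
  also have "\<dots> = (\<Sum>(i, t)\<in>{..<n} \<times> {..<m}. ?q i t * X i t)"
    using J X by (intro sum.mono_neutral_left) auto
  also have "\<dots> = (\<Sum>i<n. \<Sum>t<m. ?q i t * X i t)"
    by (simp add: sum.cartesian_product)
  also have "\<dots> = (\<Sum>i<n. \<Sum>t<m. r (snode i) (wnode n m (blk i) t) * X i t) +
    (\<Sum>i<n. \<Sum>t<m. r 0 (snode i) * X i t) + (\<Sum>i<n. \<Sum>t<m. r (tnode n t) 0 * X i t) +
    (\<Sum>i<n. \<Sum>t<m. r (wnode n m (blk i) t) (tnode n t) * X i t)"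
    by (simp add: distrib_right sum.distrib)
  also have "(\<Sum>i<n. \<Sum>t<m. r (tnode n t) 0 * X i t) = (\<Sum>t<m. \<Sum>i<n. r (tnode n t) 0 * X i t)"
    by (rule sum.swap)
  also have "(\<Sum>i<n. \<Sum>t<m. r (wnode n m (blk i) t) (tnode n t) * X i t) =
     (\<Sum>t<m. \<Sum>i<n. r (wnode n m (blk i) t) (tnode n t) * X i t)"
    by (rule sum.swap)
  also have "\<dots> = (\<Sum>t<m. \<Sum>j<n. \<Sum>i<n. if j = blk i then r (wnode n m j t) (tnode n t) * X i t else 0)"
    by (simp only: sum_blk)
  also have "\<dots> = (\<Sum>t<m. \<Sum>j<n. r (wnode n m j t) (tnode n t) * (\<Sum>i<n. if j = blk i then X i t else 0))"
    by (simp add: sum_distrib_left if_distrib cong: if_cong)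
  finally show ?thesis by (simp add: sum_distrib_left)
qed

text \<open>The hypotheses say that x induces a fractional circulation within the capacities.
  Complementary slackness on each of the four kinds of arcs then shows that its cost is no lower
  than that of the integral one.\<close>

lemma chosen_optimal:
  fixes x :: "nat \<times> nat \<Rightarrow> real"
  assumes x0: "\<And>e. e \<in> J \<Longrightarrow> 0 \<le> x e"
    and xa: "\<And>i. i < n \<Longrightarrow> (\<Sum>e | e \<in> J \<and> fst e = i. x e) \<le> a i"
    and xb: "\<And>t. t < m \<Longrightarrow> (\<Sum>e | e \<in> J \<and> snd e = t. x e) \<le> b t"
    and xg: "\<And>j t. j < n \<Longrightarrow> t < m \<Longrightarrow> (\<Sum>e | e \<in> J \<and> snd e = t \<and> blk (fst e) = j. x e) \<le> 1"
  shows "(\<Sum>e\<in>J. w e * x e) \<le> (\<Sum>e\<in>chosen. w e)"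
proof -
  define X where "X i t = (if (i, t) \<in> J then x (i, t) else 0)" for i t
  have fin: "finite J" using J by (rule finite_subset) auto
  have X0: "0 \<le> X i t" for i t using x0 by (simp add: X_def)
  have Xa: "(\<Sum>t<m. X i t) \<le> a i" if "i < n" for i
  proof -
    have "(\<Sum>t<m. X i t) = (\<Sum>e\<in>Pair i ` {t. t < m \<and> (i, t) \<in> J}. x e)"
      by (subst sum.reindex) (auto simp: inj_on_def X_def sum.If_cases Collect_conj_eq lessThan_def)
    also have "Pair i ` {t. t < m \<and> (i, t) \<in> J} = {e. e \<in> J \<and> fst e = i}" using J by auto
    finally show ?thesis using xa[OF that] by simp
  qed
  have Xb': "(\<Sum>i<n. if P i then X i t else 0) = (\<Sum>e | e \<in> J \<and> snd e = t \<and> P (fst e). x e)"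
    for t P
  proof -
    have "(\<Sum>i<n. if P i then X i t else 0) = (\<Sum>i<n. if P i \<and> (i, t) \<in> J then x (i, t) else 0)"
      by (intro sum.cong) (auto simp: X_def)
    also have "\<dots> = (\<Sum>e\<in>(\<lambda>i. (i, t)) ` {i. i < n \<and> P i \<and> (i, t) \<in> J}. x e)"
      by (subst sum.reindex) (auto simp: inj_on_def sum.If_cases Collect_conj_eq lessThan_def)
    also have "(\<lambda>i. (i, t)) ` {i. i < n \<and> P i \<and> (i, t) \<in> J} = {e. e \<in> J \<and> snd e = t \<and> P (fst e)}"
      using J by auto
    finally show ?thesis .
  qed
  have Xb: "(\<Sum>i<n. X i t) \<le> b t" if "t < m" for t
    using Xb'[of "\<lambda>_. True" t] xb[OF that] by simp
  have Xg: "(\<Sum>i<n. if j = blk i then X i t else 0) \<le> 1" if "j < n" "t < m" for j t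
    using Xb'[of "\<lambda>i. j = blk i" t] xg[OF that] by (simp add: eq_commute)
  \<comment> \<open>No hypothesis bounds a single variable directly; the bound 1 comes from the
    inequality for the block of i.\<close>
  have X1: "X i t \<le> C (snode i) (wnode n m (blk i) t)" if "i < n" "t < m" for i t
  proof -
    have "(\<Sum>k\<in>{i}. if blk i = blk k then X k t else 0) \<le> (\<Sum>k<n. if blk i = blk k then X k t else 0)"
      using that X0 by (intro sum_mono2) auto
    then have "X i t \<le> 1" using Xg[OF blk[OF that(1)] that(2)] by simp
    moreover have "C (snode i) (wnode n m (blk i) t) = (if (i, t) \<in> J then 1 else 0)"
      using caps that blk by (simp add: capacities_def)
    ultimately show ?thesis by (simp add: X_def split: if_splits)
  qed
  note cs = complementary_slackness and nl = node_less blk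
  have 1: "(\<Sum>i<n. \<Sum>t<m. r (snode i) (wnode n m (blk i) t) * chi i t) \<le>
      (\<Sum>i<n. \<Sum>t<m. r (snode i) (wnode n m (blk i) t) * X i t)"
  proof (intro sum_mono)
    fix i t assume "i \<in> {..<n}" "t \<in> {..<m}"
    then have it: "i < n" "t < m" by auto
    then have "C (wnode n m (blk i) t) (snode i) = 0" using caps blk by (simp add: capacities_def)
    with it show "r (snode i) (wnode n m (blk i) t) * chi i t \<le> r (snode i) (wnode n m (blk i) t) * X i t"
      using cs[of "snode i" "wnode n m (blk i) t" "X i t"] X0 X1[OF it] by (simp add: nl flow_edge)
  qed
  have 2: "(\<Sum>i<n. r 0 (snode i) * (\<Sum>t<m. chi i t)) \<le> (\<Sum>i<n. r 0 (snode i) * (\<Sum>t<m. X i t))"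
  proof (intro sum_mono)
    fix i assume "i \<in> {..<n}"
    then have i: "i < n" by auto
    then have "C (snode i) 0 = 0" "C 0 (snode i) = a i" using caps by (simp_all add: capacities_def)
    with i show "r 0 (snode i) * (\<Sum>t<m. chi i t) \<le> r 0 (snode i) * (\<Sum>t<m. X i t)"
      using cs[of 0 "snode i" "\<Sum>t<m. X i t"] X0 Xa[OF i] by (simp add: nl flow_root sum_nonneg)
  qed
  have 3: "(\<Sum>t<m. r (tnode n t) 0 * (\<Sum>i<n. chi i t)) \<le> (\<Sum>t<m. r (tnode n t) 0 * (\<Sum>i<n. X i t))"
  proof (intro sum_mono)
    fix t assume "t \<in> {..<m}"
    then have t: "t < m" by auto
    then have "C (tnode n t) 0 = b t" "C 0 (tnode n t) = 0" using caps by (simp_all add: capacities_def)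
    with t show "r (tnode n t) 0 * (\<Sum>i<n. chi i t) \<le> r (tnode n t) 0 * (\<Sum>i<n. X i t)"
      using cs[of "tnode n t" 0 "\<Sum>i<n. X i t"] X0 Xb[OF t] by (simp add: nl flow_sink sum_nonneg)
  qed
  have 4: "(\<Sum>t<m. \<Sum>j<n. r (wnode n m j t) (tnode n t) * (\<Sum>i<n. if j = blk i then chi i t else 0)) \<le>
     (\<Sum>t<m. \<Sum>j<n. r (wnode n m j t) (tnode n t) * (\<Sum>i<n. if j = blk i then X i t else 0))"
  proof (intro sum_mono)
    fix t j assume "t \<in> {..<m}" "j \<in> {..<n}"
    then have jt: "j < n" "t < m" by auto
    then have "C (tnode n t) (wnode n m j t) = 0" "C (wnode n m j t) (tnode n t) = 1"
      using caps by (simp_all add: capacities_def)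
    with jt show "r (wnode n m j t) (tnode n t) * (\<Sum>i<n. if j = blk i then chi i t else 0) \<le>
       r (wnode n m j t) (tnode n t) * (\<Sum>i<n. if j = blk i then X i t else 0)"
      using cs[of "wnode n m j t" "tnode n t" "\<Sum>i<n. if j = blk i then X i t else 0"] X0 Xg[OF jt]
      by (simp add: nl flow_copy sum_nonneg)
  qed
  have sub: "chosen \<subseteq> J" by (auto simp: chosen_def)
  \<comment> \<open>Both sides are instances of the same identity, so the four comparisons add
    up.\<close>
  have "- (\<Sum>(i, t)\<in>J. w (i, t) * chi i t) \<le> - (\<Sum>(i, t)\<in>J. w (i, t) * X i t)"
    using 1 2 3 4 sub by (subst (1 2) weight_by_reduced_costs) (auto simp: X_def)
  moreover have "(\<Sum>(i, t)\<in>J. w (i, t) * chi i t) = (\<Sum>e\<in>chosen. w e)"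
    using sub fin by (auto simp: case_prod_unfold of_bool_def sum.inter_restrict[symmetric]
        intro!: sum.mono_neutral_cong_right)
  moreover have "(\<Sum>(i, t)\<in>J. w (i, t) * X i t) = (\<Sum>e\<in>J. w e * x e)"
    by (intro sum.cong) (auto simp: X_def)
  ultimately show ?thesis by simp
qed

end

section \<open>Restricting the instance\<close>

lemma mod_add_less: "a < n \<Longrightarrow> b < n \<Longrightarrow> (a + b) mod n = (if a + b < n then a + b else a + b - n)" for a b n :: nat
  by (simp add: le_mod_geq)

text \<open>The position of node i in the cyclic order that starts at node h.\<close>

definition slot :: "problem \<Rightarrow> nat \<Rightarrow> nat \<Rightarrow> nat" where
  "slot I h i = (i + num_S I - h) mod num_S I"

definition block_length :: "problem \<Rightarrow> nat" where
  "block_length I = 2 * min_dist I - 1"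

definition block :: "problem \<Rightarrow> nat \<Rightarrow> nat \<Rightarrow> nat" where
  "block I h i = slot I h i div block_length I"

definition kept :: "problem \<Rightarrow> nat \<Rightarrow> nat \<Rightarrow> bool" where
  "kept I h i \<longleftrightarrow> slot I h i mod block_length I < min_dist I"

definition kept_edges :: "problem \<Rightarrow> nat \<Rightarrow> (nat \<times> nat) set" where
  "kept_edges I h = {e \<in> edges I. kept I h (fst e)}"

text \<open>An infinite bound becomes the size of the opposite side. This cuts off no LP solution on
  the kept edges, since there each value is at most 1 by \<open>lp_le_one\<close>.\<close>

definition cap_S :: "problem \<Rightarrow> nat \<Rightarrow> nat" where
  "cap_S I i = (case bound I (SNode i) of enat k \<Rightarrow> k | \<infinity> \<Rightarrow> num_T I)"

definition cap_T :: "problem \<Rightarrow> nat \<Rightarrow> nat" where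
  "cap_T I t = (case bound I (TNode t) of enat k \<Rightarrow> k | \<infinity> \<Rightarrow> num_S I)"

locale divisible_instance =
  fixes I :: problem
  assumes valid: "valid_problem I" and d_pos: "0 < min_dist I" and dvd: "block_length I dvd num_S I"
begin

abbreviation "n \<equiv> num_S I"
abbreviation "m \<equiv> num_T I"
abbreviation "d \<equiv> min_dist I"
abbreviation "q \<equiv> block_length I"

lemma q_eq: "q = 2 * d - 1" and q_pos: "0 < q" and q_d: "q + 1 = 2 * d"
  using d_pos by (auto simp: block_length_def)

lemma edges_subset: "edges I \<subseteq> {..<n} \<times> {..<m}"
  using valid by (simp add: valid_problem_def)

lemma finite_edges: "finite (edges I)"
  using edges_subset by (rule finite_subset) auto

lemma weight_nonneg: "e \<in> edges I \<Longrightarrow> 0 \<le> weight I e"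
  using valid by (simp add: valid_problem_def)

lemma slot_less: "i < n \<Longrightarrow> slot I h i < n"
  by (simp add: slot_def)

lemma slot_eq: "i < n \<Longrightarrow> h < n \<Longrightarrow> slot I h i = (if h \<le> i then i - h else i + n - h)"
  using mod_add_less[of i n "n - h"] by (cases "h = 0") (auto simp: slot_def)

lemma slot_inverse: "i < n \<Longrightarrow> h < n \<Longrightarrow> (slot I h i + h) mod n = i"
  by (simp add: slot_eq)

lemma slot_of: "k < n \<Longrightarrow> h < n \<Longrightarrow> slot I h ((k + h) mod n) = k"
  using mod_add_less[of k n h] by (subst slot_eq) auto

lemma block_less: "i < n \<Longrightarrow> block I h i < n"
  unfolding block_def using slot_less[of i h] by (meson div_le_dividend le_less_trans)

text \<open>A kept position has offset at most d - 1 in a block of length 2 d - 1, so the next block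
  begins at least d positions later. The second inequality is the same statement around the
  cycle.\<close>

lemma slot_distance:
  assumes "s < n" "s' < n" "s mod q < d" "s' mod q < d" "s div q < s' div q"
  shows "s + d \<le> s'" "s' + d \<le> n + s"
proof -
  obtain z where z: "n = q * z" using dvd by auto
  have s: "s = q * (s div q) + s mod q" "s' = q * (s' div q) + s' mod q" by simp_all
  have "q * (s div q) + q \<le> q * (s' div q)"
    using assms(5) by (metis mult_Suc_right Suc_leI add.commute mult_le_mono2)
  then show "s + d \<le> s'" using s assms(3) q_d by linarith
  \<comment> \<open>Divisibility enters here: the block of s' is complete and ends before the
    cut.\<close>
  have "s' div q < z" using assms(2) q_pos z by (simp add: div_less_iff_less_mult mult.commute)
  then have "q * (s' div q) + q \<le> n"
    unfolding z by (metis mult_Suc_right Suc_leI add.commute mult_le_mono2)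
  then show "s' + d \<le> n + s" using s assms(4) q_d by linarith
qed

text \<open>Passing from positions to indices is a rotation, which either keeps the absolute
  difference or replaces it by n minus it. The second case exchanges the two bounds.\<close>

lemma kept_distance:
  assumes "i < n" "j < n" "h < n" "kept I h i" "kept I h j" "block I h i \<noteq> block I h j"
  shows "int d \<le> \<bar>int i - int j\<bar> \<and> \<bar>int i - int j\<bar> \<le> int n - int d"
proof -
  have "slot I h i + d \<le> slot I h j \<and> slot I h j + d \<le> n + slot I h i \<or>
    slot I h j + d \<le> slot I h i \<and> slot I h i + d \<le> n + slot I h j"
    using assms slot_distance slot_less unfolding kept_def block_def by (metis linorder_neqE_nat)
  then show ?thesis using assms(1-3) by (auto simp: slot_eq split: if_splits)
qed

text \<open>The offset of a kept node in its block is below d and serves as the offset in the window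
  that starts with the block. Thus a window inequality of the LP yields the capacity 1 of a
  copy.\<close>

lemma block_window:
  assumes "h < n" "i < n" "kept I h i"
  shows "i \<in> window I ((h + q * block I h i) mod n)"
proof -
  let ?s = "slot I h i"
  have "i = (?s + h) mod n" using slot_inverse assms by simp
  also have "?s + h = (h + q * block I h i) + ?s mod q" by (simp add: block_def)
  also have "\<dots> mod n = ((h + q * block I h i) mod n + ?s mod q) mod n" by (simp add: mod_add_left_eq)
  finally show ?thesis using assms(3) unfolding window_def kept_def by blast
qed

lemma lp_block:
  assumes x: "lp_feasible I x" and h: "h < n" and t: "t < m"
  shows "(\<Sum>e | e \<in> kept_edges I h \<and> snd e = t \<and> block I h (fst e) = j. x e) \<le> 1"
proof -
  let ?i = "(h + q * j) mod n"
  have "(\<Sum>e | e \<in> kept_edges I h \<and> snd e = t \<and> block I h (fst e) = j. x e) \<le>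
    (\<Sum>e | e \<in> edges I \<and> snd e = t \<and> fst e \<in> window I ?i. x e)"
    using x finite_edges edges_subset block_window[OF h]
    by (intro sum_mono2) (auto simp: kept_edges_def lp_feasible_def)
  also have "\<dots> \<le> 1" using x h t by (simp add: lp_feasible_def)
  finally show ?thesis .
qed

text \<open>The LP bounds no single variable explicitly; the inequality for the block of the edge
  does.\<close>

lemma lp_le_one:
  assumes x: "lp_feasible I x" and h: "h < n" and e: "e \<in> kept_edges I h"
  shows "x e \<le> 1"
proof -
  have "x e = (\<Sum>e\<in>{e}. x e)" by simp
  also have "\<dots> \<le> (\<Sum>e' | e' \<in> kept_edges I h \<and> snd e' = snd e \<and> block I h (fst e') = block I h (fst e). x e')"
    using x finite_edges e by (intro sum_mono2) (auto simp: kept_edges_def lp_feasible_def)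
  also have "\<dots> \<le> 1" using e edges_subset by (intro lp_block x h) (auto simp: kept_edges_def)
  finally show ?thesis .
qed

lemma lp_degree_S:
  assumes x: "lp_feasible I x" and h: "h < n" and i: "i < n"
  shows "(\<Sum>e | e \<in> kept_edges I h \<and> fst e = i. x e) \<le> cap_S I i"
proof (cases "bound I (SNode i)")
  case (enat k)
  have "(\<Sum>e | e \<in> kept_edges I h \<and> fst e = i. x e) \<le> (\<Sum>e\<in>incident_edges I (SNode i). x e)"
    using x finite_edges by (intro sum_mono2) (auto simp: kept_edges_def lp_feasible_def)
  also have "ereal \<dots> \<le> ereal_of_enat (bound I (SNode i))"
    using x i unfolding lp_feasible_def nodes_def by blast
  then have "(\<Sum>e\<in>incident_edges I (SNode i). x e) \<le> k" using enat by simp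
  finally show ?thesis using enat by (simp add: cap_S_def)
next
  case infinity
  have sub: "{e. e \<in> kept_edges I h \<and> fst e = i} \<subseteq> Pair i ` {..<m}"
    using edges_subset by (auto simp: kept_edges_def)
  have "(\<Sum>e | e \<in> kept_edges I h \<and> fst e = i. x e) \<le> (\<Sum>e | e \<in> kept_edges I h \<and> fst e = i. 1)"
    using lp_le_one[OF x h] by (intro sum_mono) auto
  also have "\<dots> \<le> card (Pair i ` {..<m})" using card_mono[OF _ sub] by simp
  also have "\<dots> \<le> m" by (metis card_image_le card_lessThan finite_lessThan of_nat_mono)
  finally show ?thesis using infinity by (simp add: cap_S_def)
qed

lemma lp_degree_T:
  assumes x: "lp_feasible I x" and h: "h < n" and t: "t < m"
  shows "(\<Sum>e | e \<in> kept_edges I h \<and> snd e = t. x e) \<le> cap_T I t"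
proof (cases "bound I (TNode t)")
  case (enat k)
  have "(\<Sum>e | e \<in> kept_edges I h \<and> snd e = t. x e) \<le> (\<Sum>e\<in>incident_edges I (TNode t). x e)"
    using x finite_edges by (intro sum_mono2) (auto simp: kept_edges_def lp_feasible_def)
  also have "ereal \<dots> \<le> ereal_of_enat (bound I (TNode t))"
    using x t unfolding lp_feasible_def nodes_def by blast
  then have "(\<Sum>e\<in>incident_edges I (TNode t). x e) \<le> k" using enat by simp
  finally show ?thesis using enat by (simp add: cap_T_def)
next
  case infinity
  have sub: "{e. e \<in> kept_edges I h \<and> snd e = t} \<subseteq> (\<lambda>i. (i, t)) ` {..<n}"
    using edges_subset by (auto simp: kept_edges_def)
  have "(\<Sum>e | e \<in> kept_edges I h \<and> snd e = t. x e) \<le> (\<Sum>e | e \<in> kept_edges I h \<and> snd e = t. 1)"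
    using lp_le_one[OF x h] by (intro sum_mono) auto
  also have "\<dots> \<le> card ((\<lambda>i. (i, t)) ` {..<n})" using card_mono[OF _ sub] by simp
  also have "\<dots> \<le> n" by (metis card_image_le card_lessThan finite_lessThan of_nat_mono)
  finally show ?thesis using infinity by (simp add: cap_T_def)
qed

text \<open>The comparison is with all LP solutions and not just with matchings, because it has to
  bound the integrality gap as well.\<close>

definition restricted_optimum :: "nat \<Rightarrow> (nat \<times> nat) set \<Rightarrow> bool" where
  "restricted_optimum h M \<longleftrightarrow> cyclic_matching I M \<and>
     (\<forall>x. lp_feasible I x \<longrightarrow> (\<Sum>e\<in>kept_edges I h. weight I e * x e) \<le> matching_weight I M)"

text \<open>Two chosen edges at one node of T lie in different blocks by
  \<open>chosen_block\<close>, hence are far apart by \<open>kept_distance\<close>. Optimality holds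
  because LP solutions satisfy the constraints of the network.\<close>

lemma restricted_optimum_chosen:
  assumes h: "h < n"
    and opt: "optimal_circulation n m (block I h) (cap_S I) (cap_T I) (weight I) (kept_edges I h) C R c p"
  shows "restricted_optimum h (optimal_circulation.chosen n m (block I h) (kept_edges I h) R)"
proof -
  interpret optimal_circulation n m "block I h" "cap_S I" "cap_T I" "weight I" "kept_edges I h" C R c p
    by fact
  have sub: "chosen \<subseteq> kept_edges I h" "kept_edges I h \<subseteq> edges I"
    unfolding chosen_def by (blast, auto simp: kept_edges_def)
  have "enat (card (chosen \<inter> incident_edges I v)) \<le> bound I v" if "v \<in> nodes I" for v
  proof (cases v)
    case (SNode i)
    then have "i < n" using that by (auto simp: nodes_def)
    moreover have "chosen \<inter> incident_edges I v = {e \<in> chosen. fst e = i}" using sub SNode by auto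
    ultimately show ?thesis
      using chosen_degrees(1)[of i] SNode by (auto simp: cap_S_def split: enat.splits)
  next
    case (TNode t)
    then have "t < m" using that by (auto simp: nodes_def)
    moreover have "chosen \<inter> incident_edges I v = {e \<in> chosen. snd e = t}" using sub TNode by auto
    ultimately show ?thesis
      using chosen_degrees(2)[of t] TNode by (auto simp: cap_T_def split: enat.splits)
  qed
  moreover have "int d \<le> \<bar>int i - int j\<bar> \<and> \<bar>int i - int j\<bar> \<le> int n - int d"
    if "(i, t) \<in> chosen" "(j, t) \<in> chosen" "i \<noteq> j" for i j t
    using that chosen_block[of i t j] sub edges_subset h
    by (intro kept_distance[of _ _ h]) (auto simp: kept_edges_def)
  ultimately have "cyclic_matching I chosen" using sub by (auto simp: cyclic_matching_def)
  moreover have "(\<Sum>e\<in>kept_edges I h. weight I e * x e) \<le> matching_weight I chosen" if "lp_feasible I x" for x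
    unfolding matching_weight_def
    using that h sub lp_degree_S lp_degree_T lp_block
    by (intro chosen_optimal) (auto simp: lp_feasible_def)
  ultimately show ?thesis by (simp add: restricted_optimum_def)
qed

section \<open>Averaging over the starting points\<close>

text \<open>While h runs through q consecutive values, the offset of i in its block takes every
  residue modulo q exactly once, and d of these residues are below d.\<close>

lemma card_starts:
  assumes "i < n" shows "card {h. h < q \<and> kept I h i} = d"
proof -
  let ?f = "\<lambda>h. (i + n - h) mod q"
  \<comment> \<open>This keeps the subtraction in \<open>i + n - h\<close> from being truncated for
    h < q.\<close>
  have "q \<le> n" using dvd assms by (auto intro: dvd_imp_le)
  \<comment> \<open>As q divides n, reduction modulo n does not affect residues modulo q.\<close>
  have kept: "kept I h i \<longleftrightarrow> ?f h < d" for h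
    using dvd by (simp add: kept_def slot_def mod_mod_cancel)
  have inj: "inj_on ?f {..<q}"
  proof (rule linorder_inj_onI)
    fix h h' assume h: "h < h'" "h \<in> {..<q}" "h' \<in> {..<q}"
    show "?f h \<noteq> ?f h'"
    proof
      assume "?f h = ?f h'"
      then have "q dvd (i + n - h) - (i + n - h')" by (rule mod_eq_dvd_iff_nat[THEN iffD1, rotated]) (use h in simp)
      also have "(i + n - h) - (i + n - h') = h' - h" using h \<open>q \<le> n\<close> by auto
      finally show False using h by (auto dest: dvd_imp_le)
    qed
  qed auto
  then have surj: "?f ` {..<q} = {..<q}"
    using q_pos by (intro endo_inj_surj) auto
  have "?f ` {h. h < q \<and> ?f h < d} = {..<d}"
  proof (intro equalityI subsetI)
    fix k assume k: "k \<in> {..<d}"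
    then have "k \<in> {..<q}" using q_d by auto
    then have "k \<in> ?f ` {..<q}" by (simp only: surj)
    then obtain h where "h < q" "k = ?f h" by (elim imageE) simp
    then show "k \<in> ?f ` {h. h < q \<and> ?f h < d}" using k by blast
  qed blast
  moreover have "inj_on ?f {h. h < q \<and> ?f h < d}" by (rule inj_on_subset[OF inj]) auto
  then have "card (?f ` {h. h < q \<and> ?f h < d}) = card {h. h < q \<and> ?f h < d}" by (rule card_image)
  ultimately show ?thesis by (simp only: kept card_lessThan)
qed

text \<open>Double counting: summed over the first q starting points, each edge is counted d times,
  and each starting point contributes at most B. The factor is q / d.\<close>

lemma averaging:
  assumes B: "0 \<le> B" "\<And>h. h < n \<Longrightarrow> (\<Sum>e\<in>kept_edges I h. f e) \<le> B"
  shows "(\<Sum>e\<in>edges I. f e) \<le> (2 - 1 / real d) * B"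
proof (cases "n = 0")
  \<comment> \<open>If S is empty, there is no starting point to supply a bound, and
    \<open>0 \<le> B\<close> is used instead.\<close>
  case True
  then have "edges I = {}" using edges_subset by auto
  moreover have "0 \<le> 2 - 1 / real d" using d_pos by (simp add: field_simps)
  ultimately show ?thesis using B(1) by simp
next
  case False
  then have "q \<le> n" using dvd by (auto intro: dvd_imp_le)
  have "real d * (\<Sum>e\<in>edges I. f e) = (\<Sum>e\<in>edges I. \<Sum>h<q. if kept I h (fst e) then f e else 0)"
    unfolding sum_distrib_left
  proof (intro sum.cong refl)
    fix e assume "e \<in> edges I"
    then have "fst e < n" using edges_subset by auto
    then have "card ({..<q} \<inter> {h. kept I h (fst e)}) = d"
      using card_starts[of "fst e"] by (simp add: Collect_conj_eq lessThan_def)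
    then show "real d * f e = (\<Sum>h<q. if kept I h (fst e) then f e else 0)"
      by (simp add: sum.If_cases)
  qed
  also have "\<dots> = (\<Sum>h<q. \<Sum>e\<in>kept_edges I h. f e)"
    unfolding kept_edges_def using finite_edges by (subst sum.swap) (simp add: sum.inter_filter)
  also have "\<dots> \<le> (\<Sum>h<q. B)" using B(2) \<open>q \<le> n\<close> by (intro sum_mono) auto
  also have "\<dots> = (2 * real d - 1) * B" using d_pos by (simp add: q_eq of_nat_diff)
  finally show ?thesis using d_pos by (simp add: field_simps)
qed

section \<open>Matchings as LP solutions, and the bounds on the ratios\<close>

lemma matching_feasible:
  assumes M: "cyclic_matching I M"
  shows "lp_feasible I (\<lambda>e. of_bool (e \<in> M))"
  unfolding lp_feasible_def
proof (intro conjI allI impI ballI)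
  fix v assume "v \<in> nodes I"
  then have "enat (card (M \<inter> incident_edges I v)) \<le> bound I v" using M by (simp add: cyclic_matching_def)
  moreover have "finite (incident_edges I v)" using finite_edges by (cases v) auto
  ultimately show "ereal (\<Sum>e\<in>incident_edges I v. of_bool (e \<in> M)) \<le> ereal_of_enat (bound I v)"
    by (cases "bound I v") (simp_all add: Int_commute)
next
  fix t i assume "t < m" "i < n"
  let ?W = "{e \<in> edges I. snd e = t \<and> fst e \<in> window I i}"
  have "e = e'" if ee: "e \<in> ?W \<inter> M" "e' \<in> ?W \<inter> M" for e e'
  proof (rule ccontr)
    assume ne: "e \<noteq> e'"
    obtain a a' where e: "e = (a, t)" "e' = (a', t)" "a \<in> window I i" "a' \<in> window I i" "(a, t) \<in> M" "(a', t) \<in> M"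
      using ee by (cases e; cases e') auto
    then have dist: "int d \<le> \<bar>int a - int a'\<bar>" "\<bar>int a - int a'\<bar> \<le> int n - int d"
      using M ne e unfolding cyclic_matching_def by blast+
    \<comment> \<open>Two edges of a matching at one node of T force n to be at least d, so the
      offsets in a window wrap around at most once.\<close>
    then have "d \<le> n" by linarith
    obtain k k' where "k < d" "k' < d" "a = (i + k) mod n" "a' = (i + k') mod n"
      using e by (auto simp: window_def)
    then show False using dist \<open>d \<le> n\<close> \<open>i < n\<close> by (auto simp: mod_add_less split: if_splits)
  qed
  then have "card (?W \<inter> M) \<le> 1" using finite_edges by (subst card_le_Suc0_iff_eq[unfolded One_nat_def[symmetric]]) auto
  then show "(\<Sum>e | e \<in> edges I \<and> snd e = t \<and> fst e \<in> window I i. of_bool (e \<in> M)) \<le> (1 :: real)"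
    using finite_edges by simp
qed auto

lemma matching_weight_lp:
  assumes "cyclic_matching I M"
  shows "(\<Sum>e\<in>edges I. weight I e * of_bool (e \<in> M)) = matching_weight I M"
  unfolding matching_weight_def using assms finite_edges
  by (intro sum.mono_neutral_cong_right) (auto simp: cyclic_matching_def)

lemma finite_matchings: "finite {M. cyclic_matching I M}"
  by (rule finite_subset[of _ "Pow (edges I)"]) (use finite_edges in \<open>auto simp: cyclic_matching_def\<close>)

lemma empty_matching: "cyclic_matching I {}"
  by (simp add: cyclic_matching_def zero_enat_def[symmetric])

lemma max_matching_weight_ge: "cyclic_matching I M \<Longrightarrow> matching_weight I M \<le> max_matching_weight I"
  unfolding max_matching_weight_def using finite_matchings by (intro Max_ge) auto

lemma max_matching_weight_attained: "\<exists>M. cyclic_matching I M \<and> max_matching_weight I = matching_weight I M"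
proof -
  have "max_matching_weight I \<in> matching_weight I ` {M. cyclic_matching I M}"
    unfolding max_matching_weight_def using finite_matchings empty_matching by (intro Max_in) auto
  then show ?thesis by auto
qed

lemma matching_weight_nonneg: "cyclic_matching I M \<Longrightarrow> 0 \<le> matching_weight I M"
  unfolding matching_weight_def by (intro sum_nonneg) (auto simp: cyclic_matching_def intro: weight_nonneg)

text \<open>This one property of the output yields both the approximation ratio and the bound on the
  gap.\<close>

definition rounding :: "(nat \<times> nat) set \<Rightarrow> bool" where
  "rounding M \<longleftrightarrow> cyclic_matching I M \<and>
     (\<forall>x. lp_feasible I x \<longrightarrow>
       (\<Sum>e\<in>edges I. weight I e * x e) \<le> (2 - 1 / real d) * matching_weight I M)"

text \<open>The characteristic vector of a heaviest matching is one of the LP solutions.\<close>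

lemma rounding_approx:
  assumes "rounding M"
  shows "matching_weight I M \<ge> 1 / (2 - 1 / real d) * max_matching_weight I"
proof -
  obtain M' where M': "cyclic_matching I M'" "max_matching_weight I = matching_weight I M'"
    using max_matching_weight_attained by blast
  then have "max_matching_weight I \<le> (2 - 1 / real d) * matching_weight I M"
    using assms matching_feasible[OF M'(1)] matching_weight_lp[OF M'(1)] by (auto simp: rounding_def)
  moreover have "0 < 2 - 1 / real d" using d_pos by (simp add: field_simps)
  ultimately show ?thesis by (simp add: field_simps)
qed

lemma rounding_gap:
  assumes "rounding M"
  shows "gap_ratio I \<le> ereal (2 - 1 / real d)"
proof -
  let ?z = "2 - 1 / real d" and ?m = "max_matching_weight I"
  have z: "0 < ?z" using d_pos by (simp add: field_simps)
  have le: "matching_weight I M \<le> ?m" "0 \<le> matching_weight I M"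
    using assms max_matching_weight_ge matching_weight_nonneg by (auto simp: rounding_def)
  have lp: "lp_optimum I \<le> ereal (?z * ?m)"
    unfolding lp_optimum_def
  proof (intro SUP_least)
    fix x assume "x \<in> {x. lp_feasible I x}"
    then have "(\<Sum>e\<in>edges I. weight I e * x e) \<le> ?z * matching_weight I M" using assms by (simp add: rounding_def)
    also have "\<dots> \<le> ?z * ?m" using le z by (intro mult_left_mono) auto
    finally show "ereal (\<Sum>e\<in>edges I. weight I e * x e) \<le> ereal (?z * ?m)" by simp
  qed
  show ?thesis
  proof (cases "?m = 0")
    case True
    \<comment> \<open>A positive optimum divided by 0 would be infinite; here the quotient is at
      most 0.\<close>
    then have "lp_optimum I \<le> 0" using lp by (simp add: zero_ereal_def)
    then have "gap_ratio I \<le> 0"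
      using True by (auto simp: gap_ratio_def divide_ereal_def ereal_mult_le_0_iff zero_ereal_def[symmetric])
    also have "0 \<le> ereal ?z" using z by simp
    finally show ?thesis .
  next
    case False
    then have "0 < ?m" using le by linarith
    then show ?thesis using lp unfolding gap_ratio_def
      by (simp add: ereal_divide_le_pos mult.commute)
  qed
qed

end

section \<open>A tight instance\<close>

text \<open>A star with 2 d - 1 leaves: on a cycle of this length any two nodes are at cyclic
  distance at most d - 1, so one edge is all that a matching can contain.\<close>

definition tight_problem :: "nat \<Rightarrow> problem" where
  "tight_problem d = \<lparr>num_S = 2 * d - 1, num_T = 1, edges = {..<2 * d - 1} \<times> {0}, min_dist = d,
     bound = (\<lambda>_. \<infinity>), weight = (\<lambda>_. 1)\<rparr>"

lemma tight_problem_simps [simp]: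
  "num_S (tight_problem d) = 2 * d - 1" "num_T (tight_problem d) = 1"
  "edges (tight_problem d) = {..<2 * d - 1} \<times> {0}" "min_dist (tight_problem d) = d"
  "bound (tight_problem d) v = \<infinity>" "weight (tight_problem d) e = 1"
  by (simp_all add: tight_problem_def)

lemma tight_problem_divisible: "0 < d \<Longrightarrow> tight_problem d \<in> divisible_problems d"
  by (auto simp: divisible_problems_def valid_problem_def)

lemma tight_problem_matching:
  assumes "0 < d" shows "max_matching_weight (tight_problem d) = 1"
proof -
  let ?I = "tight_problem d"
  interpret divisible_instance ?I
    by unfold_locales (use assms in \<open>auto simp: valid_problem_def block_length_def\<close>)
  have "matching_weight ?I M \<le> 1" if M: "cyclic_matching ?I M" for M
  proof -
    have sub: "M \<subseteq> {..<2 * d - 1} \<times> {0}" using M by (simp add: cyclic_matching_def)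
    have "e = e'" if ee: "e \<in> M" "e' \<in> M" for e e'
    proof (rule ccontr)
      assume "e \<noteq> e'"
      then obtain i j where "(i, 0) \<in> M" "(j, 0) \<in> M" "i \<noteq> j" 
        using ee subsetD[OF sub ee(1)] subsetD[OF sub ee(2)] by (cases e; cases e') auto
      \<comment> \<open>The upper bound equals d - 1 and contradicts the lower bound d.\<close>
      then have "int d \<le> \<bar>int i - int j\<bar> \<and> \<bar>int i - int j\<bar> \<le> int (2 * d - 1) - int d"
        using M unfolding cyclic_matching_def tight_problem_simps by blast
      then show False using assms by linarith
    qed
    moreover have "finite M" using sub by (rule finite_subset) auto
    ultimately have "card M \<le> 1" by (simp add: card_le_Suc0_iff_eq)
    then show ?thesis by (simp add: matching_weight_def)
  qed
  moreover have "cyclic_matching ?I {(0, 0)}" using assms by (auto simp: cyclic_matching_def)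
  moreover have "matching_weight ?I {(0, 0)} = 1" by (simp add: matching_weight_def)
  ultimately show ?thesis
    using max_matching_weight_attained max_matching_weight_ge by (metis antisym)
qed

lemma tight_problem_lp:
  assumes "0 < d" shows "ereal (2 - 1 / real d) \<le> lp_optimum (tight_problem d)"
proof -
  let ?I = "tight_problem d" and ?x = "\<lambda>_ :: nat \<times> nat. 1 / real d"
  have "(\<Sum>e | e \<in> edges ?I \<and> snd e = t \<and> fst e \<in> window ?I i. ?x e) \<le> 1" for t i
  proof -
    have "window ?I i = (\<lambda>k. (i + k) mod (2 * d - 1)) ` {..<d}" by (auto simp: window_def)
    then have w: "finite (window ?I i)" "card (window ?I i) \<le> d"
      using card_image_le[of "{..<d}" "\<lambda>k. (i + k) mod (2 * d - 1)"] by auto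
    have "{e. e \<in> edges ?I \<and> snd e = t \<and> fst e \<in> window ?I i} \<subseteq> (\<lambda>a. (a, t)) ` window ?I i"
      by auto
    then have "card {e. e \<in> edges ?I \<and> snd e = t \<and> fst e \<in> window ?I i} \<le> card (window ?I i)"
      using w by (meson card_image_le card_mono finite_imageI order_trans)
    then show ?thesis using w assms by (simp add: field_simps del: tight_problem_simps)
  qed
  then have "lp_feasible ?I ?x" by (simp add: lp_feasible_def del: tight_problem_simps(3))
  moreover have "(\<Sum>e\<in>edges ?I. weight ?I e * ?x e) = 2 - 1 / real d"
    using assms by (simp add: of_nat_diff field_simps)
  ultimately show ?thesis unfolding lp_optimum_def by (intro SUP_upper2[of ?x]) auto
qed

lemma tight_problem_ratio: "0 < d \<Longrightarrow> ereal (2 - 1 / real d) \<le> gap_ratio (tight_problem d)"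
  using tight_problem_lp[of d] by (simp add: gap_ratio_def tight_problem_matching one_ereal_def[symmetric])

section \<open>The algorithm\<close>

text \<open>What every phase may read and none may spoil: the input, as far as it is used, and the
  computed number \<open>''N''\<close> of network nodes.\<close>

definition ready :: "problem \<Rightarrow> state \<Rightarrow> bool" where
  "ready I s \<longleftrightarrow> nmem s ''n'' 0 0 = num_S I \<and> nmem s ''m'' 0 0 = num_T I \<and> nmem s ''d'' 0 0 = min_dist I \<and>
     nmem s ''N'' 0 0 = node_count (num_S I) (num_T I) \<and>
     (\<forall>i t. nmem s ''E'' i t = of_bool ((i, t) \<in> edges I)) \<and>
     (\<forall>i<num_S I. nmem s ''b'' i 0 = finite_part (bound I (SNode i)) \<and>
        nmem s ''binf'' i 0 = of_bool (bound I (SNode i) = \<infinity>)) \<and>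
     (\<forall>t<num_T I. nmem s ''b'' t 1 = finite_part (bound I (TNode t)) \<and>
        nmem s ''binf'' t 1 = of_bool (bound I (TNode t) = \<infinity>)) \<and>
     (\<forall>(i, t)\<in>edges I. rmem s ''w'' i t = weight I (i, t))"

lemma ready_cong:
  assumes "\<And>a. a \<in> {''n'', ''m'', ''d'', ''N'', ''E'', ''b'', ''binf''} \<Longrightarrow> nmem s' a = nmem s a"
    "rmem s' ''w'' = rmem s ''w''"
  shows "ready I s' = ready I s"
  using assms by (simp add: ready_def)

lemma ready_unchanged:
  assumes "ready I s" "unchanged c s s'" "nmods c \<inter> {''n'', ''m'', ''d'', ''N'', ''E'', ''b'', ''binf''} = {}"
    "''w'' \<notin> rmods c"
  shows "ready I s'"
  using ready_cong[of s' s I] assms unfolding unchanged_def by blast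

definition clear_com :: com where
  "clear_com = For ''x'' (nvar ''N'')
     (Seq (RAssign ''pot'' (nvar ''x'') (NConst 0) (RConst 0))
       (For ''y'' (nvar ''N'')
         (Seq (NAssign ''cap'' (nvar ''x'') (nvar ''y'') (NConst 0))
           (RAssign ''c'' (nvar ''x'') (nvar ''y'') (RConst 0)))))"

lemma mods_clear [simp]: "nmods clear_com = {''x'', ''y'', ''cap''}" "rmods clear_com = {''pot'', ''c''}"
  by (auto simp: clear_com_def)

lemma run_clear:
  assumes "nmem s ''N'' 0 0 = N" "N \<le> L"
  shows "run L clear_com s (\<lambda>s'. \<forall>x<N. rmem s' ''pot'' x 0 = 0 \<and>
    (\<forall>y<N. nmem s' ''cap'' x y = 0 \<and> rmem s' ''c'' x y = 0))"
  unfolding clear_com_def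
proof (rule run_For[where b = N and Inv = "\<lambda>k s'. \<forall>x<k. rmem s' ''pot'' x 0 = 0 \<and>
    (\<forall>y<N. nmem s' ''cap'' x y = 0 \<and> rmem s' ''c'' x y = 0)"], goal_cases)
  case (5 k s')
  then have "nmem s' ''N'' 0 0 = N" using assms by (auto simp: unchanged_def)
  note s' = this 5(2-)
  show ?case
  proof (intro run_Seq run_RAssign, rule run_For[where b = N and Inv = "\<lambda>l s''.
      (\<forall>x<Suc k. rmem s'' ''pot'' x 0 = 0) \<and> (\<forall>x y. y < N \<longrightarrow> x < k \<or> x = k \<and> y < l \<longrightarrow>
        nmem s'' ''cap'' x y = 0 \<and> rmem s'' ''c'' x y = 0)"], goal_cases)
    case (5 l s'')
    then have "nmem s'' ''x'' 0 0 = k" using s' by (auto simp: unchanged_def)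
    with 5(2-) show ?case
      by - (rule run_Seq, rule run_NAssign, rule run_RAssign, auto simp: less_Suc_eq)
  qed (use assms s' in \<open>auto simp: unchanged_def less_Suc_eq\<close>)
qed (use assms in \<open>auto simp: unchanged_def\<close>)

section \<open>The program: building the network, matching, keeping the best result\<close>

definition caps_S_com :: com where
  "caps_S_com = For ''i'' (nvar ''n'')
     (Cond (NLess (NConst 0) (NCell ''binf'' (nvar ''i'') (NConst 0)))
       (NAssign ''cap'' (NConst 0) (NPlus (NConst 1) (nvar ''i'')) (nvar ''m''))
       (NAssign ''cap'' (NConst 0) (NPlus (NConst 1) (nvar ''i'')) (NCell ''b'' (nvar ''i'') (NConst 0))))"

definition tnode_exp :: "nexp \<Rightarrow> nexp" where
  "tnode_exp t = NPlus (NPlus (NConst 1) (nvar ''n'')) t"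

lemma nval_tnode_exp: "nval (tnode_exp t) s = tnode (nmem s ''n'' 0 0) (nval t s)"
  by (simp add: tnode_exp_def tnode_def)

definition caps_T_com :: com where
  "caps_T_com = For ''t'' (nvar ''m'')
     (Cond (NLess (NConst 0) (NCell ''binf'' (nvar ''t'') (NConst 1)))
       (NAssign ''cap'' (tnode_exp (nvar ''t'')) (NConst 0) (nvar ''n''))
       (NAssign ''cap'' (tnode_exp (nvar ''t'')) (NConst 0) (NCell ''b'' (nvar ''t'') (NConst 1))))"

text \<open>\<open>''base''\<close> starts at \<open>wnode n m 0 0\<close> and advances by m per
  block, which replaces the product in \<open>wnode\<close>.\<close>

definition caps_copies_com :: com where
  "caps_copies_com = Seq (nset ''base'' (tnode_exp (nvar ''m'')))
     (For ''i'' (nvar ''n'')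
       (Seq (For ''t'' (nvar ''m'')
              (NAssign ''cap'' (NPlus (nvar ''base'') (nvar ''t'')) (tnode_exp (nvar ''t'')) (NConst 1)))
            (nset ''base'' (NPlus (nvar ''base'') (nvar ''m'')))))"

lemma mods_caps [simp]:
  "nmods caps_S_com = {''i'', ''cap''}" "rmods caps_S_com = {}"
  "nmods caps_T_com = {''t'', ''cap''}" "rmods caps_T_com = {}"
  "nmods caps_copies_com = {''base'', ''i'', ''t'', ''cap''}" "rmods caps_copies_com = {}"
  by (auto simp: caps_S_com_def caps_T_com_def caps_copies_com_def)

text \<open>
  For kept nodes i, \<open>win i\<close> is the number of the first node of the copy of T that belongs to the
  block of i. It is 0 for the other nodes of S.
\<close>

definition blocks_com :: com where
  "blocks_com = Seq (nset ''base'' (tnode_exp (nvar ''m''))) (Seq (nset ''p'' (NConst 0))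
     (For ''k'' (nvar ''n'')
       (Seq (nset ''i'' (NPlus (nvar ''k'') (nvar ''o'')))
       (Seq (Cond (NLess (nvar ''i'') (nvar ''n'')) Skip (nset ''i'' (NMinus (nvar ''i'') (nvar ''n''))))
       (Seq (Cond (NLess (nvar ''p'') (nvar ''d''))
              (NAssign ''win'' (nvar ''i'') (NConst 0) (nvar ''base''))
              (NAssign ''win'' (nvar ''i'') (NConst 0) (NConst 0)))
       (Seq (nset ''p'' (NPlus (nvar ''p'') (NConst 1)))
         (Cond (NLess (NPlus (nvar ''p'') (NConst 1)) (NPlus (nvar ''d'') (nvar ''d''))) Skip
           (Seq (nset ''p'' (NConst 0)) (nset ''base'' (NPlus (nvar ''base'') (nvar ''m'')))))))))))"

lemma mods_blocks [simp]: "nmods blocks_com = {''base'', ''p'', ''k'', ''i'', ''win''}" "rmods blocks_com = {}"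
  by (auto simp: blocks_com_def)

definition match_com :: com where
  "match_com = For ''i'' (nvar ''n'')
     (Cond (NLess (NConst 0) (NCell ''win'' (nvar ''i'') (NConst 0)))
       (For ''t'' (nvar ''m'')
         (Cond (NLess (NConst 0) (NCell ''E'' (nvar ''i'') (nvar ''t'')))
           (Seq (nset ''u'' (NPlus (NConst 1) (nvar ''i'')))
           (Seq (nset ''v'' (NPlus (NCell ''win'' (nvar ''i'') (NConst 0)) (nvar ''t'')))
           (Seq (rset ''wt'' (RCell ''w'' (nvar ''i'') (nvar ''t'')))
             insert_com)))
           Skip))
       Skip)"

lemma mods_match [simp]:
  "nmods match_com = {''i'', ''t'', ''u'', ''v'', ''x'', ''y'', ''k'', ''vis'', ''pred'', ''cap''}"
  "rmods match_com = {''wt'', ''c'', ''D'', ''dist'', ''pot''}"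
  by (auto simp: match_com_def)

text \<open>\<open>''F''\<close> and \<open>''acc''\<close> hold a candidate and its weight, so that
  \<open>''M''\<close> is overwritten only by something heavier.\<close>

definition extract_com :: com where
  "extract_com = Seq (rset ''acc'' (RConst 0)) (For ''i'' (nvar ''n'') (For ''t'' (nvar ''m'')
     (Cond (BAnd (NLess (NConst 0) (NCell ''win'' (nvar ''i'') (NConst 0)))
             (NLess (NConst 0) (NCell ''cap'' (NPlus (NCell ''win'' (nvar ''i'') (NConst 0)) (nvar ''t''))
                (NPlus (NConst 1) (nvar ''i'')))))
       (Seq (NAssign ''F'' (nvar ''i'') (nvar ''t'') (NConst 1))
            (rset ''acc'' (RPlus (rvar ''acc'') (RCell ''w'' (nvar ''i'') (nvar ''t'')))))
       (NAssign ''F'' (nvar ''i'') (nvar ''t'') (NConst 0)))))"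

lemma mods_extract [simp]: "nmods extract_com = {''i'', ''t'', ''F''}" "rmods extract_com = {''acc''}"
  by (auto simp: extract_com_def)

definition keep_com :: com where
  "keep_com = Cond (RLess (rvar ''best'') (rvar ''acc''))
     (Seq (rset ''best'' (rvar ''acc''))
       (For ''i'' (nvar ''n'') (For ''t'' (nvar ''m'')
         (NAssign ''M'' (nvar ''i'') (nvar ''t'') (NCell ''F'' (nvar ''i'') (nvar ''t''))))))
     Skip"

lemma mods_keep [simp]: "nmods keep_com = {''i'', ''t'', ''M''}" "rmods keep_com = {''best''}"
  by (auto simp: keep_com_def)

text \<open>\<open>''N''\<close> reaches \<open>node_count n m\<close> by n additions of m.
  \<open>''o''\<close> is the starting point h; the network is rebuilt for each of its
  values.\<close>

definition main_com :: com where
  "main_com = Seq (nset ''N'' (tnode_exp (nvar ''m'')))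
     (Seq (For ''i'' (nvar ''n'') (nset ''N'' (NPlus (nvar ''N'') (nvar ''m''))))
       (For ''o'' (nvar ''n'')
         (Seq clear_com (Seq caps_S_com (Seq caps_T_com (Seq caps_copies_com (Seq blocks_com
         (Seq match_com (Seq extract_com keep_com)))))))))"

lemma capacities_cong:
  assumes "capacities n m blk a b g J C" "\<And>i. i < n \<Longrightarrow> a i = a' i" "\<And>t. t < m \<Longrightarrow> b t = b' t"
    "\<And>j t. j < n \<Longrightarrow> t < m \<Longrightarrow> g j t = g' j t"
  shows "capacities n m blk a' b' g' J C"
  using assms by (simp add: capacities_def)

section \<open>Correctness of the phases for one starting point\<close>

locale algorithm = divisible_instance +
  fixes L :: nat
  assumes L: "node_count n m \<le> L"
begin

abbreviation "N \<equiv> node_count n m"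

lemma nm_le_L: "n \<le> L" "m \<le> L"
  using L by (auto simp: node_count_def)

lemma run_caps_S:
  assumes "ready I s" "capacities n m blk (\<lambda>_. 0) b g J (nmem s ''cap'')"
  shows "run L caps_S_com s (\<lambda>s'. capacities n m blk (cap_S I) b g J (nmem s' ''cap''))"
  unfolding caps_S_com_def
proof (rule run_For[where b = n and
      Inv = "\<lambda>k s'. capacities n m blk (\<lambda>i. if i < k then cap_S I i else 0) b g J (nmem s' ''cap'')"], goal_cases)
  case (5 k s')
  then have s': "ready I s'" using assms(1) by (elim ready_unchanged) auto
  have "(\<lambda>i. if i < Suc k then cap_S I i else 0) = (\<lambda>i. if i < k then cap_S I i else 0)(k := cap_S I k)"
    by (auto simp: fun_eq_iff)
  then have "capacities n m blk (\<lambda>i. if i < Suc k then cap_S I i else 0) b g J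
      (put (nmem s' ''cap'') 0 (snode k) (cap_S I k))"
    using capacities_put(1)[OF 5(3,2)] by simp
  then show ?case
    using s' 5(2,4) by - (intro run_Cond run_NAssign;
      auto simp: ready_def array_set array_set_other snode_def cap_S_def split: enat.splits)
next
  case 4
  show ?case using assms(2) by (simp add: array_set_other)
next
  case (6 s')
  show ?case by (rule capacities_cong[OF 6(2)]) auto
qed (use assms nm_le_L in \<open>auto simp: ready_def unchanged_def\<close>)

lemma run_caps_T:
  assumes "ready I s" "capacities n m blk a (\<lambda>_. 0) g J (nmem s ''cap'')"
  shows "run L caps_T_com s (\<lambda>s'. capacities n m blk a (cap_T I) g J (nmem s' ''cap''))"
  unfolding caps_T_com_def
proof (rule run_For[where b = m and
      Inv = "\<lambda>k s'. capacities n m blk a (\<lambda>t. if t < k then cap_T I t else 0) g J (nmem s' ''cap'')"], goal_cases)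
  case (5 k s')
  then have s': "ready I s'" using assms(1) by (elim ready_unchanged) auto
  have "(\<lambda>t. if t < Suc k then cap_T I t else 0) = (\<lambda>t. if t < k then cap_T I t else 0)(k := cap_T I k)"
    by (auto simp: fun_eq_iff)
  then have "capacities n m blk a (\<lambda>t. if t < Suc k then cap_T I t else 0) g J
      (put (nmem s' ''cap'') (tnode n k) 0 (cap_T I k))"
    using capacities_put(2)[OF 5(3,2)] by simp
  then show ?case
    using s' 5(2,4) by - (intro run_Cond run_NAssign;
      auto simp: ready_def array_set array_set_other nval_tnode_exp cap_T_def split: enat.splits)
next
  case 4
  show ?case using assms(2) by (simp add: array_set_other)
next
  case (6 s')
  show ?case by (rule capacities_cong[OF 6(2)]) auto
qed (use assms nm_le_L in \<open>auto simp: ready_def unchanged_def\<close>)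

lemma run_caps_copies:
  assumes "ready I s" "capacities n m blk a b (\<lambda>_ _. 0) J (nmem s ''cap'')"
  shows "run L caps_copies_com s (\<lambda>s'. capacities n m blk a b (\<lambda>_ _. 1) J (nmem s' ''cap''))"
  unfolding caps_copies_com_def
proof (intro run_Seq run_NAssign, rule run_For[where b = n and
      Inv = "\<lambda>k s'. nmem s' ''base'' 0 0 = wnode n m k 0 \<and>
        capacities n m blk a b (\<lambda>j t. if j < k then 1 else 0) J (nmem s' ''cap'')"], goal_cases)
  case (5 k s')
  then have s': "nmem s' ''n'' 0 0 = n" "nmem s' ''m'' 0 0 = m"
    using assms(1) by (auto simp: ready_def unchanged_def array_set_other)
  show ?case
  proof (rule run_Seq, rule run_For[where b = m and
      Inv = "\<lambda>l s''. capacities n m blk a b (\<lambda>j t. if j < k \<or> j = k \<and> t < l then 1 else 0) J (nmem s'' ''cap'')"],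
      goal_cases)
    case (5 l s'')
    then have s'': "nmem s'' ''n'' 0 0 = n" "nmem s'' ''base'' 0 0 = wnode n m k 0"
      using s' \<open>_ \<and> _\<close> by (auto simp: unchanged_def)
    have "(\<lambda>j t. if j < k \<or> j = k \<and> t < Suc l then 1 else 0) =
        put (\<lambda>j t. if j < k \<or> j = k \<and> t < l then 1 else 0) k l (1 :: nat)"
      by (auto simp: fun_eq_iff put_def)
    then have "capacities n m blk a b (\<lambda>j t. if j < k \<or> j = k \<and> t < Suc l then 1 else 0) J
        (put (nmem s'' ''cap'') (wnode n m k l) (tnode n l) 1)"
      using capacities_put(3)[OF 5(3) \<open>k < n\<close> 5(2)] by simp
    then show ?case using s'' 5(4)
      by - (rule run_NAssign, simp add: array_set array_set_other nval_tnode_exp wnode_def)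
  next
    case (6 s'')
    then have s'': "nmem s'' ''m'' 0 0 = m" "nmem s'' ''base'' 0 0 = wnode n m k 0"
      using s' \<open>nmem s' _ _ _ = wnode _ _ _ _ \<and> _\<close> by (auto simp: unchanged_def)
    have "capacities n m blk a b (\<lambda>j t. if j < Suc k then 1 else 0) J (nmem s'' ''cap'')"
      by (rule capacities_cong[OF 6(2)]) auto
    with s'' show ?case
      by - (rule run_NAssign, simp add: array_set_other wnode_def)
  qed (use s' 5 nm_le_L in \<open>auto simp: unchanged_def array_set_other\<close>)
next
  case 4
  show ?case using assms
    by (simp add: ready_def array_set_other nval_tnode_exp tnode_def wnode_def)
next
  case (6 s')
  show ?case by (rule capacities_cong[OF conjunct2[OF 6(2)]]) auto
qed (use assms nm_le_L in \<open>auto simp: ready_def unchanged_def array_set_other\<close>)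

text \<open>The original capacities C are a ghost: the program stores only residual capacities.
  \<open>J\<close> is the set of edges inserted so far.\<close>

definition net :: "nat \<Rightarrow> (nat \<times> nat) set \<Rightarrow> state \<Rightarrow> bool" where
  "net h J s \<longleftrightarrow> (\<exists>C. circulation N C (nmem s ''cap'') \<and>
     capacities n m (block I h) (cap_S I) (cap_T I) (\<lambda>_ _. 1) J C \<and>
     arc_costs n m (block I h) (weight I) J (rmem s ''c'') \<and>
     nonneg_arcs N (nmem s ''cap'') (reduced (rmem s ''c'') (\<lambda>x. rmem s ''pot'' x 0)))"

lemma net_cong:
  assumes "nmem s' ''cap'' = nmem s ''cap''" "rmem s' ''c'' = rmem s ''c''" "rmem s' ''pot'' = rmem s ''pot''"
  shows "net h J s' = net h J s"
  using assms by (simp add: net_def)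

text \<open>Without edges the zero flow is optimal, with zero potentials as certificate. The rest of
  the program appears as a continuation, to fit the right-nested sequence in
  \<open>main_com\<close>.\<close>

lemma run_setup:
  assumes "ready I s"
    and Q: "\<And>s'. ready I s' \<Longrightarrow> net h {} s' \<Longrightarrow>
      (\<And>a. a \<notin> {''x'', ''y'', ''i'', ''t'', ''base'', ''cap''} \<Longrightarrow> nmem s' a = nmem s a) \<Longrightarrow>
      (\<And>a. a \<notin> {''pot'', ''c''} \<Longrightarrow> rmem s' a = rmem s a) \<Longrightarrow> run L c s' Q"
  shows "run L (Seq clear_com (Seq caps_S_com (Seq caps_T_com (Seq caps_copies_com c)))) s Q"
proof (rule run_Seq, rule run_weaken[OF run_clear[where N = N]], goal_cases)
  case (3 s1)
  have s1: "ready I s1" using assms(1) 3(1) by (rule ready_unchanged) auto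
  show ?case
  proof (rule run_Seq, rule run_weaken[OF run_caps_S[OF s1 capacities_zero[of n m _ "block I h"]]], goal_cases)
    case (2 s2)
    have s2: "ready I s2" using s1 2(1) by (rule ready_unchanged) auto
    show ?case
    proof (rule run_Seq, rule run_weaken[OF run_caps_T[OF s2 2(2)]], goal_cases)
      case (1 s3)
      have s3: "ready I s3" using s2 1(1) by (rule ready_unchanged) auto
      show ?case
      proof (rule run_Seq, rule run_weaken[OF run_caps_copies[OF s3 1(2)]])
        fix s4 assume s4: "unchanged caps_copies_com s3 s4"
          "capacities n m (block I h) (cap_S I) (cap_T I) (\<lambda>_ _. 1) {} (nmem s4 ''cap'')"
        have "rmem s4 = rmem s1" using s4(1) 1(1) 2(1) by (auto simp: unchanged_def)
        then have zero: "\<forall>x<N. rmem s4 ''pot'' x 0 = 0" "\<forall>x<N. \<forall>y<N. rmem s4 ''c'' x y = 0"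
          using 3(2) by auto
        have "circulation N (nmem s4 ''cap'') (nmem s4 ''cap'')" by (simp add: circulation_def)
        moreover have "arc_costs n m (block I h) (weight I) {} (rmem s4 ''c'')"
          using zero by (simp add: arc_costs_def antisym_costs_def node_less)
        moreover have "nonneg_arcs N (nmem s4 ''cap'') (reduced (rmem s4 ''c'') (\<lambda>x. rmem s4 ''pot'' x 0))"
          using zero by (simp add: nonneg_arcs_def reduced_def)
        ultimately have "net h {} s4" using s4(2) unfolding net_def by blast
        moreover have "ready I s4" using s3 s4(1) by (rule ready_unchanged) auto
        ultimately show "run L c s4 Q"
          using s4(1) 1(1) 2(1) 3(1) by (intro Q) (auto simp: unchanged_def)
      qed
    qed
  qed (use 3 in auto)
qed (use assms L in \<open>auto simp: ready_def\<close>)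

definition block_nodes :: "nat \<Rightarrow> state \<Rightarrow> bool" where
  "block_nodes h s \<longleftrightarrow> (\<forall>i<n. nmem s ''win'' i 0 = (if kept I h i then wnode n m (block I h i) 0 else 0))"

lemma mod_div_Suc:
  "Suc k mod r = (if Suc (k mod r) < r then Suc (k mod r) else 0)"
  "Suc k div r = (if Suc (k mod r) < r then k div r else Suc (k div r))" if "0 < r" for k r :: nat
  using that mod_less_divisor[OF that, of k] by (auto simp: mod_Suc div_Suc)

text \<open>Division by q is replaced by counting: \<open>''p''\<close> and \<open>''base''\<close>
  follow k mod q and k div q for the position k. The test \<open>p + 1 < 2 d\<close> expresses p <
  q.\<close>

lemma run_blocks:
  assumes s: "ready I s" "nmem s ''o'' 0 0 = h" and h: "h < n"
  shows "run L blocks_com s (block_nodes h)"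
  unfolding blocks_com_def
proof (intro run_Seq run_NAssign, rule run_For[where b = n and
      Inv = "\<lambda>k s'. nmem s' ''p'' 0 0 = k mod q \<and> nmem s' ''base'' 0 0 = wnode n m (k div q) 0 \<and>
        (\<forall>k'<k. nmem s' ''win'' ((k' + h) mod n) 0 = (if k' mod q < d then wnode n m (k' div q) 0 else 0))"],
      goal_cases)
  case (5 k s')
  then have s': "nmem s' ''n'' 0 0 = n" "nmem s' ''m'' 0 0 = m" "nmem s' ''d'' 0 0 = d" "nmem s' ''o'' 0 0 = h"
    using s by (auto simp: ready_def unchanged_def array_set_other)
  let ?i = "(k + h) mod n"
  have i: "?i = (if k + h < n then k + h else k + h - n)" using 5(2) h by (rule mod_add_less)
  \<comment> \<open>Distinct positions belong to distinct nodes, so the entries of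
    \<open>''win''\<close> written earlier survive.\<close>
  have ne: "(k' + h) mod n \<noteq> ?i" if "k' < k" for k'
    using slot_of[of k' h] slot_of[of k h] that 5(2) h by auto
  define s1 where "s1 = set_nat s' ''i'' 0 0 ?i"
  define s2 where "s2 = set_nat s1 ''win'' ?i 0 (if k mod q < d then wnode n m (k div q) 0 else 0)"
  have win: "\<forall>k'<Suc k. nmem s2 ''win'' ((k' + h) mod n) 0 = (if k' mod q < d then wnode n m (k' div q) 0 else 0)"
    using 5(3) ne by (auto simp: s2_def s1_def less_Suc_eq)
  have s2: "nmem s2 ''p'' 0 0 = k mod q" "nmem s2 ''base'' 0 0 = wnode n m (k div q) 0"
    "nmem s2 ''m'' 0 0 = m" "nmem s2 ''d'' 0 0 = d"
    using 5(3) s' by (simp_all add: s2_def s1_def)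
  have tail: "run L (Seq (nset ''p'' (NPlus (nvar ''p'') (NConst 1)))
         (Cond (NLess (NPlus (nvar ''p'') (NConst 1)) (NPlus (nvar ''d'') (nvar ''d''))) Skip
           (Seq (nset ''p'' (NConst 0)) (nset ''base'' (NPlus (nvar ''base'') (nvar ''m'')))))) s2
     (\<lambda>s''. nmem (set_nat s'' ''k'' 0 0 (Suc k)) ''p'' 0 0 = Suc k mod q \<and>
            nmem (set_nat s'' ''k'' 0 0 (Suc k)) ''base'' 0 0 = wnode n m (Suc k div q) 0 \<and>
            (\<forall>k'<Suc k. nmem (set_nat s'' ''k'' 0 0 (Suc k)) ''win'' ((k' + h) mod n) 0 =
              (if k' mod q < d then wnode n m (k' div q) 0 else 0)))"
    using s2 win q_d by - (rule run_Seq, rule run_NAssign, rule run_Cond,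
      rule run_Skip, simp add: mod_div_Suc[OF q_pos], rule run_Seq, rule run_NAssign, rule run_NAssign,
      simp add: mod_div_Suc[OF q_pos] wnode_def)
  have mid: "run L (Seq (Cond (NLess (nvar ''p'') (nvar ''d''))
              (NAssign ''win'' (nvar ''i'') (NConst 0) (nvar ''base''))
              (NAssign ''win'' (nvar ''i'') (NConst 0) (NConst 0))) c) s1 Q" if "run L c s2 Q" for c Q
    using that 5(3) s' by - (rule run_Seq, rule run_Cond; rule run_NAssign; simp add: s2_def s1_def)
  have "run L (Seq (Cond (NLess (nvar ''i'') (nvar ''n'')) Skip (nset ''i'' (NMinus (nvar ''i'') (nvar ''n'')))) c)
      (set_nat s' ''i'' 0 0 (k + h)) Q" if "run L c s1 Q" for c Q
  proof (rule run_Seq, rule run_Cond)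
    assume "bval (NLess (nvar ''i'') (nvar ''n'')) (set_nat s' ''i'' 0 0 (k + h))"
    then have "set_nat s' ''i'' 0 0 (k + h) = s1" using s' i by (simp add: s1_def)
    then show "run L Skip (set_nat s' ''i'' 0 0 (k + h)) (\<lambda>s'. run L c s' Q)" using that by (intro run_Skip) simp
  next
    assume "\<not> bval (NLess (nvar ''i'') (nvar ''n'')) (set_nat s' ''i'' 0 0 (k + h))"
    then have "set_nat (set_nat s' ''i'' 0 0 (k + h)) ''i'' 0 0 (k + h - n) = s1"
      using s' i by (simp add: s1_def set_nat_def update_cell_def)
    then show "run L (nset ''i'' (NMinus (nvar ''i'') (nvar ''n''))) (set_nat s' ''i'' 0 0 (k + h)) (\<lambda>s'. run L c s' Q)"
      using that s' by (intro run_NAssign) simp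
  qed
  from this[OF mid[OF tail]] show ?case using 5(4) s'
    by - (rule run_Seq, rule run_NAssign, simp)
next
  case (6 s')
  show ?case unfolding block_nodes_def
  proof (intro allI impI)
    fix i assume "i < n"
    then show "nmem s' ''win'' i 0 = (if kept I h i then wnode n m (block I h i) 0 else 0)"
      using 6(2) slot_inverse[of i h] slot_less[of i h] h unfolding kept_def block_def by metis
  qed
qed (use s nm_le_L in \<open>auto simp: ready_def unchanged_def array_set_other nval_tnode_exp tnode_def wnode_def\<close>)

text \<open>As the edge is not in \<open>J\<close>, there is no capacity yet between its two network
  nodes, and \<open>run_insert\<close> applies. The ghost capacities change in one entry.\<close>

lemma net_step:
  assumes s: "ready I s" and net: "net h J s" and J: "J \<subseteq> {..<n} \<times> {..<m}" "(i, t) \<notin> J" and it: "i < n" "t < m"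
    and vars: "nmem s ''u'' 0 0 = snode i" "nmem s ''v'' 0 0 = wnode n m (block I h i) t"
      "rmem s ''wt'' 0 0 = weight I (i, t)"
  shows "run L insert_com s (net h (insert (i, t) J))"
proof -
  let ?u = "snode i" and ?v = "wnode n m (block I h i) t" and ?w = "weight I (i, t)"
  from net obtain C where C: "circulation N C (nmem s ''cap'')"
     "capacities n m (block I h) (cap_S I) (cap_T I) (\<lambda>_ _. 1) J C"
     "arc_costs n m (block I h) (weight I) J (rmem s ''c'')"
     "nonneg_arcs N (nmem s ''cap'') (reduced (rmem s ''c'') (\<lambda>x. rmem s ''pot'' x 0))"
    unfolding net_def by blast
  have b: "block I h i < n" using block_less[OF it(1)] .
  have zero: "C ?u ?v = 0" "C ?v ?u = 0" using C(2) it b J(2) by (simp_all add: capacities_def)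
  have "run L insert_com s (\<lambda>s'. circulation N (put C ?u ?v 1) (nmem s' ''cap'') \<and>
    rmem s' ''c'' = put (put (rmem s ''c'') ?u ?v (- ?w)) ?v ?u ?w \<and>
    nonneg_arcs N (nmem s' ''cap'')
      (reduced (put (put (rmem s ''c'') ?u ?v (- ?w)) ?v ?u ?w) (\<lambda>x. rmem s' ''pot'' x 0)))"
    using run_insert[of s N L C] s L it b C zero unfolding vars
    by (simp add: ready_def node_less node_distinct arc_costs_def)
  then show ?thesis
  proof (rule run_weaken)
    fix s' :: state assume "circulation N (put C ?u ?v 1) (nmem s' ''cap'') \<and>
      rmem s' ''c'' = put (put (rmem s ''c'') ?u ?v (- ?w)) ?v ?u ?w \<and>
      nonneg_arcs N (nmem s' ''cap'')
        (reduced (put (put (rmem s ''c'') ?u ?v (- ?w)) ?v ?u ?w) (\<lambda>x. rmem s' ''pot'' x 0))"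
    then show "net h (insert (i, t) J) s'"
      using capacities_put(4)[OF C(2) it b] arc_costs_put[OF C(3) it b J(1)] unfolding net_def by metis
  qed
qed

text \<open>Edges are inserted in lexicographic order, and \<open>net\<close> holds for the kept
  edges passed so far.\<close>

lemma run_match:
  assumes s: "ready I s" "block_nodes h s" "net h {} s"
  shows "run L match_com s (net h (kept_edges I h))"
  unfolding match_com_def
proof (rule run_For[where b = n and Inv = "\<lambda>k. net h {e \<in> kept_edges I h. fst e < k}"], goal_cases)
  case (5 k s1)
  have s1: "ready I s1" using s(1) 5(1) by (rule ready_unchanged) auto
  have win: "nmem s1 ''win'' = nmem s ''win''" using 5(1) by (auto simp: unchanged_def)
  show ?case
  proof (rule run_Cond)
    assume "bval (NLess (NConst 0) (NCell ''win'' (nvar ''i'') (NConst 0))) s1"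
    then have kept: "kept I h k" and w: "nmem s1 ''win'' k 0 = wnode n m (block I h k) 0"
      using s(2) 5(2,4) by (auto simp: win block_nodes_def split: if_splits)
    show "run L (For ''t'' (nvar ''m'')
         (Cond (NLess (NConst 0) (NCell ''E'' (nvar ''i'') (nvar ''t'')))
           (Seq (nset ''u'' (NPlus (NConst 1) (nvar ''i'')))
           (Seq (nset ''v'' (NPlus (NCell ''win'' (nvar ''i'') (NConst 0)) (nvar ''t'')))
           (Seq (rset ''wt'' (RCell ''w'' (nvar ''i'') (nvar ''t''))) insert_com))) Skip)) s1
       (\<lambda>s''. net h {e \<in> kept_edges I h. fst e < Suc k} (set_nat s'' ''i'' 0 0 (Suc k)))"
    proof (rule run_For[where b = m and
          Inv = "\<lambda>l. net h {e \<in> kept_edges I h. fst e < k \<or> fst e = k \<and> snd e < l}"], goal_cases)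
      case (5 l s2)
      let ?J = "\<lambda>l. {e \<in> kept_edges I h. fst e < k \<or> fst e = k \<and> snd e < l}"
      have s2: "ready I s2" using s1 5(1) by (rule ready_unchanged) auto
      have w2: "nmem s2 ''win'' k 0 = wnode n m (block I h k) 0" "nmem s2 ''i'' 0 0 = k"
        using 5(1) w \<open>nmem s1 ''i'' 0 0 = k\<close> by (auto simp: unchanged_def)
      show ?case
      proof (rule run_Cond)
        assume "bval (NLess (NConst 0) (NCell ''E'' (nvar ''i'') (nvar ''t''))) s2"
        then have e: "(k, l) \<in> edges I" using s2 w2 5(4) by (auto simp: ready_def)
        then have J: "?J (Suc l) = insert (k, l) (?J l)"
          using kept by (auto simp: kept_edges_def less_Suc_eq)
        define s3 where "s3 = set_real (set_nat (set_nat s2 ''u'' 0 0 (snode k)) ''v'' 0 0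
            (wnode n m (block I h k) l)) ''wt'' 0 0 (weight I (k, l))"
        have "run L insert_com s3 (net h (?J (Suc l)))"
          unfolding J
        proof (rule net_step)
          show "ready I s3" using s2 by (subst ready_cong[of _ s2]) (auto simp: s3_def array_set_other)
          show "net h (?J l) s3" using 5(3) by (subst net_cong[of _ s2]) (auto simp: s3_def array_set_other)
        qed (use edges_subset e in \<open>auto simp: kept_edges_def s3_def\<close>)
        then have "run L insert_com s3 (\<lambda>s''. net h (?J (Suc l)) (set_nat s'' ''t'' 0 0 (Suc l)))"
          by (rule run_weaken) (subst net_cong, auto simp: array_set_other)
        then show "run L (Seq (nset ''u'' (NPlus (NConst 1) (nvar ''i'')))
           (Seq (nset ''v'' (NPlus (NCell ''win'' (nvar ''i'') (NConst 0)) (nvar ''t'')))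
           (Seq (rset ''wt'' (RCell ''w'' (nvar ''i'') (nvar ''t''))) insert_com))) s2
           (\<lambda>s''. net h (?J (Suc l)) (set_nat s'' ''t'' 0 0 (Suc l)))"
          using w2 5(4) s2 e by - (rule run_Seq, rule run_NAssign, rule run_Seq, rule run_NAssign,
            rule run_Seq, rule run_RAssign, auto simp: s3_def snode_def wnode_def ready_def)
      next
        assume "\<not> bval (NLess (NConst 0) (NCell ''E'' (nvar ''i'') (nvar ''t''))) s2"
        then have "(k, l) \<notin> edges I" using s2 w2 5(4) by (auto simp: ready_def)
        then have "?J (Suc l) = ?J l" by (auto simp: kept_edges_def less_Suc_eq)
        then show "run L Skip s2 (\<lambda>s''. net h (?J (Suc l)) (set_nat s'' ''t'' 0 0 (Suc l)))"
          using 5(3) by (intro run_Skip) (subst net_cong[of _ s2], auto simp: array_set_other)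
      qed
    next
      case 4
      show ?case using \<open>net _ _ s1\<close> by (subst net_cong[of _ s1]) (auto simp: array_set_other)
    next
      case (6 s2)
      have "{e \<in> kept_edges I h. fst e < Suc k} = {e \<in> kept_edges I h. fst e < k \<or> fst e = k \<and> snd e < m}"
        using edges_subset by (auto simp: kept_edges_def less_Suc_eq)
      then show ?case using 6(2) by (subst net_cong[of _ s2]) (auto simp: array_set_other)
    qed (use s1 nm_le_L in \<open>auto simp: ready_def unchanged_def\<close>)
  next
    assume "\<not> bval (NLess (NConst 0) (NCell ''win'' (nvar ''i'') (NConst 0))) s1"
    then have "\<not> kept I h k"
      using s(2) 5(2,4) by (auto simp: win block_nodes_def wnode_def split: if_splits)
    then have "{e \<in> kept_edges I h. fst e < Suc k} = {e \<in> kept_edges I h. fst e < k}"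
      by (auto simp: kept_edges_def less_Suc_eq)
    then show "run L Skip s1 (\<lambda>s''. net h {e \<in> kept_edges I h. fst e < Suc k} (set_nat s'' ''i'' 0 0 (Suc k)))"
      using 5(3) by (intro run_Skip) (subst net_cong[of _ s1], auto simp: array_set_other)
  qed
next
  case 4
  show ?case using s(3) by (subst net_cong[of _ s]) (auto simp: array_set_other)
next
  case (6 s')
  have "{e \<in> kept_edges I h. fst e < n} = kept_edges I h" using edges_subset by (auto simp: kept_edges_def)
  then show ?case using 6(2) by simp
qed (use s nm_le_L in \<open>auto simp: ready_def unchanged_def\<close>)

end

section \<open>Reading off the matchings and comparing them\<close>

context algorithm
begin

definition found :: "state \<Rightarrow> (nat \<times> nat) set" where
  "found s = {(i, t). i < n \<and> t < m \<and> 0 < nmem s ''win'' i 0 \<and>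
     0 < nmem s ''cap'' (nmem s ''win'' i 0 + t) (snode i)}"

lemma run_extract:
  assumes s: "ready I s"
  shows "run L extract_com s (\<lambda>s'. (\<forall>i<n. \<forall>t<m. nmem s' ''F'' i t \<noteq> 0 \<longleftrightarrow> (i, t) \<in> found s) \<and>
     rmem s' ''acc'' 0 0 = (\<Sum>i<n. \<Sum>t<m. if (i, t) \<in> found s then rmem s ''w'' i t else 0))"
  unfolding extract_com_def
proof (intro run_Seq run_RAssign, rule run_For[where b = n and Inv = "\<lambda>k s'.
     (\<forall>i<k. \<forall>t<m. nmem s' ''F'' i t \<noteq> 0 \<longleftrightarrow> (i, t) \<in> found s) \<and>
     rmem s' ''acc'' 0 0 = (\<Sum>i<k. \<Sum>t<m. if (i, t) \<in> found s then rmem s ''w'' i t else 0)"], goal_cases)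
  case (5 k s1)
  let ?g = "\<lambda>i t. if (i, t) \<in> found s then rmem s ''w'' i t else 0"
  from 5(1) have s1: "nmem s1 ''win'' = nmem s ''win''" "nmem s1 ''cap'' = nmem s ''cap''"
      "nmem s1 ''m'' = nmem s ''m''" "rmem s1 ''w'' = rmem s ''w''"
    by (auto simp: unchanged_def array_set_other)
  show ?case
  proof (rule run_For[where b = m and Inv = "\<lambda>l s'.
      (\<forall>i t. t < m \<longrightarrow> i < k \<or> i = k \<and> t < l \<longrightarrow> (nmem s' ''F'' i t \<noteq> 0 \<longleftrightarrow> (i, t) \<in> found s)) \<and>
      rmem s' ''acc'' 0 0 = (\<Sum>i<k. \<Sum>t<m. ?g i t) + (\<Sum>t<l. ?g k t)"], goal_cases)
    case (5 l s2)
    from 5(1) have s2: "nmem s2 ''win'' = nmem s ''win''" "nmem s2 ''cap'' = nmem s ''cap''"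
        "rmem s2 ''w'' = rmem s ''w''" "nmem s2 ''i'' 0 0 = k" "nmem s2 ''t'' 0 0 = l"
      using s1 \<open>nmem s1 ''i'' 0 0 = k\<close> \<open>nmem s2 ''t'' 0 0 = l\<close> by (auto simp: unchanged_def)
    have kl: "(k, l) \<in> found s \<longleftrightarrow> 0 < nmem s ''win'' k 0 \<and> 0 < nmem s ''cap'' (nmem s ''win'' k 0 + l) (snode k)"
      using 5(2) \<open>k < n\<close> by (simp add: found_def)
    show ?case
    proof (rule run_Cond)
      assume "bval (BAnd (NLess (NConst 0) (NCell ''win'' (nvar ''i'') (NConst 0)))
             (NLess (NConst 0) (NCell ''cap'' (NPlus (NCell ''win'' (nvar ''i'') (NConst 0)) (nvar ''t''))
                (NPlus (NConst 1) (nvar ''i''))))) s2"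
      then have "(k, l) \<in> found s" by (simp add: kl s2 snode_def)
      then show "run L (Seq (NAssign ''F'' (nvar ''i'') (nvar ''t'') (NConst 1))
            (rset ''acc'' (RPlus (rvar ''acc'') (RCell ''w'' (nvar ''i'') (nvar ''t''))))) s2
         (\<lambda>s'. (\<forall>i t. t < m \<longrightarrow> i < k \<or> i = k \<and> t < Suc l \<longrightarrow>
             (nmem (set_nat s' ''t'' 0 0 (Suc l)) ''F'' i t \<noteq> 0 \<longleftrightarrow> (i, t) \<in> found s)) \<and>
           rmem (set_nat s' ''t'' 0 0 (Suc l)) ''acc'' 0 0 = (\<Sum>i<k. \<Sum>t<m. ?g i t) + (\<Sum>t<Suc l. ?g k t))"
        using 5(3) s2 by - (rule run_Seq, rule run_NAssign, rule run_RAssign, auto simp: less_Suc_eq)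
    next
      assume "\<not> bval (BAnd (NLess (NConst 0) (NCell ''win'' (nvar ''i'') (NConst 0)))
             (NLess (NConst 0) (NCell ''cap'' (NPlus (NCell ''win'' (nvar ''i'') (NConst 0)) (nvar ''t''))
                (NPlus (NConst 1) (nvar ''i''))))) s2"
      then have "(k, l) \<notin> found s" by (simp add: kl s2 snode_def)
      then show "run L (NAssign ''F'' (nvar ''i'') (nvar ''t'') (NConst 0)) s2
         (\<lambda>s'. (\<forall>i t. t < m \<longrightarrow> i < k \<or> i = k \<and> t < Suc l \<longrightarrow>
             (nmem (set_nat s' ''t'' 0 0 (Suc l)) ''F'' i t \<noteq> 0 \<longleftrightarrow> (i, t) \<in> found s)) \<and>
           rmem (set_nat s' ''t'' 0 0 (Suc l)) ''acc'' 0 0 = (\<Sum>i<k. \<Sum>t<m. ?g i t) + (\<Sum>t<Suc l. ?g k t))"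
        using 5(3) s2 by - (rule run_NAssign, auto simp: less_Suc_eq)
    qed
  qed (use 5 s1 s nm_le_L in \<open>auto simp: ready_def unchanged_def less_Suc_eq\<close>)
qed (use s nm_le_L in \<open>auto simp: ready_def unchanged_def array_set_other\<close>)

lemma run_keep:
  assumes s: "ready I s"
  shows "run L keep_com s (\<lambda>s'.
     if rmem s ''best'' 0 0 < rmem s ''acc'' 0 0
     then rmem s' ''best'' 0 0 = rmem s ''acc'' 0 0 \<and> (\<forall>i<n. \<forall>t<m. nmem s' ''M'' i t = nmem s ''F'' i t)
     else s' = s)"
  unfolding keep_com_def
proof (rule run_Cond)
  assume "bval (RLess (rvar ''best'') (rvar ''acc'')) s"
  then have less: "rmem s ''best'' 0 0 < rmem s ''acc'' 0 0" by simp
  show "run L (Seq (rset ''best'' (rvar ''acc''))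
       (For ''i'' (nvar ''n'') (For ''t'' (nvar ''m'')
         (NAssign ''M'' (nvar ''i'') (nvar ''t'') (NCell ''F'' (nvar ''i'') (nvar ''t'')))))) s
    (\<lambda>s'. if rmem s ''best'' 0 0 < rmem s ''acc'' 0 0
     then rmem s' ''best'' 0 0 = rmem s ''acc'' 0 0 \<and> (\<forall>i<n. \<forall>t<m. nmem s' ''M'' i t = nmem s ''F'' i t)
     else s' = s)"
  proof (intro run_Seq run_RAssign, rule run_For[where b = n and Inv = "\<lambda>k s'.
      \<forall>i<k. \<forall>t<m. nmem s' ''M'' i t = nmem s ''F'' i t"], goal_cases)
    case (5 k s1)
    from 5(1) have s1: "nmem s1 ''F'' = nmem s ''F''" "nmem s1 ''m'' = nmem s ''m''"
      by (auto simp: unchanged_def array_set_other)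
    show ?case
    proof (rule run_For[where b = m and Inv = "\<lambda>l s'.
      \<forall>i t. t < m \<longrightarrow> i < k \<or> i = k \<and> t < l \<longrightarrow> nmem s' ''M'' i t = nmem s ''F'' i t"], goal_cases)
      case (5 l s2)
      from 5(1) have "nmem s2 ''F'' = nmem s ''F''" "nmem s2 ''i'' 0 0 = k" "nmem s2 ''t'' 0 0 = l"
        using s1 \<open>nmem s1 ''i'' 0 0 = k\<close> \<open>nmem s2 ''t'' 0 0 = l\<close> by (auto simp: unchanged_def)
      with 5(3) show ?case by - (rule run_NAssign, auto simp: less_Suc_eq)
    qed (use 5 s1 s nm_le_L in \<open>auto simp: ready_def unchanged_def less_Suc_eq\<close>)
  qed (use s nm_le_L less in \<open>auto simp: ready_def unchanged_def array_set_other\<close>)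
next
  assume "\<not> bval (RLess (rvar ''best'') (rvar ''acc'')) s"
  then show "run L Skip s (\<lambda>s'. if rmem s ''best'' 0 0 < rmem s ''acc'' 0 0
     then rmem s' ''best'' 0 0 = rmem s ''acc'' 0 0 \<and> (\<forall>i<n. \<forall>t<m. nmem s' ''M'' i t = nmem s ''F'' i t)
     else s' = s)"
    by (intro run_Skip) simp
qed

text \<open>The cells that the program inspects are those that define \<open>chosen\<close>, so the
  guarantee for the circulation carries over to the candidate.\<close>

lemma found_restricted_optimum:
  assumes h: "h < n" and b: "block_nodes h s" and net: "net h (kept_edges I h) s"
  shows "restricted_optimum h (found s)" "found s \<subseteq> kept_edges I h"
proof -
  from net obtain C where C: "circulation N C (nmem s ''cap'')"
     "capacities n m (block I h) (cap_S I) (cap_T I) (\<lambda>_ _. 1) (kept_edges I h) C"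
     "arc_costs n m (block I h) (weight I) (kept_edges I h) (rmem s ''c'')"
     "nonneg_arcs N (nmem s ''cap'') (reduced (rmem s ''c'') (\<lambda>x. rmem s ''pot'' x 0))"
    unfolding net_def by blast
  let ?J = "kept_edges I h"
  have J: "?J \<subseteq> {..<n} \<times> {..<m}" using edges_subset by (auto simp: kept_edges_def)
  have opt: "optimal_circulation n m (block I h) (cap_S I) (cap_T I) (weight I) ?J C
      (nmem s ''cap'') (rmem s ''c'') (\<lambda>x. rmem s ''pot'' x 0)"
    by unfold_locales (use C J block_less in auto)
  interpret optimal_circulation n m "block I h" "cap_S I" "cap_T I" "weight I" ?J C
    "nmem s ''cap''" "rmem s ''c''" "\<lambda>x. rmem s ''pot'' x 0"
    by (fact opt)
  \<comment> \<open>A pair that is not a kept edge has no capacity in either direction, hence no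
    residual capacity. This is why the program can extract edges without consulting
    \<open>''E''\<close>.\<close>
  have in_J: "(i, t) \<in> ?J" if "i < n" "t < m" "0 < nmem s ''cap'' (wnode n m (block I h i) t) (snode i)" for i t
  proof (rule ccontr)
    assume "(i, t) \<notin> ?J"
    then have "C (snode i) (wnode n m (block I h i) t) = 0" "C (wnode n m (block I h i) t) (snode i) = 0"
      using C(2) that block_less by (simp_all add: capacities_def)
    then show False
      using residual_sum[of "snode i" "wnode n m (block I h i) t"] that block_less by (simp add: node_less)
  qed
  have "(i, t) \<in> found s \<longleftrightarrow> (i, t) \<in> chosen" for i t
  proof (cases "i < n \<and> t < m")
    case True
    have w: "wnode n m j 0 + t = wnode n m j t" for j by (simp add: wnode_def)
    show ?thesis
    proof (cases "kept I h i")
      case kept: True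
      then have "nmem s ''win'' i 0 = wnode n m (block I h i) 0" using b True by (simp add: block_nodes_def)
      moreover have "0 < wnode n m (block I h i) 0" by (simp add: wnode_def)
      ultimately show ?thesis using True in_J by (auto simp: found_def chosen_def w)
    next
      case False
      then have "(i, t) \<notin> ?J" "nmem s ''win'' i 0 = 0"
        using b True by (auto simp: block_nodes_def kept_edges_def)
      then show ?thesis by (simp add: found_def chosen_def)
    qed
  next
    case False
    then show ?thesis using J by (auto simp: found_def chosen_def)
  qed
  then have eq: "found s = chosen" by auto
  show "restricted_optimum h (found s)" unfolding eq by (rule restricted_optimum_chosen[OF h opt])
  show "found s \<subseteq> ?J" unfolding eq chosen_def by blast
qed

text \<open>The last clause makes \<open>''best''\<close> the bound B for \<open>averaging\<close>
  once all starting points have been tried.\<close>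

definition best_so_far :: "nat \<Rightarrow> state \<Rightarrow> bool" where
  "best_so_far k s \<longleftrightarrow> cyclic_matching I (output_edges I s) \<and>
     rmem s ''best'' 0 0 = matching_weight I (output_edges I s) \<and>
     (\<forall>h<k. \<forall>x. lp_feasible I x \<longrightarrow> (\<Sum>e\<in>kept_edges I h. weight I e * x e) \<le> rmem s ''best'' 0 0)"

lemma best_so_far_cong:
  "nmem s' ''M'' = nmem s ''M'' \<Longrightarrow> rmem s' ''best'' = rmem s ''best'' \<Longrightarrow> best_so_far k s' = best_so_far k s"
  by (simp add: best_so_far_def output_edges_def)

lemma best_so_far_step:
  assumes s: "best_so_far h s" and h: "h < n" and M: "restricted_optimum h M" "M \<subseteq> {..<n} \<times> {..<m}"
    and step: "if rmem s ''best'' 0 0 < matching_weight I M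
      then rmem s' ''best'' 0 0 = matching_weight I M \<and> (\<forall>i<n. \<forall>t<m. nmem s' ''M'' i t \<noteq> 0 \<longleftrightarrow> (i, t) \<in> M)
      else nmem s' ''M'' = nmem s ''M'' \<and> rmem s' ''best'' = rmem s ''best''"
  shows "best_so_far (Suc h) s'"
proof (cases "rmem s ''best'' 0 0 < matching_weight I M")
  case True
  then have "output_edges I s' = M" using step M(2) by (auto simp: output_edges_def)
  then show ?thesis using True s step M(1)
    by (fastforce simp: best_so_far_def restricted_optimum_def less_Suc_eq)
next
  case False
  then have "best_so_far h s'" using s step best_so_far_cong by metis
  then show ?thesis using False s step M(1)
    by (fastforce simp: best_so_far_def restricted_optimum_def less_Suc_eq)
qed

lemma run_main:
  "run L main_com (input_state I) (\<lambda>s'. rounding (output_edges I s'))"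
  unfolding main_com_def
proof (intro run_Seq run_NAssign, rule run_For[where b = n and
      Inv = "\<lambda>k s. nmem s ''N'' 0 0 = wnode n m k 0"], goal_cases)
  case (5 k s)
  then have "nmem s ''m'' 0 0 = m" by (auto simp: unchanged_def input_state_def array_set_other)
  with 5(3) show ?case by - (rule run_NAssign, simp add: wnode_def)
next
  case (6 s)
  then have s: "\<And>a. a \<notin> {''i'', ''N''} \<Longrightarrow> nmem s a = nmem (input_state I) a" "rmem s = rmem (input_state I)"
    by (auto simp: unchanged_def array_set_other)
  have ready: "ready I s"
    using 6(2) s edges_subset by (auto simp: ready_def node_count_def wnode_def input_state_def)
  \<comment> \<open>Memory is 0 initially, so \<open>''M''\<close> is the empty matching and
    \<open>''best''\<close> is its weight.\<close>
  have init: "best_so_far 0 s"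
    using s by (simp add: best_so_far_def output_edges_def input_state_def empty_matching matching_weight_def)
  show ?case
  proof (rule run_For[where b = n and Inv = best_so_far], goal_cases)
    case (5 h s1)
    have s1: "ready I s1" using ready 5(1) by (rule ready_unchanged) auto
    show ?case
    proof (rule run_setup[OF s1, where h = h], rule run_Seq, rule run_weaken[OF run_blocks[where h = h]])
      fix s2 s3
      assume s2: "ready I s2" "net h {} s2"
        "\<And>a. a \<notin> {''x'', ''y'', ''i'', ''t'', ''base'', ''cap''} \<Longrightarrow> nmem s2 a = nmem s1 a"
        "\<And>a. a \<notin> {''pot'', ''c''} \<Longrightarrow> rmem s2 a = rmem s1 a"
      assume un3: "unchanged blocks_com s2 s3" and blocks3: "block_nodes h s3"
      have s3: "ready I s3" using s2(1) un3 by (rule ready_unchanged) auto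
      have net3: "net h {} s3" using s2(2) un3 by (subst net_cong[of _ s2]) (auto simp: unchanged_def)
      show "run L (Seq match_com (Seq extract_com keep_com)) s3
          (\<lambda>s'. best_so_far (Suc h) (set_nat s' ''o'' 0 0 (Suc h)))"
      proof (rule run_Seq, rule run_weaken[OF run_match[OF s3 blocks3 net3]])
        fix s4
        assume un4: "unchanged match_com s3 s4" and net4: "net h (kept_edges I h) s4"
        have s4: "ready I s4" using s3 un4 by (rule ready_unchanged) auto
        have blocks4: "block_nodes h s4" using blocks3 un4 by (auto simp: unchanged_def block_nodes_def)
        let ?M = "found s4"
        note M = found_restricted_optimum[OF 5(2) blocks4 net4]
        show "run L (Seq extract_com keep_com) s4 (\<lambda>s'. best_so_far (Suc h) (set_nat s' ''o'' 0 0 (Suc h)))"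
        proof (rule run_Seq, rule run_weaken[OF run_extract[OF s4]], elim conjE)
          fix s5
          assume un5: "unchanged extract_com s4 s5"
            and F: "\<forall>i<n. \<forall>t<m. nmem s5 ''F'' i t \<noteq> 0 \<longleftrightarrow> (i, t) \<in> ?M"
            and acc: "rmem s5 ''acc'' 0 0 = (\<Sum>i<n. \<Sum>t<m. if (i, t) \<in> ?M then rmem s4 ''w'' i t else 0)"
          have s5: "ready I s5" using s4 un5 by (rule ready_unchanged) auto
          have sub: "?M \<subseteq> {..<n} \<times> {..<m}" "?M \<subseteq> edges I"
            using M(2) by (auto simp: found_def kept_edges_def)
          have w: "rmem s4 ''w'' (fst e) (snd e) = weight I e" if "e \<in> ?M" for e
            using s4 subsetD[OF sub(2) that] unfolding ready_def by (cases e) auto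
          have "rmem s5 ''acc'' 0 0 = (\<Sum>e\<in>{..<n} \<times> {..<m}. if e \<in> ?M then rmem s4 ''w'' (fst e) (snd e) else 0)"
            unfolding acc by (simp add: sum.cartesian_product case_prod_unfold)
          also have "\<dots> = matching_weight I ?M"
            unfolding matching_weight_def using sub w
            by (intro sum.mono_neutral_cong_right) auto
          finally have acc: "rmem s5 ''acc'' 0 0 = matching_weight I ?M" .
          have "nmem s5 ''M'' = nmem s1 ''M''" "rmem s5 ''best'' = rmem s1 ''best''"
            using un5 un4 un3 s2 by (auto simp: unchanged_def)
          then have best5: "best_so_far h s5" using 5(3) best_so_far_cong by metis
          show "run L keep_com s5 (\<lambda>s'. best_so_far (Suc h) (set_nat s' ''o'' 0 0 (Suc h)))"
          proof (rule run_weaken[OF run_keep[OF s5]], goal_cases)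
            case (1 s6)
            have "best_so_far (Suc h) s6"
              by (rule best_so_far_step[OF best5 5(2) M(1) sub(1)]) (use 1(2) F in \<open>auto simp: acc split: if_splits\<close>)
            then show ?case by (subst best_so_far_cong[of _ s6]) (simp_all add: array_set_other)
          qed
        qed
      qed
    qed (use 5 in \<open>auto simp: unchanged_def\<close>)
  next
    case (6 s')
    have "rounding (output_edges I s')"
      unfolding rounding_def
    proof (intro conjI allI impI)
      show "cyclic_matching I (output_edges I s')" using 6(2) by (simp add: best_so_far_def)
      fix x assume "lp_feasible I x"
      then show "(\<Sum>e\<in>edges I. weight I e * x e) \<le> (2 - 1 / real d) * matching_weight I (output_edges I s')"
        using 6(2) matching_weight_nonneg by (intro averaging) (auto simp: best_so_far_def)
    qed
    then show ?case .
  next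
    case 4
    show ?case using init by (subst best_so_far_cong[of _ s]) (simp_all add: array_set_other)
  qed (use ready nm_le_L in \<open>auto simp: ready_def unchanged_def\<close>)
qed (use nm_le_L in \<open>auto simp: unchanged_def array_set_other input_state_def nval_tnode_exp tnode_def wnode_def\<close>)

end

theorem theorem1:
  "(\<forall>d::nat. 0 < d \<longrightarrow>
      integrality_gap d \<le> ereal (2 - 1 / real d) \<and>
      (\<exists>I\<in>divisible_problems d. gap_ratio I = ereal (2 - 1 / real d))) \<and>
   (\<exists>(c::com) (p::nat poly). \<forall>(d::nat) I. 0 < d \<longrightarrow> I \<in> divisible_problems d \<longrightarrow>
      (\<exists>k s. exec c (input_state I) k s \<and>
             k \<le> poly p (problem_size I) \<and>
             cyclic_matching I (output_edges I s) \<and>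
             matching_weight I (output_edges I s) \<ge> 1 / (2 - 1 / real d) * max_matching_weight I))"
proof -
  \<comment> \<open>With z the problem size, 1 + z + z * z bounds 1 + n + m + n * m, the number of
    network nodes, and with it the rounds of every loop.\<close>
  define size_poly :: "nat poly" where "size_poly = [:1, 1, 1:]"
  obtain p where p: "\<And>z. cost (poly size_poly z) main_com = poly p z" using cost_polynomial by blast
  have main: "\<exists>k s. exec main_com (input_state I) k s \<and> k \<le> poly p (problem_size I) \<and>
      divisible_instance.rounding I (output_edges I s)"
    and inst: "divisible_instance I" if "I \<in> divisible_problems d" for I d
  proof -
    have I: "valid_problem I" "0 < min_dist I" "block_length I dvd num_S I"
      using that by (auto simp: divisible_problems_def block_length_def)
    then show "divisible_instance I" by unfold_locales
    let ?z = "problem_size I"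
    have "num_S I * num_T I \<le> ?z * ?z" by (intro mult_le_mono) (auto simp: problem_size_def)
    then have "node_count (num_S I) (num_T I) \<le> poly size_poly ?z"
      by (simp add: node_count_def size_poly_def problem_size_def)
    then interpret algorithm I "poly size_poly ?z" using I by unfold_locales
    show "\<exists>k s. exec main_com (input_state I) k s \<and> k \<le> poly p ?z \<and> rounding (output_edges I s)"
      using run_main by (simp add: run_def p)
  qed
  have gap: "gap_ratio I \<le> ereal (2 - 1 / real d)" if I: "I \<in> divisible_problems d" for I d
  proof -
    have "min_dist I = d" using I by (simp add: divisible_problems_def)
    then show ?thesis using main[OF I] divisible_instance.rounding_gap[OF inst[OF I]] by blast
  qed
  show ?thesis
  proof (intro conjI allI impI)
    fix d :: nat assume "0 < d"
    show "integrality_gap d \<le> ereal (2 - 1 / real d)"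
      unfolding integrality_gap_def by (intro SUP_least gap)
    \<comment> \<open>The upper bound, applied to the tight instance itself, turns its lower bound
      into an equality.\<close>
    show "\<exists>I\<in>divisible_problems d. gap_ratio I = ereal (2 - 1 / real d)"
      using tight_problem_divisible[OF \<open>0 < d\<close>] tight_problem_ratio[OF \<open>0 < d\<close>] gap by (metis antisym)
  next
    show "\<exists>c (p::nat poly). \<forall>d I. 0 < d \<longrightarrow> I \<in> divisible_problems d \<longrightarrow>
      (\<exists>k s. exec c (input_state I) k s \<and> k \<le> poly p (problem_size I) \<and>
             cyclic_matching I (output_edges I s) \<and>
             matching_weight I (output_edges I s) \<ge> 1 / (2 - 1 / real d) * max_matching_weight I)"
    proof (intro exI[of _ main_com] exI[of _ p] allI impI)
      fix d I assume I: "I \<in> divisible_problems d"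
      then have "min_dist I = d" by (simp add: divisible_problems_def)
      then show "\<exists>k s. exec main_com (input_state I) k s \<and> k \<le> poly p (problem_size I) \<and>
             cyclic_matching I (output_edges I s) \<and>
             matching_weight I (output_edges I s) \<ge> 1 / (2 - 1 / real d) * max_matching_weight I"
        using main[OF I] divisible_instance.rounding_approx[OF inst[OF I]]
          divisible_instance.rounding_def[OF inst[OF I]] by blast
    qed
  qed
qed

end
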